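(* Let $d\in\mathbb{N}$ (with $d\ge 1$), and let $\mathcal{A}$ be a proper Segal subalgebra of $L^1(\mathbb{R}^d)$. Then $\mathcal{A}$ is not approximately amenable.
   Context: $L^1(\mathbb{R}^d)$ is the group algebra with convolution product. A Segal subalgebra of $L^1(\mathbb{R}^d)$ (in the sense of Reiter and Stegeman) is a dense linear subspace $\mathcal{A}\subseteq L^1(\mathbb{R}^d)$ equipped with a norm $\|\cdot\|_{\mathcal{A}}$ under which it is a Banach space, such that $\|f\|_{L^1}\le\|f\|_{\mathcal{A}}$ for all $f\in\mathcal{A}$; $\mathcal{A}$ is invariant under translations and $\|L_yf\|_{\mathcal{A}}=\|f\|_{\mathcal{A}}$ for all $f\in\mathcal{A}$, $y\in\mathbb{R}^d$, where $(L_yf)(x)=f(x-y)$; and for each $f\in\mathcal{A}$ the map $y\mapsto L_yf$ from $\mathbb{R}^d$ to $\mathcal{A}$ is continuous. Such an $\mathcal{A}$ is a Banach algebra under convolution. It is proper if $\mathcal{A}\ne L^1(\mathbb{R}^d)$. A continuous derivation $D$ from a Banach algebra $\mathcal{A}$ into a Banach $\mathcal{A}$-bimodule $Y$ is approximately inner if there is a net $(y_i)$ in $Y$ such that $D(a)=\lim_i (a\cdot y_i-y_i\cdot a)$ in norm for every $a\in\mathcal{A}$. The Banach algebra $\mathcal{A}$ is approximately amenable if, for every Banach $\mathcal{A}$-bimodule $X$, every continuous derivation from $\mathcal{A}$ into the dual bimodule $X^*$ is approximately inner. *)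

theory Defs
  imports "HOL-Analysis.Analysis" "HOL-Algebra.Module"
begin

section \<open>The group algebra of a Euclidean space\<close>

text \<open>
  Complex-valued integrable functions modulo equality almost everywhere. Borel measurable
  representatives suffice, as every Lebesgue integrable function agrees a.e. with a Borel one.
\<close>

definition L1_rel :: "('e::euclidean_space \<Rightarrow> complex) \<Rightarrow> ('e \<Rightarrow> complex) \<Rightarrow> bool" where
  "L1_rel f g \<longleftrightarrow> integrable lborel f \<and> integrable lborel g \<and> (AE x in lborel. f x = g x)"

quotient_type (overloaded) 'e L1 = "'e::euclidean_space \<Rightarrow> complex" / partial: L1_rel
proof (rule part_equivpI)
  show "\<exists>f :: 'e \<Rightarrow> complex. L1_rel f f"
    by (rule exI[of _ "\<lambda>_. 0"]) (simp add: L1_rel_def)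
  show "symp (L1_rel :: ('e \<Rightarrow> complex) \<Rightarrow> _)"
    by (auto simp: symp_def L1_rel_def elim!: eventually_mono)
  show "transp (L1_rel :: ('e \<Rightarrow> complex) \<Rightarrow> _)"
    unfolding transp_def L1_rel_def by (auto elim!: eventually_elim2)
qed

lemma L1_rel_norm_eq:
  assumes "L1_rel f g"
  shows "(LINT x|lborel. cmod (f x)) = (LINT x|lborel. cmod (g x))"
  using assms unfolding L1_rel_def by (intro integral_cong_AE) auto

instantiation L1 :: (euclidean_space) real_normed_vector
begin

lift_definition zero_L1 :: "'a L1" is "\<lambda>_. 0"
  by (simp add: L1_rel_def)

lift_definition plus_L1 :: "'a L1 \<Rightarrow> 'a L1 \<Rightarrow> 'a L1" is "\<lambda>f g x. f x + g x"
  unfolding L1_rel_def by (auto elim!: eventually_elim2)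

lift_definition minus_L1 :: "'a L1 \<Rightarrow> 'a L1 \<Rightarrow> 'a L1" is "\<lambda>f g x. f x - g x"
  unfolding L1_rel_def by (auto elim!: eventually_elim2)

lift_definition uminus_L1 :: "'a L1 \<Rightarrow> 'a L1" is "\<lambda>f x. - f x"
  unfolding L1_rel_def by (auto elim!: eventually_mono)

lift_definition scaleR_L1 :: "real \<Rightarrow> 'a L1 \<Rightarrow> 'a L1" is "\<lambda>r f x. r *\<^sub>R f x"
  unfolding L1_rel_def by (auto elim!: eventually_mono)

lift_definition norm_L1 :: "'a L1 \<Rightarrow> real" is "\<lambda>f. LINT x|lborel. cmod (f x)"
  by (rule L1_rel_norm_eq)

definition sgn_L1 :: "'a L1 \<Rightarrow> 'a L1" where
  "sgn_L1 f = inverse (norm f) *\<^sub>R f"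

definition dist_L1 :: "'a L1 \<Rightarrow> 'a L1 \<Rightarrow> real" where
  "dist_L1 f g = norm (f - g)"

definition uniformity_L1 :: "('a L1 \<times> 'a L1) filter" where
  "uniformity_L1 = (INF e\<in>{0 <..}. principal {(f, g). dist f g < e})"

definition open_L1 :: "'a L1 set \<Rightarrow> bool" where
  "open_L1 U \<longleftrightarrow> (\<forall>f\<in>U. eventually (\<lambda>(f', g). f' = f \<longrightarrow> g \<in> U) uniformity)"

instance
proof
  fix f g h :: "'a L1" and r s :: real and U :: "'a L1 set"
  show "f + g + h = f + (g + h)" "f + g = g + f" "0 + f = f" "- f + f = 0" "f - g = f + - g"
    by (transfer, simp add: L1_rel_def add_ac)+
  show "r *\<^sub>R (f + g) = r *\<^sub>R f + r *\<^sub>R g" "(r + s) *\<^sub>R f = r *\<^sub>R f + s *\<^sub>R f"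
    "r *\<^sub>R s *\<^sub>R f = (r * s) *\<^sub>R f" "1 *\<^sub>R f = f"
    by (transfer, simp add: L1_rel_def algebra_simps)+
  show "dist f g = norm (f - g)" by (rule dist_L1_def)
  show "sgn f = inverse (norm f) *\<^sub>R f" by (rule sgn_L1_def)
  show "uniformity = (INF e\<in>{0 <..}. principal {(f, g :: 'a L1). dist f g < e})"
    by (rule uniformity_L1_def)
  show "open U \<longleftrightarrow> (\<forall>f\<in>U. \<forall>\<^sub>F (f', g) in uniformity. f' = f \<longrightarrow> g \<in> U)"
    by (rule open_L1_def)
  show "norm f = 0 \<longleftrightarrow> f = 0"
    by transfer (auto simp: L1_rel_def integral_nonneg_eq_0_iff_AE)
  show "norm (f + g) \<le> norm f + norm g"
  proof (transfer, goal_cases)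
    case (1 f g)
    then have "integrable lborel f" "integrable lborel g"
      by (auto simp: L1_rel_def)
    then have "(LINT x|lborel. cmod (f x + g x)) \<le> (LINT x|lborel. cmod (f x) + cmod (g x))"
      by (intro integral_mono) (auto intro: norm_triangle_ineq)
    with \<open>integrable lborel f\<close> \<open>integrable lborel g\<close> show ?case by simp
  qed
  show "norm (r *\<^sub>R f) = \<bar>r\<bar> * norm f"
    by transfer simp
qed

end

lift_definition scaleC_L1 :: "complex \<Rightarrow> 'e::euclidean_space L1 \<Rightarrow> 'e L1"
  is "\<lambda>c f x. c * f x"
  unfolding L1_rel_def by (auto elim!: eventually_mono)

lemma lborel_distr_reflect:
  fixes x :: "'e::euclidean_space"
  shows "distr lborel borel (\<lambda>y. x - y) = lborel"
  using lborel_affine[of "-1" x, symmetric] by (simp add: density_1)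

lemma lborel_distr_shift:
  fixes x :: "'e::euclidean_space"
  shows "distr lborel borel (\<lambda>y. y - x) = lborel"
  using lborel_affine[of 1 "- x", symmetric] by (simp add: density_1)

lemma AE_lborel_reflect:
  fixes x :: "'e::euclidean_space"
  assumes "AE y in lborel. P y"
  shows "AE y in lborel. P (x - y)"
proof -
  have "AE y in distr lborel borel (\<lambda>y. x - y). P y"
    by (simp only: lborel_distr_reflect assms)
  then show ?thesis by (rule AE_distrD[rotated]) simp
qed

lemma AE_lborel_shift:
  fixes x :: "'e::euclidean_space"
  assumes "AE y in lborel. P y"
  shows "AE y in lborel. P (y - x)"
proof -
  have "AE y in distr lborel borel (\<lambda>y. y - x). P y"
    by (simp only: lborel_distr_shift assms)
  then show ?thesis by (rule AE_distrD[rotated]) simp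
qed

lemma integrable_lborel_shift:
  fixes f :: "'e::euclidean_space \<Rightarrow> complex"
  assumes "integrable lborel f"
  shows "integrable lborel (\<lambda>y. f (y - x))"
proof -
  have "integrable (distr lborel borel (\<lambda>y. y - x)) f"
    by (simp only: lborel_distr_shift assms)
  then show ?thesis by (rule integrable_distr[rotated]) simp
qed

lemma integral_norm_lborel_shift:
  fixes f :: "'e::euclidean_space \<Rightarrow> complex"
  assumes "integrable lborel f"
  shows "(LINT y|lborel. cmod (f (y - x))) = (LINT y|lborel. cmod (f y))"
proof -
  have "f \<in> borel_measurable borel"
    using assms by simp
  then have "(LINT y|distr lborel borel (\<lambda>y. y - x). cmod (f y)) = (LINT y|lborel. cmod (f (y - x)))"
    by (intro integral_distr) auto
  then show ?thesis by (simp only: lborel_distr_shift)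
qed

lift_definition translate :: "'e::euclidean_space \<Rightarrow> 'e L1 \<Rightarrow> 'e L1"
  is "\<lambda>y f x. f (x - y)"
  unfolding L1_rel_def
  by (intro conjI integrable_lborel_shift AE_lborel_shift[where P = "\<lambda>x. _ x = _ x"]) simp_all

lemma integrable_convolution:
  fixes f g :: "'e::euclidean_space \<Rightarrow> complex"
  assumes f: "integrable lborel f" and g: "integrable lborel g"
  shows "integrable lborel (\<lambda>x. LINT y|lborel. f y * g (x - y))"
proof -
  let ?h = "\<lambda>(y, x). f y * g (x - y)"
  have [measurable]: "f \<in> borel_measurable borel" "g \<in> borel_measurable borel"
    using f g by simp_all
  have "integrable (lborel \<Otimes>\<^sub>M lborel) ?h"
  proof (rule lborel_pair.Fubini_integrable)
    show "?h \<in> borel_measurable (lborel \<Otimes>\<^sub>M lborel)" by measurable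
    have "(\<lambda>y. LINT x|lborel. cmod (?h (y, x))) = (\<lambda>y. cmod (f y) * (LINT x|lborel. cmod (g x)))"
      by (simp add: norm_mult integral_norm_lborel_shift[OF g])
    then show "integrable lborel (\<lambda>y. LINT x|lborel. cmod (?h (y, x)))"
      using f by simp
    show "AE y in lborel. integrable lborel (\<lambda>x. ?h (y, x))"
      using integrable_lborel_shift[OF g] by simp
  qed
  then show ?thesis
    using lborel_pair.integrable_snd[of "\<lambda>y x. f y * g (x - y)"] by simp
qed

lift_definition conv :: "'e::euclidean_space L1 \<Rightarrow> 'e L1 \<Rightarrow> 'e L1"
  is "\<lambda>f g x. LINT y|lborel. f y * g (x - y)"
proof -
  fix f f' g g' :: "'e \<Rightarrow> complex"
  assume *: "L1_rel f f'" "L1_rel g g'"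
  have [measurable]: "f \<in> borel_measurable borel" "g \<in> borel_measurable borel"
      "f' \<in> borel_measurable borel" "g' \<in> borel_measurable borel"
    using * by (auto simp: L1_rel_def)
  have "(LINT y|lborel. f y * g (x - y)) = (LINT y|lborel. f' y * g' (x - y))" for x
  proof (rule integral_cong_AE)
    have "AE y in lborel. f y = f' y" "AE y in lborel. g (x - y) = g' (x - y)"
      using * AE_lborel_reflect[of "\<lambda>y. g y = g' y" x] by (simp_all add: L1_rel_def)
    then show "AE y in lborel. f y * g (x - y) = f' y * g' (x - y)"
      by eventually_elim simp
  qed measurable
  then show "L1_rel (\<lambda>x. LINT y|lborel. f y * g (x - y)) (\<lambda>x. LINT y|lborel. f' y * g' (x - y))"
    using * by (simp add: L1_rel_def integrable_convolution)
qed


section \<open>Complex Banach spaces with an explicit carrier\<close>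

definition complex_ring :: "complex ring" where
  "complex_ring = \<lparr>carrier = UNIV, mult = (*), one = 1, zero = 0, add = (+)\<rparr>"

text \<open>
  The inherited field \<open>mult\<close> is the product of a Banach algebra; it is irrelevant for mere
  Banach spaces. The inherited field \<open>one\<close> is never used, so algebras need not be unital.
\<close>

record 'x normed_module = "(complex, 'x) module" +
  vnorm :: "'x \<Rightarrow> real"

text \<open>The value off the carrier is irrelevant; it is set to 0 because the locale
  \<open>Metric_space\<close> wants nonnegativity and symmetry everywhere.\<close>

definition ndist :: "('x, 'm) normed_module_scheme \<Rightarrow> 'x \<Rightarrow> 'x \<Rightarrow> real" where
  "ndist X x y = (if x \<in> carrier X \<and> y \<in> carrier X then vnorm X (x \<ominus>\<^bsub>X\<^esub> y) else 0)"

abbreviation ntopology :: "('x, 'm) normed_module_scheme \<Rightarrow> 'x topology" where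
  "ntopology X \<equiv> Metric_space.mtopology (carrier X) (ndist X)"

definition complex_banach :: "('x, 'm) normed_module_scheme \<Rightarrow> bool" where
  "complex_banach X \<longleftrightarrow>
     Module.module complex_ring X \<and>
     (\<forall>x\<in>carrier X. 0 \<le> vnorm X x) \<and>
     (\<forall>x\<in>carrier X. vnorm X x = 0 \<longleftrightarrow> x = \<zero>\<^bsub>X\<^esub>) \<and>
     (\<forall>x\<in>carrier X. \<forall>y\<in>carrier X. vnorm X (x \<oplus>\<^bsub>X\<^esub> y) \<le> vnorm X x + vnorm X y) \<and>
     (\<forall>c. \<forall>x\<in>carrier X. vnorm X (c \<odot>\<^bsub>X\<^esub> x) = cmod c * vnorm X x) \<and>
     Metric_space.mcomplete (carrier X) (ndist X)"

definition complex_linear ::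
    "('x, 'm) normed_module_scheme \<Rightarrow> ('y, 'n) normed_module_scheme \<Rightarrow> ('x \<Rightarrow> 'y) \<Rightarrow> bool" where
  "complex_linear X Y T \<longleftrightarrow>
     T \<in> carrier X \<rightarrow> carrier Y \<and>
     (\<forall>x\<in>carrier X. \<forall>x'\<in>carrier X. T (x \<oplus>\<^bsub>X\<^esub> x') = T x \<oplus>\<^bsub>Y\<^esub> T x') \<and>
     (\<forall>c. \<forall>x\<in>carrier X. T (c \<odot>\<^bsub>X\<^esub> x) = c \<odot>\<^bsub>Y\<^esub> T x)"


section \<open>Approximate amenability\<close>

record ('a, 'x) normed_bimodule = "'x normed_module" +
  lact :: "'a \<Rightarrow> 'x \<Rightarrow> 'x"
  ract :: "'x \<Rightarrow> 'a \<Rightarrow> 'x"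

definition banach_bimodule ::
    "('a, 'm) normed_module_scheme \<Rightarrow> ('a, 'x) normed_bimodule \<Rightarrow> bool" where
  "banach_bimodule A X \<longleftrightarrow>
     complex_banach X \<and>
     (\<forall>a\<in>carrier A. complex_linear X X (lact X a)) \<and>
     (\<forall>x\<in>carrier X. complex_linear A X (\<lambda>a. lact X a x)) \<and>
     (\<forall>a\<in>carrier A. complex_linear X X (\<lambda>x. ract X x a)) \<and>
     (\<forall>x\<in>carrier X. complex_linear A X (ract X x)) \<and>
     (\<forall>a\<in>carrier A. \<forall>b\<in>carrier A. \<forall>x\<in>carrier X.
        lact X a (lact X b x) = lact X (a \<otimes>\<^bsub>A\<^esub> b) x \<and>
        ract X (ract X x a) b = ract X x (a \<otimes>\<^bsub>A\<^esub> b) \<and>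
        ract X (lact X a x) b = lact X a (ract X x b)) \<and>
     (\<exists>K. \<forall>a\<in>carrier A. \<forall>x\<in>carrier X.
        vnorm X (lact X a x) \<le> K * vnorm A a * vnorm X x \<and>
        vnorm X (ract X x a) \<le> K * vnorm A a * vnorm X x)"

text \<open>
  Functionals are extensional (\<open>undefined\<close> off the carrier of \<open>X\<close>), so that equality in the dual
  is equality on the carrier.
\<close>

definition dual_bimodule :: "('a, 'x) normed_bimodule \<Rightarrow> ('a, 'x \<Rightarrow> complex) normed_bimodule" where
  "dual_bimodule X =
     \<lparr>carrier = {\<phi> \<in> extensional (carrier X).
         (\<forall>x\<in>carrier X. \<forall>y\<in>carrier X. \<phi> (x \<oplus>\<^bsub>X\<^esub> y) = \<phi> x + \<phi> y) \<and>
         (\<forall>c. \<forall>x\<in>carrier X. \<phi> (c \<odot>\<^bsub>X\<^esub> x) = c * \<phi> x) \<and>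
         (\<exists>K. \<forall>x\<in>carrier X. cmod (\<phi> x) \<le> K * vnorm X x)},
      mult = undefined,
      one = undefined,
      zero = (\<lambda>x\<in>carrier X. 0),
      add = (\<lambda>\<phi> \<psi>. \<lambda>x\<in>carrier X. \<phi> x + \<psi> x),
      smult = (\<lambda>c \<phi>. \<lambda>x\<in>carrier X. c * \<phi> x),
      vnorm = (\<lambda>\<phi>. SUP x\<in>{x \<in> carrier X. vnorm X x \<le> 1}. cmod (\<phi> x)),
      lact = (\<lambda>a \<phi>. \<lambda>x\<in>carrier X. \<phi> (ract X x a)),
      ract = (\<lambda>\<phi> a. \<lambda>x\<in>carrier X. \<phi> (lact X a x))\<rparr>"

definition continuous_derivation ::
    "('a, 'm) normed_module_scheme \<Rightarrow> ('a, 'y) normed_bimodule \<Rightarrow> ('a \<Rightarrow> 'y) \<Rightarrow> bool" where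
  "continuous_derivation A Y D \<longleftrightarrow>
     complex_linear A Y D \<and>
     continuous_map (ntopology A) (ntopology Y) D \<and>
     (\<forall>a\<in>carrier A. \<forall>b\<in>carrier A. D (a \<otimes>\<^bsub>A\<^esub> b) = lact Y a (D b) \<oplus>\<^bsub>Y\<^esub> ract Y (D a) b)"

text \<open>
  The net \<open>(y\<^sub>i)\<close> is represented by a proper filter on \<open>Y\<close> (its filter of tails); conversely, every
  proper filter containing the carrier is the tail filter of a net in the carrier.
\<close>

definition approximately_inner ::
    "('a, 'm) normed_module_scheme \<Rightarrow> ('a, 'y) normed_bimodule \<Rightarrow> ('a \<Rightarrow> 'y) \<Rightarrow> bool" where
  "approximately_inner A Y D \<longleftrightarrow>
     (\<exists>F. F \<noteq> bot \<and> (\<forall>\<^sub>F y in F. y \<in> carrier Y) \<and>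
        (\<forall>a\<in>carrier A. limitin (ntopology Y) (\<lambda>y. lact Y a y \<ominus>\<^bsub>Y\<^esub> ract Y y a) (D a) F))"

text \<open>
  HOL cannot quantify over all types inside a formula, so the bimodules range over those whose
  underlying set lies in a given type \<open>'x\<close>. Failure for one choice of \<open>'x\<close> implies failure of
  approximate amenability in the unrestricted sense.
\<close>

definition approximately_amenable ::
    "'x itself \<Rightarrow> ('a, 'm) normed_module_scheme \<Rightarrow> bool" where
  "approximately_amenable (_ :: 'x itself) A \<longleftrightarrow>
     (\<forall>(X :: ('a, 'x) normed_bimodule) D.
        banach_bimodule A X \<longrightarrow> continuous_derivation A (dual_bimodule X) D \<longrightarrow>
        approximately_inner A (dual_bimodule X) D)"

text \<open>
  A type with room for the decisive bimodule. With \<open>A\<^sup>#\<close> the unitization, realised on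
  \<open>complex \<times> 'a\<close>, the bounded bilinear forms on \<open>A\<^sup># \<times> A\<^sup>#\<close> are the dual of the projective tensor
  square of \<open>A\<^sup>#\<close>. \<open>A\<close> is approximately amenable iff the derivation \<open>a \<mapsto> a \<otimes> 1 - 1 \<otimes> a\<close> into
  the bidual of \<open>K\<close>, the kernel of the product map on that square, is approximately inner. The
  predual \<open>K\<^sup>*\<close> of that bidual is a quotient of the space of bilinear forms; the forms \<open>\<Phi>\<close> with
  \<open>\<Phi> (u, 1) = 0\<close> for all \<open>u\<close> represent its elements uniquely. So for \<open>'x = 'a bimodule_univ\<close> the
  restricted notion is equivalent to the unrestricted one.
\<close>

type_synonym 'a bimodule_univ = "complex \<times> 'a \<Rightarrow> complex \<times> 'a \<Rightarrow> complex"


section \<open>Segal algebras\<close>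

definition L1_subalgebra ::
    "'e::euclidean_space L1 set \<Rightarrow> ('e L1 \<Rightarrow> real) \<Rightarrow> 'e L1 normed_module" where
  "L1_subalgebra S N =
     \<lparr>carrier = S, mult = conv, one = undefined, zero = 0, add = (+), smult = scaleC_L1,
      vnorm = N\<rparr>"

definition segal_algebra :: "'e::euclidean_space L1 set \<Rightarrow> ('e L1 \<Rightarrow> real) \<Rightarrow> bool" where
  "segal_algebra S N \<longleftrightarrow>
     complex_banach (L1_subalgebra S N) \<and>
     closure S = UNIV \<and>
     (\<forall>f\<in>S. norm f \<le> N f) \<and>
     (\<forall>f\<in>S. \<forall>y. translate y f \<in> S \<and> N (translate y f) = N f) \<and>
     (\<forall>f\<in>S. continuous_map euclidean (ntopology (L1_subalgebra S N)) (\<lambda>y. translate y f))"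

end

theory Submission
  imports Defs "HOL-Probability.Sinc_Integral"
begin

text \<open>
  \<open>S\<close> is an ideal of \<open>L\<^sup>1\<close> with \<open>N (f * g) \<le> \<parallel>f\<parallel> N g\<close>, since \<open>f * g\<close> is an \<open>S\<close>-valued integral of
  translates of \<open>g\<close>. Take the de la Vallee-Poussin kernels \<open>E\<^sub>n\<close> at scale \<open>2\<^sup>n\<close>: they are bounded in \<open>L\<^sup>1\<close>,
  \<open>E\<^sub>n E\<^bsub>n+1\<^esub> = E\<^sub>n\<close>, and therefore they lie in \<open>S\<close> and act on it with bounded multiplier norms. If \<open>N (E\<^sub>n)\<close>
  were bounded as well, then \<open>N\<close> and the \<open>L\<^sup>1\<close> norm would be equivalent and \<open>S\<close> would be everything.

  A commutative Banach algebra with such an unbounded but multiplier-bounded sequence is not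
  approximately amenable. Otherwise there is an approximate diagonal with one-sided components
  \<open>p\<close>, \<open>q\<close> in the bidual such that \<open>a p \<approx> a\<close> for finitely many prescribed \<open>a\<close>. Prescribing series
  \<open>\<Sum> c\<^sub>k G\<^sub>k\<close> and \<open>\<Sum> c\<^sub>k G\<^sub>k\<^sup>2\<close> over a rapidly growing subsequence \<open>G\<close> and eliminating the two-sided
  component, one finds that \<open>p\<close> acts as a nearly constant scalar all along the sequence. This
  scalar is close to 1 at the beginning, but it tends to 0 because \<open>p\<close> is bounded while \<open>N (G\<^sub>k)\<close> is not.
\<close>


section \<open>The Hahn-Banach theorem\<close>

text \<open>Approximate innerness yields, for each finite set of elements and each tolerance, one
  functional on the bilinear forms, with no control over its norm. Infinitely many conditions, one
  for each step of the sequence, must therefore be read off from finitely many elements; this is why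
  they are packed into series. The price is a coefficient
  \<open>c j = (1/2) ^ j / N (G (3 * j))\<close> in front of each condition. Dividing it out leaves
  an error of order \<open>2 ^ i\<close> at step i, and the fourfold growth of the norms turns this
  into a geometric series.

  The series of squares makes up for the lack of idempotents, of which L^1 of a Euclidean space has
  none but 0. With idempotent kernels a difference \<open>D\<close> of two of them straddling a step
  would be an eigenvector of multiplication by the first series, and one form would suffice. In
  general the product with the series contains \<open>G\<^sup>2\<close>, and a second element
  producing the same \<open>G\<^sup>2\<close> is needed to remove it.

  Membership of the kernels in \<open>S\<close> is not read off from a formula: each has the next
  one as a local unit, and a dense ideal that is complete in a finer norm contains every element
  with a local unit.\<close>

definition sublinear_on :: "'a::real_vector set \<Rightarrow> ('a \<Rightarrow> real) \<Rightarrow> bool" where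
  "sublinear_on S q \<longleftrightarrow> (\<forall>x\<in>S. \<forall>y\<in>S. q (x + y) \<le> q x + q y) \<and>
     (\<forall>r\<ge>0. \<forall>x\<in>S. q (r *\<^sub>R x) = r * q x)"

lemma sublinear_onD:
  assumes "sublinear_on S q"
  shows "x \<in> S \<Longrightarrow> y \<in> S \<Longrightarrow> q (x + y) \<le> q x + q y"
    and "r \<ge> 0 \<Longrightarrow> x \<in> S \<Longrightarrow> q (r *\<^sub>R x) = r * q x"
  using assms by (auto simp: sublinear_on_def)

lemma sublinear_on_zero:
  assumes "sublinear_on S q" "subspace S"
  shows "q 0 = 0"
  using sublinear_onD(2)[OF assms(1), of 0 0] subspace_0[OF assms(2)] by simp

lemma sublinear_on_minus:
  assumes "sublinear_on S q" "subspace S" "x \<in> S"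
  shows "- q (- x) \<le> q x"
  using sublinear_onD(1)[OF assms(1), of x "- x"] sublinear_on_zero[OF assms(1,2)]
    subspace_neg[OF assms(2,3)] assms(3) by simp

text \<open>The infimum of \<open>q (x + t *\<^sub>R y) - t * q y\<close> over t \<ge> 0 is again
  sublinear and lowers q towards oddness in the direction y; t = 1 at the point -y gives the last
  inequality.\<close>

lemma sublinear_on_directional:
  assumes S: "subspace S" and q: "sublinear_on S q" and y: "y \<in> S"
  obtains q' where "sublinear_on S q'" "\<And>x. x \<in> S \<Longrightarrow> q' x \<le> q x" "q' (- y) \<le> - q y"
proof -
  define h where "h x t = q (x + t *\<^sub>R y) - t * q y" for x t
  define q' where "q' x = (if x \<in> S then Inf (h x ` {0..}) else 0)" for x
  have mem [simp]: "x + t *\<^sub>R y \<in> S" if "x \<in> S" for x t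
    using S y that by (auto intro: subspace_add subspace_scale)
  have lower: "- q (- x) \<le> h x t" if "x \<in> S" "t \<ge> 0" for x t
  proof -
    have "q (t *\<^sub>R y) \<le> q (x + t *\<^sub>R y) + q (- x)"
      using sublinear_onD(1)[OF q mem[OF that(1)] subspace_neg[OF S that(1)]] by simp
    then show ?thesis
      using sublinear_onD(2)[OF q that(2) y] by (simp add: h_def)
  qed
  have bdd: "bdd_below (h x ` {0..})" if "x \<in> S" for x
    using lower[OF that] by (intro bdd_belowI2[where m = "- q (- x)"]) auto
  have le: "q' x \<le> h x t" if "x \<in> S" "t \<ge> 0" for x t
    using that bdd[OF that(1)] by (auto simp: q'_def intro!: cINF_lower)
  have ge: "c \<le> q' x" if "x \<in> S" "\<And>t. t \<ge> 0 \<Longrightarrow> c \<le> h x t" for x c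
    using that by (auto simp: q'_def intro!: cINF_greatest)
  have sub: "q' (x + z) \<le> q' x + q' z" if "x \<in> S" "z \<in> S" for x z
  proof -
    have "q' (x + z) \<le> h x s + h z t" if st: "s \<ge> 0" "t \<ge> 0" for s t
    proof -
      have "q' (x + z) \<le> h (x + z) (s + t)"
        using le[of "x + z" "s + t"] \<open>x \<in> S\<close> \<open>z \<in> S\<close> st subspace_add[OF S] by simp
      also have "\<dots> \<le> h x s + h z t"
        using sublinear_onD(1)[OF q mem[OF \<open>x \<in> S\<close>, of s] mem[OF \<open>z \<in> S\<close>, of t]]
        by (simp add: h_def algebra_simps)
      finally show ?thesis .
    qed
    then have "q' (x + z) - h x s \<le> q' z" if "s \<ge> 0" for s
      using that \<open>z \<in> S\<close> by (intro ge) (auto simp: algebra_simps)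
    then have "q' (x + z) - q' z \<le> q' x"
      using \<open>x \<in> S\<close> by (intro ge) (auto simp: algebra_simps)
    then show ?thesis by simp
  qed
  have hom_le: "r * q' x \<le> q' (r *\<^sub>R x)" if "x \<in> S" "r > 0" for x r
  proof (rule ge)
    show "r *\<^sub>R x \<in> S" using S that by (simp add: subspace_scale)
    fix t :: real assume t: "t \<ge> 0"
    have "r * q' x \<le> r * h x (t / r)"
      using le[OF that(1), of "t / r"] that t by (intro mult_left_mono) auto
    also have "\<dots> = q (r *\<^sub>R (x + (t / r) *\<^sub>R y)) - t * q y"
      using sublinear_onD(2)[OF q, of r "x + (t / r) *\<^sub>R y"] that by (simp add: h_def algebra_simps)
    also have "r *\<^sub>R (x + (t / r) *\<^sub>R y) = r *\<^sub>R x + t *\<^sub>R y"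
      using that by (simp add: algebra_simps)
    finally show "r * q' x \<le> h (r *\<^sub>R x) t" by (simp add: h_def)
  qed
  have hom: "q' (r *\<^sub>R x) = r * q' x" if "x \<in> S" "r \<ge> 0" for x r
  proof (cases "r = 0")
    case True
    have 0: "0 \<in> S" using S by (rule subspace_0)
    have "0 \<le> q' 0"
      using lower[OF 0] sublinear_on_zero[OF q S] by (intro ge[OF 0]) force
    moreover have "q' 0 \<le> 0"
      using le[OF 0, of 0] sublinear_on_zero[OF q S] by (simp add: h_def)
    ultimately show ?thesis using True by simp
  next
    case False
    with that have "r > 0" by simp
    have "r * (inverse r * q' (r *\<^sub>R x)) \<le> r * q' x"
      using hom_le[of "r *\<^sub>R x" "inverse r"] that \<open>r > 0\<close> S
      by (intro mult_left_mono) (simp_all add: subspace_scale)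
    with \<open>r > 0\<close> have "q' (r *\<^sub>R x) \<le> r * q' x" by (simp add: mult.assoc[symmetric])
    with hom_le[OF that(1) \<open>r > 0\<close>] show ?thesis by simp
  qed
  have "q' (- y) \<le> h (- y) 1" using le[of "- y" 1] S y by (simp add: subspace_neg)
  also have "\<dots> = - q y" using sublinear_on_zero[OF q S] by (simp add: h_def)
  finally have "q' (- y) \<le> - q y" .
  moreover have "q' x \<le> q x" if "x \<in> S" for x using le[OF that, of 0] by (simp add: h_def)
  ultimately show ?thesis
    using that[of q'] sub hom by (auto simp: sublinear_on_def q'_def)
qed

text \<open>Zorn's lemma for the pointwise order. The infimum over a chain is finite, because each
  member is at least \<open>- p (- x)\<close> at x, and it is subadditive, because of two members of
  a chain one lies below both.\<close>

lemma minimal_sublinear_on: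
  assumes S: "subspace S" and p: "sublinear_on S p"
  obtains q where "sublinear_on S q" "\<And>x. x \<in> S \<Longrightarrow> q x \<le> p x"
    "\<And>q' x. sublinear_on S q' \<Longrightarrow> (\<And>x. x \<in> S \<Longrightarrow> q' x \<le> q x) \<Longrightarrow> x \<in> S \<Longrightarrow> q' x = q x"
proof -
  \<comment> \<open>The value 0 off \<open>S\<close> turns comparison on \<open>S\<close> into
    comparison of functions.\<close>
  define A where "A = {q. sublinear_on S q \<and> (\<forall>x\<in>S. q x \<le> p x) \<and> (\<forall>x. x \<notin> S \<longrightarrow> q x = 0)}"
  define P :: "('a \<Rightarrow> real) \<Rightarrow> ('a \<Rightarrow> real) \<Rightarrow> bool" where "P = (\<lambda>q q'. q' \<le> q)"
  have "\<exists>m\<in>A. \<forall>a\<in>A. P m a \<longrightarrow> a = m"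
  proof (rule predicate_Zorn)
    show "partial_order_on A (relation_of P A)"
      by (auto simp: P_def partial_order_on_def preorder_on_def refl_on_def trans_def antisym_def
          relation_of_def)
    fix C assume "C \<in> Chains (relation_of P A)"
    then have CA: "C \<subseteq> A" and chain: "\<And>q q'. q \<in> C \<Longrightarrow> q' \<in> C \<Longrightarrow> q \<le> q' \<or> q' \<le> q"
      by (auto simp: Chains_def relation_of_def P_def)
    show "\<exists>u\<in>A. \<forall>a\<in>C. P a u"
    proof (cases "C = {}")
      case True
      have "(\<lambda>x. if x \<in> S then p x else 0) \<in> A"
        using p S by (auto simp: A_def sublinear_on_def subspace_add subspace_scale)
      with True show ?thesis by blast
    next
      case False
      define u where "u x = (INF q\<in>C. q x)" for x
      have sl: "sublinear_on S q" if "q \<in> C" for q using CA that by (auto simp: A_def)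
      have bdd: "bdd_below ((\<lambda>q. q x) ` C)" for x
      proof (cases "x \<in> S")
        case True
        show ?thesis
        proof (rule bdd_belowI2[where m = "- p (- x)"])
          fix q assume "q \<in> C"
          with CA True S have "q (- x) \<le> p (- x)" by (auto simp: A_def subspace_neg)
          with sublinear_on_minus[OF sl[OF \<open>q \<in> C\<close>] S True] show "- p (- x) \<le> q x" by simp
        qed
      next
        case False
        with CA show ?thesis by (intro bdd_belowI2[where m = 0]) (auto simp: A_def)
      qed
      have lower: "u x \<le> q x" if "q \<in> C" for q x
        unfolding u_def by (rule cINF_lower[OF bdd that])
      have greatest: "c \<le> u x" if "\<And>q. q \<in> C \<Longrightarrow> c \<le> q x" for c x
        unfolding u_def using False that by (intro cINF_greatest) auto
      have "u (x + y) \<le> u x + u y" if "x \<in> S" "y \<in> S" for x y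
      proof -
        have uxy: "u (x + y) \<le> q x + q' y" if "q \<in> C" "q' \<in> C" for q q'
        proof -
          from chain[OF that] obtain r where r: "r \<in> C" "r \<le> q" "r \<le> q'"
          proof
            assume "q \<le> q'"
            then show ?thesis using that[of q] \<open>q \<in> C\<close> by simp
          next
            assume "q' \<le> q"
            then show ?thesis using that[of q'] \<open>q' \<in> C\<close> by simp
          qed
          have "u (x + y) \<le> r x + r y"
            using lower[OF r(1), of "x + y"] sublinear_onD(1)[OF sl[OF r(1)] \<open>x \<in> S\<close> \<open>y \<in> S\<close>] by simp
          also have "\<dots> \<le> q x + q' y" using r by (intro add_mono) (auto simp: le_fun_def)
          finally show ?thesis .
        qed
        have "u (x + y) - q x \<le> u y" if "q \<in> C" for q
        proof (rule greatest)
          fix q' assume "q' \<in> C"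
          with uxy[OF that this] show "u (x + y) - q x \<le> q' y" by simp
        qed
        then have "u (x + y) - u y \<le> q x" if "q \<in> C" for q
          using that by (smt (verit))
        then have "u (x + y) - u y \<le> u x" by (rule greatest)
        then show ?thesis by simp
      qed
      moreover have "u (r *\<^sub>R x) = r * u x" if "x \<in> S" "r \<ge> 0" for r x
      proof (cases "r = 0")
        case True
        have "u 0 = (INF q\<in>C. 0)"
          unfolding u_def using sublinear_on_zero[OF sl S] by (intro INF_cong) auto
        with False True show ?thesis by simp
      next
        case rn: False
        with that have "r > 0" by simp
        have hom: "q (r *\<^sub>R x) = r * q x" if "q \<in> C" for q
          using sublinear_onD(2)[OF sl[OF that] \<open>r \<ge> 0\<close> \<open>x \<in> S\<close>] .
        have "u (r *\<^sub>R x) / r \<le> u x"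
        proof (rule greatest)
          fix q assume "q \<in> C"
          from lower[OF this, of "r *\<^sub>R x"] hom[OF this] \<open>r > 0\<close>
          show "u (r *\<^sub>R x) / r \<le> q x" by (simp add: pos_divide_le_eq mult.commute)
        qed
        moreover have "r * u x \<le> u (r *\<^sub>R x)"
        proof (rule greatest)
          fix q assume "q \<in> C"
          from lower[OF this, of x] hom[OF this] \<open>r > 0\<close>
          show "r * u x \<le> q (r *\<^sub>R x)" by simp
        qed
        ultimately show ?thesis using \<open>r > 0\<close> by (simp add: pos_divide_le_eq mult.commute)
      qed
      ultimately have "sublinear_on S u" by (auto simp: sublinear_on_def)
      moreover obtain q0 where "q0 \<in> C" using False by blast
      then have "u x \<le> p x" if "x \<in> S" for x
        using lower[OF \<open>q0 \<in> C\<close>, of x] CA that by (force simp: A_def)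
      moreover have "u x = 0" if "x \<notin> S" for x
      proof -
        have "u x = (INF q\<in>C. 0)" unfolding u_def using CA that by (intro INF_cong) (auto simp: A_def)
        with False show ?thesis by simp
      qed
      ultimately have "u \<in> A" by (auto simp: A_def)
      with lower show ?thesis by (auto simp: P_def le_fun_def)
    qed
  qed
  then obtain q where q: "q \<in> A" and min: "\<And>q'. q' \<in> A \<Longrightarrow> q' \<le> q \<Longrightarrow> q' = q"
    by (auto simp: P_def)
  show ?thesis
  proof (rule that[of q])
    show "sublinear_on S q" "\<And>x. x \<in> S \<Longrightarrow> q x \<le> p x" using q by (auto simp: A_def)
    fix q' x assume q': "sublinear_on S q'" "\<And>x. x \<in> S \<Longrightarrow> q' x \<le> q x" "x \<in> S"
    define r where "r x = (if x \<in> S then q' x else 0)" for x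
    have "sublinear_on S r"
      using q'(1) S by (simp add: r_def sublinear_on_def subspace_add subspace_scale)
    moreover have "r x \<le> p x" if "x \<in> S" for x
      using q'(2)[OF that] q that by (force simp: r_def A_def)
    ultimately have "r \<in> A" by (simp add: A_def r_def)
    moreover have "r \<le> q" using q' q by (auto simp: le_fun_def r_def A_def)
    ultimately have "r = q" by (rule min)
    then have "r x = q x" by simp
    with q'(3) show "q' x = q x" by (simp add: r_def)
  qed
qed

text \<open>A minimal sublinear function cannot be lowered in any direction, hence is odd, and an
  odd sublinear function is linear. Equality at x0 is arranged before minimising, by lowering p in
  the direction x0.\<close>

theorem hahn_banach_real:
  assumes S: "subspace S" and p: "sublinear_on S p" and x0: "x0 \<in> S"
  obtains f where "\<And>x y. x \<in> S \<Longrightarrow> y \<in> S \<Longrightarrow> f (x + y) = f x + f y"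
    "\<And>r x. x \<in> S \<Longrightarrow> f (r *\<^sub>R x) = r * f x"
    "\<And>x. x \<in> S \<Longrightarrow> f x \<le> p x" "f x0 = p x0"
proof -
  obtain p' where p': "sublinear_on S p'" "\<And>x. x \<in> S \<Longrightarrow> p' x \<le> p x" "p' (- x0) \<le> - p x0"
    by (rule sublinear_on_directional[OF S p x0]) blast
  obtain f where f: "sublinear_on S f" "\<And>x. x \<in> S \<Longrightarrow> f x \<le> p' x"
    "\<And>q' x. sublinear_on S q' \<Longrightarrow> (\<And>x. x \<in> S \<Longrightarrow> q' x \<le> f x) \<Longrightarrow> x \<in> S \<Longrightarrow> q' x = f x"
    by (rule minimal_sublinear_on[OF S p'(1)]) blast
  have odd: "f (- y) = - f y" if y: "y \<in> S" for y
  proof -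
    obtain q where "sublinear_on S q" "\<And>x. x \<in> S \<Longrightarrow> q x \<le> f x" "q (- y) \<le> - f y"
      by (rule sublinear_on_directional[OF S f(1) y]) blast
    moreover from this have "q (- y) = f (- y)"
      using subspace_neg[OF S y] by (intro f(3))
    ultimately show ?thesis using sublinear_on_minus[OF f(1) S y] by simp
  qed
  have add: "f (x + y) = f x + f y" if "x \<in> S" "y \<in> S" for x y
    using sublinear_onD(1)[OF f(1) that] odd[OF that(2)]
      sublinear_onD(1)[OF f(1) subspace_add[OF S that] subspace_neg[OF S that(2)]] by simp
  have hom: "f (r *\<^sub>R x) = r * f x" if "x \<in> S" for r x
  proof (cases "r \<ge> 0")
    case True
    then show ?thesis using sublinear_onD(2)[OF f(1) True that] by simp
  next
    case False
    then have "f ((- r) *\<^sub>R x) = - r * f x" using sublinear_onD(2)[OF f(1) _ that, of "- r"] by simp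
    with odd[of "r *\<^sub>R x"] S that show ?thesis by (simp add: subspace_scale)
  qed
  show ?thesis
  proof (rule that[of f])
    show "f x \<le> p x" if "x \<in> S" for x using f(2)[OF that] p'(2)[OF that] by simp
    then have "f x0 \<le> p x0" using x0 .
    moreover have "f (- x0) \<le> p' (- x0)" using f(2) subspace_neg[OF S x0] by blast
    ultimately show "f x0 = p x0" using odd[OF x0] p'(3) by simp
  qed (fact add hom)+
qed

section \<open>Normed modules and their duals\<close>

text \<open>Completeness is split off from \<open>complex_banach\<close>: duals are handled as
  normed spaces, and the completeness of the space of forms is a separate argument.\<close>

definition complex_normed :: "('x, 'm) normed_module_scheme \<Rightarrow> bool" where
  "complex_normed X \<longleftrightarrow>
     Module.module complex_ring X \<and>
     (\<forall>x\<in>carrier X. 0 \<le> vnorm X x) \<and>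
     (\<forall>x\<in>carrier X. vnorm X x = 0 \<longleftrightarrow> x = \<zero>\<^bsub>X\<^esub>) \<and>
     (\<forall>x\<in>carrier X. \<forall>y\<in>carrier X. vnorm X (x \<oplus>\<^bsub>X\<^esub> y) \<le> vnorm X x + vnorm X y) \<and>
     (\<forall>c. \<forall>x\<in>carrier X. vnorm X (c \<odot>\<^bsub>X\<^esub> x) = cmod c * vnorm X x)"

lemma complex_banach_iff:
  "complex_banach X \<longleftrightarrow> complex_normed X \<and> Metric_space.mcomplete (carrier X) (ndist X)"
  by (auto simp: complex_banach_def complex_normed_def)

lemma complex_ring_cring: "cring complex_ring"
proof (rule cringI)
  show "abelian_group complex_ring"
    by (rule abelian_groupI) (auto simp: complex_ring_def intro: exI[of _ "- x" for x])
  show "Group.comm_monoid complex_ring"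
    by (rule Group.comm_monoidI) (auto simp: complex_ring_def)
qed (auto simp: complex_ring_def algebra_simps)

text \<open>Subtraction in a module comes from the inverse in its additive group; writing it with
  the scalar -1 makes the homogeneity of the norm applicable.\<close>

lemma complex_module_minus:
  assumes "Module.module complex_ring X" "x \<in> carrier X" "y \<in> carrier X"
  shows "x \<ominus>\<^bsub>X\<^esub> y = x \<oplus>\<^bsub>X\<^esub> (- 1 \<odot>\<^bsub>X\<^esub> y)"
proof -
  interpret Module.module complex_ring X by fact
  have "- 1 \<odot>\<^bsub>X\<^esub> y \<oplus>\<^bsub>X\<^esub> y = (- 1 \<oplus>\<^bsub>complex_ring\<^esub> 1) \<odot>\<^bsub>X\<^esub> y"
    using smult_l_distr[of "- 1" 1 y] smult_one[of y] assms(3) by (simp add: complex_ring_def)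
  also have "\<dots> = \<zero>\<^bsub>X\<^esub>"
    using smult_l_null[of y] assms(3) by (simp add: complex_ring_def)
  finally have "\<ominus>\<^bsub>X\<^esub> y = - 1 \<odot>\<^bsub>X\<^esub> y"
    using assms(3) smult_closed[of "- 1" y] by (intro M.minus_equality) (auto simp: complex_ring_def)
  then show ?thesis by (simp add: a_minus_def)
qed

lemma complex_normed_metric:
  assumes "complex_normed X"
  shows "Metric_space (carrier X) (ndist X)"
proof -
  from assms have mod: "Module.module complex_ring X" by (simp add: complex_normed_def)
  interpret Module.module complex_ring X by fact
  note [simp] = M.minus_closed
  show ?thesis
  proof
    show "0 \<le> ndist X x y" for x y
      using assms by (auto simp: ndist_def complex_normed_def)
    show "ndist X x y = ndist X y x" for x y
    proof (cases "x \<in> carrier X \<and> y \<in> carrier X")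
      case True
      have sc: "- 1 \<odot>\<^bsub>X\<^esub> z \<in> carrier X" if "z \<in> carrier X" for z
        using smult_closed[of "- 1" z] that by (simp add: complex_ring_def)
      have "- 1 \<odot>\<^bsub>X\<^esub> (x \<oplus>\<^bsub>X\<^esub> (- 1 \<odot>\<^bsub>X\<^esub> y)) = - 1 \<odot>\<^bsub>X\<^esub> x \<oplus>\<^bsub>X\<^esub> (- 1 \<odot>\<^bsub>X\<^esub> (- 1 \<odot>\<^bsub>X\<^esub> y))"
        using True sc smult_r_distr[of "- 1" x "- 1 \<odot>\<^bsub>X\<^esub> y"] by (simp add: complex_ring_def)
      also have "- 1 \<odot>\<^bsub>X\<^esub> (- 1 \<odot>\<^bsub>X\<^esub> y) = y"
        using True smult_assoc1[of "- 1" "- 1" y] smult_one[of y] by (simp add: complex_ring_def)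
      also have "- 1 \<odot>\<^bsub>X\<^esub> x \<oplus>\<^bsub>X\<^esub> y = y \<ominus>\<^bsub>X\<^esub> x"
        using True sc complex_module_minus[OF mod, of y x] by (simp add: M.a_comm)
      finally have "y \<ominus>\<^bsub>X\<^esub> x = - 1 \<odot>\<^bsub>X\<^esub> (x \<ominus>\<^bsub>X\<^esub> y)"
        using True by (simp add: complex_module_minus[OF mod])
      then have "vnorm X (y \<ominus>\<^bsub>X\<^esub> x) = cmod (- 1) * vnorm X (x \<ominus>\<^bsub>X\<^esub> y)"
        using assms True unfolding complex_normed_def by simp
      with True show ?thesis by (simp add: ndist_def)
    qed (auto simp: ndist_def)
    show "ndist X x y = 0 \<longleftrightarrow> x = y" if xy: "x \<in> carrier X" "y \<in> carrier X" for x y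
    proof -
      have "x \<ominus>\<^bsub>X\<^esub> y = \<zero>\<^bsub>X\<^esub> \<longleftrightarrow> x = y"
        using xy M.minus_equality[of x "\<ominus>\<^bsub>X\<^esub> y"] by (auto simp: a_minus_def M.r_neg)
      with assms xy show ?thesis by (simp add: ndist_def complex_normed_def)
    qed
    show "ndist X x z \<le> ndist X x y + ndist X y z"
      if "x \<in> carrier X" "y \<in> carrier X" "z \<in> carrier X" for x y z
    proof -
      have "x \<ominus>\<^bsub>X\<^esub> z = (x \<ominus>\<^bsub>X\<^esub> y) \<oplus>\<^bsub>X\<^esub> (y \<ominus>\<^bsub>X\<^esub> z)"
        using that by (simp add: a_minus_def M.a_ac M.l_neg M.r_neg M.r_neg2 M.r_neg1)
      with that assms show ?thesis by (simp add: ndist_def complex_normed_def)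
    qed
  qed
qed

lemma complex_normed_nonneg: "complex_normed X \<Longrightarrow> x \<in> carrier X \<Longrightarrow> 0 \<le> vnorm X x"
  by (simp add: complex_normed_def)

lemma complex_normed_smult_closed:
  "complex_normed X \<Longrightarrow> x \<in> carrier X \<Longrightarrow> c \<odot>\<^bsub>X\<^esub> x \<in> carrier X"
  using Module.module.smult_closed[of complex_ring X c x]
  by (simp add: complex_normed_def complex_ring_def)

lemma complex_normed_add_closed:
  "complex_normed X \<Longrightarrow> x \<in> carrier X \<Longrightarrow> y \<in> carrier X \<Longrightarrow> x \<oplus>\<^bsub>X\<^esub> y \<in> carrier X"
  using abelian_monoid.a_closed[of X x y] abelian_group.axioms(1)[of X]
    Module.module.axioms(2)[of complex_ring X]
  by (simp add: complex_normed_def)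

section \<open>The dual of a normed bimodule as a normed space\<close>

lemma dual_carrierD:
  assumes "\<phi> \<in> carrier (dual_bimodule X)"
  shows "\<phi> \<in> extensional (carrier X)"
    and "\<And>x y. x \<in> carrier X \<Longrightarrow> y \<in> carrier X \<Longrightarrow> \<phi> (x \<oplus>\<^bsub>X\<^esub> y) = \<phi> x + \<phi> y"
    and "\<And>c x. x \<in> carrier X \<Longrightarrow> \<phi> (c \<odot>\<^bsub>X\<^esub> x) = c * \<phi> x"
    and "\<exists>K. \<forall>x\<in>carrier X. cmod (\<phi> x) \<le> K * vnorm X x"
  using assms by (auto simp: dual_bimodule_def)

lemma dual_carrierI:
  assumes "\<phi> \<in> extensional (carrier X)"
    and "\<And>x y. x \<in> carrier X \<Longrightarrow> y \<in> carrier X \<Longrightarrow> \<phi> (x \<oplus>\<^bsub>X\<^esub> y) = \<phi> x + \<phi> y"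
    and "\<And>c x. x \<in> carrier X \<Longrightarrow> \<phi> (c \<odot>\<^bsub>X\<^esub> x) = c * \<phi> x"
    and "\<And>x. x \<in> carrier X \<Longrightarrow> cmod (\<phi> x) \<le> K * vnorm X x"
  shows "\<phi> \<in> carrier (dual_bimodule X)"
  using assms by (auto simp: dual_bimodule_def intro!: exI[of _ K])

lemma dual_norm_bdd:
  assumes X: "complex_normed X" and \<phi>: "\<phi> \<in> carrier (dual_bimodule X)"
  shows "bdd_above ((\<lambda>x. cmod (\<phi> x)) ` {x \<in> carrier X. vnorm X x \<le> 1})"
proof -
  obtain K where K: "\<forall>x\<in>carrier X. cmod (\<phi> x) \<le> K * vnorm X x"
    using dual_carrierD(4)[OF \<phi>] by blast
  have "cmod (\<phi> x) \<le> \<bar>K\<bar>" if "x \<in> carrier X" "vnorm X x \<le> 1" for x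
  proof -
    have "K * vnorm X x \<le> \<bar>K\<bar> * 1"
      using complex_normed_nonneg[OF X that(1)] that(2) by (intro mult_mono) auto
    with K that(1) show ?thesis by force
  qed
  then show ?thesis by (intro bdd_aboveI2[where M = "\<bar>K\<bar>"]) auto
qed

lemma dual_norm_bound:
  assumes X: "complex_normed X" and \<phi>: "\<phi> \<in> carrier (dual_bimodule X)" and x: "x \<in> carrier X"
  shows "cmod (\<phi> x) \<le> vnorm (dual_bimodule X) \<phi> * vnorm X x"
proof (cases "vnorm X x = 0")
  case True
  obtain K where "\<forall>x\<in>carrier X. cmod (\<phi> x) \<le> K * vnorm X x"
    using dual_carrierD(4)[OF \<phi>] by blast
  with x True show ?thesis by force
next
  case False
  with complex_normed_nonneg[OF X x] have pos: "vnorm X x > 0" by simp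
  define y where "y = complex_of_real (inverse (vnorm X x)) \<odot>\<^bsub>X\<^esub> x"
  have "y \<in> carrier X" "vnorm X y = 1"
    using X x pos False
    by (simp_all add: y_def complex_normed_smult_closed complex_normed_def norm_divide del: of_real_inverse)
  then have "cmod (\<phi> y) \<le> vnorm (dual_bimodule X) \<phi>"
    using dual_norm_bdd[OF X \<phi>] by (auto simp: dual_bimodule_def intro: cSUP_upper)
  moreover have "\<phi> y = complex_of_real (inverse (vnorm X x)) * \<phi> x"
    unfolding y_def by (rule dual_carrierD(3)[OF \<phi> x])
  ultimately have "inverse (vnorm X x) * cmod (\<phi> x) \<le> vnorm (dual_bimodule X) \<phi>"
    using pos by (simp only: norm_mult norm_of_real abs_of_pos positive_imp_inverse_positive)
  with pos show ?thesis by (simp add: field_simps)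
qed

lemma dual_norm_le:
  assumes X: "complex_normed X" and "K \<ge> 0"
    and bound: "\<And>x. x \<in> carrier X \<Longrightarrow> cmod (\<phi> x) \<le> K * vnorm X x"
  shows "vnorm (dual_bimodule X) \<phi> \<le> K"
proof -
  have "\<zero>\<^bsub>X\<^esub> \<in> carrier X"
    using X abelian_monoid.zero_closed[of X] abelian_group.axioms(1)[of X]
      Module.module.axioms(2)[of complex_ring X] by (simp add: complex_normed_def)
  moreover from this X have "vnorm X \<zero>\<^bsub>X\<^esub> = 0" by (simp add: complex_normed_def)
  ultimately have "{x \<in> carrier X. vnorm X x \<le> 1} \<noteq> {}" by force
  moreover have "cmod (\<phi> x) \<le> K" if "x \<in> carrier X" "vnorm X x \<le> 1" for x
    using bound[OF that(1)] mult_left_mono[OF that(2) \<open>K \<ge> 0\<close>] by simp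
  ultimately show ?thesis by (auto simp: dual_bimodule_def intro!: cSUP_least)
qed

lemma complex_normed_dual:
  assumes X: "complex_normed X"
  shows "complex_normed (dual_bimodule X)"
proof -
  note closed = complex_normed_smult_closed[OF X] complex_normed_add_closed[OF X]
  let ?Y = "dual_bimodule X"
  have zero: "\<zero>\<^bsub>?Y\<^esub> = (\<lambda>x\<in>carrier X. 0)" and add: "\<phi> \<oplus>\<^bsub>?Y\<^esub> \<psi> = (\<lambda>x\<in>carrier X. \<phi> x + \<psi> x)"
    and smult: "c \<odot>\<^bsub>?Y\<^esub> \<phi> = (\<lambda>x\<in>carrier X. c * \<phi> x)" for \<phi> \<psi> c
    by (simp_all add: dual_bimodule_def)
  have zeroc: "\<zero>\<^bsub>?Y\<^esub> \<in> carrier ?Y"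
    by (rule dual_carrierI[where K = 0]) (simp_all add: zero closed)
  have addc: "\<phi> \<oplus>\<^bsub>?Y\<^esub> \<psi> \<in> carrier ?Y" if "\<phi> \<in> carrier ?Y" "\<psi> \<in> carrier ?Y" for \<phi> \<psi>
  proof (rule dual_carrierI[where K = "vnorm ?Y \<phi> + vnorm ?Y \<psi>"])
    show "cmod ((\<phi> \<oplus>\<^bsub>?Y\<^esub> \<psi>) x) \<le> (vnorm ?Y \<phi> + vnorm ?Y \<psi>) * vnorm X x" if x: "x \<in> carrier X" for x
      using norm_triangle_ineq[of "\<phi> x" "\<psi> x"] x dual_norm_bound[OF X \<open>\<phi> \<in> _\<close> x]
        dual_norm_bound[OF X \<open>\<psi> \<in> _\<close> x] by (simp add: add algebra_simps)
  qed (use that in \<open>simp_all add: add closed dual_carrierD(2,3) algebra_simps\<close>)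
  have smultc: "c \<odot>\<^bsub>?Y\<^esub> \<phi> \<in> carrier ?Y" if "\<phi> \<in> carrier ?Y" for c \<phi>
  proof (rule dual_carrierI[where K = "cmod c * vnorm ?Y \<phi>"])
    show "cmod ((c \<odot>\<^bsub>?Y\<^esub> \<phi>) x) \<le> cmod c * vnorm ?Y \<phi> * vnorm X x" if x: "x \<in> carrier X" for x
      using mult_left_mono[OF dual_norm_bound[OF X \<open>\<phi> \<in> _\<close> x], of "cmod c"] x
      by (simp add: smult norm_mult mult.assoc)
  qed (use that in \<open>simp_all add: smult closed dual_carrierD(2,3) algebra_simps\<close>)
  have ext: "\<phi> = (\<lambda>x\<in>carrier X. \<phi> x)" if "\<phi> \<in> carrier ?Y" for \<phi>
    using dual_carrierD(1)[OF that] by (simp add: extensional_restrict)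
  have "abelian_group ?Y"
  proof (rule abelian_groupI)
    show "\<zero>\<^bsub>?Y\<^esub> \<oplus>\<^bsub>?Y\<^esub> \<phi> = \<phi>" if "\<phi> \<in> carrier ?Y" for \<phi>
      using ext[OF that] by (simp add: add zero cong: restrict_cong)
    show "\<exists>\<psi>\<in>carrier ?Y. \<psi> \<oplus>\<^bsub>?Y\<^esub> \<phi> = \<zero>\<^bsub>?Y\<^esub>" if "\<phi> \<in> carrier ?Y" for \<phi>
      by (rule bexI[of _ "(- 1) \<odot>\<^bsub>?Y\<^esub> \<phi>", OF _ smultc[OF that]]) (auto simp: add zero smult)
  qed (use addc zeroc in \<open>auto simp: add fun_eq_iff ac_simps\<close>)
  then have "Module.module complex_ring ?Y"
  proof (rule moduleI[OF complex_ring_cring])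
    show "\<one>\<^bsub>complex_ring\<^esub> \<odot>\<^bsub>?Y\<^esub> \<phi> = \<phi>" if "\<phi> \<in> carrier ?Y" for \<phi>
      using ext[OF that] by (simp add: smult complex_ring_def)
  qed (use smultc in \<open>auto simp: add smult complex_ring_def fun_eq_iff algebra_simps\<close>)
  moreover have nonneg: "0 \<le> vnorm ?Y \<phi>" if "\<phi> \<in> carrier ?Y" for \<phi>
  proof -
    have z: "\<zero>\<^bsub>X\<^esub> \<in> carrier X"
      using X abelian_monoid.zero_closed[of X] abelian_group.axioms(1)[of X]
        Module.module.axioms(2)[of complex_ring X] by (simp add: complex_normed_def)
    moreover from this X have "vnorm X \<zero>\<^bsub>X\<^esub> = 0" by (simp add: complex_normed_def)
    ultimately have "cmod (\<phi> \<zero>\<^bsub>X\<^esub>) \<le> vnorm ?Y \<phi>"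
      using dual_norm_bdd[OF X that] by (auto simp: dual_bimodule_def intro!: cSUP_upper)
    then show ?thesis using norm_ge_zero[of "\<phi> \<zero>\<^bsub>X\<^esub>"] by linarith
  qed
  moreover have "vnorm ?Y \<phi> = 0 \<longleftrightarrow> \<phi> = \<zero>\<^bsub>?Y\<^esub>" if "\<phi> \<in> carrier ?Y" for \<phi>
  proof
    assume "vnorm ?Y \<phi> = 0"
    then have "\<phi> x = 0" if "x \<in> carrier X" for x
      using dual_norm_bound[OF X \<open>\<phi> \<in> _\<close> that] by simp
    then show "\<phi> = \<zero>\<^bsub>?Y\<^esub>" by (subst ext[OF that]) (auto simp: zero)
  next
    assume "\<phi> = \<zero>\<^bsub>?Y\<^esub>"
    then show "vnorm ?Y \<phi> = 0"
      using dual_norm_le[OF X, of 0 \<phi>] nonneg[OF that] by (simp add: zero)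
  qed
  moreover have "vnorm ?Y (\<phi> \<oplus>\<^bsub>?Y\<^esub> \<psi>) \<le> vnorm ?Y \<phi> + vnorm ?Y \<psi>"
    if "\<phi> \<in> carrier ?Y" "\<psi> \<in> carrier ?Y" for \<phi> \<psi>
  proof (rule dual_norm_le[OF X])
    show "cmod ((\<phi> \<oplus>\<^bsub>?Y\<^esub> \<psi>) x) \<le> (vnorm ?Y \<phi> + vnorm ?Y \<psi>) * vnorm X x" if x: "x \<in> carrier X" for x
      using norm_triangle_ineq[of "\<phi> x" "\<psi> x"] x dual_norm_bound[OF X \<open>\<phi> \<in> _\<close> x]
        dual_norm_bound[OF X \<open>\<psi> \<in> _\<close> x] by (simp add: add algebra_simps)
  qed (use nonneg that in simp)
  moreover have smult_le: "vnorm ?Y (c \<odot>\<^bsub>?Y\<^esub> \<phi>) \<le> cmod c * vnorm ?Y \<phi>" if "\<phi> \<in> carrier ?Y" for c \<phi>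
  proof (rule dual_norm_le[OF X])
    show "cmod ((c \<odot>\<^bsub>?Y\<^esub> \<phi>) x) \<le> cmod c * vnorm ?Y \<phi> * vnorm X x" if x: "x \<in> carrier X" for x
      using mult_left_mono[OF dual_norm_bound[OF X \<open>\<phi> \<in> _\<close> x], of "cmod c"] x
      by (simp add: smult norm_mult mult.assoc)
  qed (use nonneg that in simp)
  moreover have "vnorm ?Y (c \<odot>\<^bsub>?Y\<^esub> \<phi>) = cmod c * vnorm ?Y \<phi>" if \<phi>: "\<phi> \<in> carrier ?Y" for c \<phi>
  proof (rule antisym[OF smult_le[OF \<phi>]], cases "c = 0")
    case True
    with nonneg[OF smultc[OF \<phi>]] show "cmod c * vnorm ?Y \<phi> \<le> vnorm ?Y (c \<odot>\<^bsub>?Y\<^esub> \<phi>)" by simp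
  next
    case False
    have "inverse c \<odot>\<^bsub>?Y\<^esub> (c \<odot>\<^bsub>?Y\<^esub> \<phi>) = \<phi>"
      using False by (subst (2) ext[OF \<phi>]) (auto simp: smult)
    with smult_le[OF smultc[OF \<phi>], of "inverse c" c]
    have "vnorm ?Y \<phi> \<le> vnorm ?Y (c \<odot>\<^bsub>?Y\<^esub> \<phi>) / cmod c" by (simp add: norm_inverse divide_inverse mult.commute)
    with False show "cmod c * vnorm ?Y \<phi> \<le> vnorm ?Y (c \<odot>\<^bsub>?Y\<^esub> \<phi>)" by (simp add: field_simps)
  qed
  ultimately show ?thesis by (simp add: complex_normed_def)
qed

lemma dual_minus_apply:
  assumes "complex_normed X" "\<phi> \<in> carrier (dual_bimodule X)" "\<psi> \<in> carrier (dual_bimodule X)"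
    "x \<in> carrier X"
  shows "(\<phi> \<ominus>\<^bsub>dual_bimodule X\<^esub> \<psi>) x = \<phi> x - \<psi> x"
proof -
  have "Module.module complex_ring (dual_bimodule X)"
    using complex_normed_dual[OF assms(1)] by (simp add: complex_normed_def)
  from complex_module_minus[OF this assms(2,3)] assms(4) show ?thesis
    by (simp add: dual_bimodule_def)
qed

section \<open>Bilinear forms on the unitization\<close>

text \<open>Models a Segal algebra in its own norm \<open>N\<close>, which differs from the norm
  that the ambient type may carry. The type has only real scalars, so the complex ones come as
  \<open>sc\<close>.\<close>

locale banach_subspace =
  fixes S :: "'a::real_vector set" and N :: "'a \<Rightarrow> real" and sc :: "complex \<Rightarrow> 'a \<Rightarrow> 'a"
  assumes zero_mem: "0 \<in> S" and add_mem: "x \<in> S \<Longrightarrow> y \<in> S \<Longrightarrow> x + y \<in> S"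
    and sc_mem: "x \<in> S \<Longrightarrow> sc c x \<in> S"
    and sc_add_right: "sc c (x + y) = sc c x + sc c y"
    and sc_add_left: "sc (c + d) x = sc c x + sc d x"
    and sc_sc: "sc c (sc d x) = sc (c * d) x"
    and sc_of_real: "sc (of_real r) x = r *\<^sub>R x"
    and N_nonneg: "x \<in> S \<Longrightarrow> 0 \<le> N x"
    and N_zero_iff: "x \<in> S \<Longrightarrow> N x = 0 \<longleftrightarrow> x = 0"
    and N_triangle: "x \<in> S \<Longrightarrow> y \<in> S \<Longrightarrow> N (x + y) \<le> N x + N y"
    and N_sc: "x \<in> S \<Longrightarrow> N (sc c x) = cmod c * N x"
    and complete: "(\<And>n::nat. X n \<in> S) \<Longrightarrow>
      (\<And>e. e > 0 \<Longrightarrow> \<exists>M. \<forall>m\<ge>M. \<forall>n\<ge>M. N (X m - X n) < e) \<Longrightarrow>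
      \<exists>l\<in>S. (\<lambda>n. N (X n - l)) \<longlonglongrightarrow> 0"
begin

lemma sc_one [simp]: "sc 1 x = x"
  using sc_of_real[of 1 x] by simp

lemma sc_minus_one: "sc (- 1) x = - x"
  using sc_of_real[of "- 1" x] by simp

lemma sc_zero [simp]: "sc 0 x = 0" "sc c 0 = 0"
  using sc_of_real[of 0 x] sc_sc[of c 0 0] sc_of_real[of 0 0] by simp_all

lemma minus_mem: "x \<in> S \<Longrightarrow> - x \<in> S"
  using sc_mem[of x "- 1"] by (simp add: sc_minus_one)

lemma diff_mem: "x \<in> S \<Longrightarrow> y \<in> S \<Longrightarrow> x - y \<in> S"
  using add_mem[OF _ minus_mem, of x y] by simp

lemma scaleR_mem: "x \<in> S \<Longrightarrow> r *\<^sub>R x \<in> S"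
  using sc_mem[of x "of_real r"] by (simp add: sc_of_real)

lemma sum_mem: "(\<And>i. i \<in> I \<Longrightarrow> f i \<in> S) \<Longrightarrow> sum f I \<in> S"
  by (induction I rule: infinite_finite_induct) (auto simp: zero_mem add_mem)

lemmas vector_mem = zero_mem add_mem sc_mem minus_mem diff_mem scaleR_mem sum_mem

lemma N_scaleR: "x \<in> S \<Longrightarrow> N (r *\<^sub>R x) = \<bar>r\<bar> * N x"
  using N_sc[of x "of_real r"] by (simp add: sc_of_real)

lemma N_0 [simp]: "N 0 = 0"
  using N_zero_iff[OF zero_mem] by simp

lemma N_minus: "x \<in> S \<Longrightarrow> N (- x) = N x"
  using N_sc[of x "- 1"] by (simp add: sc_minus_one)

lemma N_minus_commute: "x \<in> S \<Longrightarrow> y \<in> S \<Longrightarrow> N (x - y) = N (y - x)"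
  using N_minus[of "x - y"] by (simp add: vector_mem)

lemma N_triangle_diff: "x \<in> S \<Longrightarrow> y \<in> S \<Longrightarrow> N (x - y) \<le> N x + N y"
  using N_triangle[OF _ minus_mem, of x y] by (simp add: N_minus)

lemma N_sum: "(\<And>i. i \<in> I \<Longrightarrow> f i \<in> S) \<Longrightarrow> N (sum f I) \<le> (\<Sum>i\<in>I. N (f i))"
proof (induction I rule: infinite_finite_induct)
  case (insert i I)
  then show ?case using N_triangle[of "f i" "sum f I"] by (auto simp: vector_mem intro: order_trans)
qed auto

lemma N_tendsto_unique:
  assumes "(\<lambda>n. N (X n - x)) \<longlonglongrightarrow> 0" "(\<lambda>n. N (X n - y)) \<longlonglongrightarrow> 0"
    and mem': "\<And>n. X n \<in> S" "x \<in> S" "y \<in> S"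
  shows "x = y"
proof -
  have "N (x - y) \<le> N (X n - x) + N (X n - y)" for n
    using N_triangle[of "x - X n" "X n - y"] N_minus_commute[of x "X n"] mem' by (simp add: vector_mem)
  moreover have "(\<lambda>n. N (X n - x) + N (X n - y)) \<longlonglongrightarrow> 0"
    using tendsto_add[OF assms(1,2)] by simp
  ultimately have "N (x - y) \<le> 0"
    by (intro tendsto_lowerbound) auto
  then have "N (x - y) = 0" using N_nonneg[of "x - y"] mem' by (simp add: vector_mem)
  then show ?thesis using N_zero_iff[of "x - y"] mem' by (simp add: vector_mem)
qed

lemma abs_summable_series:
  assumes u: "\<And>j. u j \<in> S" and sm: "summable (\<lambda>j. N (u j))"
  obtains a where "a \<in> S" "(\<lambda>n. N ((\<Sum>j<n. u j) - a)) \<longlonglongrightarrow> 0"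
proof -
  have "\<exists>l\<in>S. (\<lambda>n. N ((\<Sum>j<n. u j) - l)) \<longlonglongrightarrow> 0"
  proof (rule complete)
    fix e :: real assume "e > 0"
    then obtain M where M: "\<And>m n. m \<ge> M \<Longrightarrow> norm (sum (\<lambda>j. N (u j)) {m..<n}) < e"
      using sm unfolding summable_Cauchy by blast
    have le: "N ((\<Sum>j<n. u j) - (\<Sum>j<m. u j)) < e" if "M \<le> m" "m \<le> n" for m n
    proof -
      have "(\<Sum>j<n. u j) - (\<Sum>j<m. u j) = (\<Sum>j=m..<n. u j)"
        using that by (simp add: lessThan_atLeast0 sum_diff_nat_ivl)
      also have "N \<dots> \<le> (\<Sum>j=m..<n. N (u j))" by (intro N_sum u)
      also have "\<dots> < e" using M[OF that(1), of n] by simp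
      finally show ?thesis .
    qed
    have "N ((\<Sum>j<m. u j) - (\<Sum>j<n. u j)) < e" if "M \<le> m" "M \<le> n" for m n
      using le[of m n] le[of n m] that N_minus_commute[of "\<Sum>j<m. u j" "\<Sum>j<n. u j"] u
      by (cases "m \<le> n") (auto simp: vector_mem)
    then show "\<exists>M. \<forall>m\<ge>M. \<forall>n\<ge>M. N ((\<Sum>j<m. u j) - (\<Sum>j<n. u j)) < e" by blast
  qed (simp add: vector_mem u)
  then show ?thesis using that by blast
qed

end

text \<open>The algebraic laws are required on the whole type, closure and the norm estimate only on
  \<open>S\<close>. This fits convolution, which is total on L^1.\<close>

locale comm_banach_algebra = banach_subspace S N sc
  for S :: "'a::real_vector set" and N :: "'a \<Rightarrow> real" and sc :: "complex \<Rightarrow> 'a \<Rightarrow> 'a" +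
  fixes mul :: "'a \<Rightarrow> 'a \<Rightarrow> 'a"
  assumes mul_mem: "x \<in> S \<Longrightarrow> y \<in> S \<Longrightarrow> mul x y \<in> S"
    and mul_commute: "mul x y = mul y x"
    and mul_assoc: "mul (mul x y) z = mul x (mul y z)"
    and mul_add: "mul x (y + z) = mul x y + mul x z"
    and mul_sc: "mul x (sc c y) = sc c (mul x y)"
    and N_mul: "x \<in> S \<Longrightarrow> y \<in> S \<Longrightarrow> N (mul x y) \<le> N x * N y"
begin

lemmas mem = vector_mem mul_mem

lemma mul_zero [simp]: "mul x 0 = 0" "mul 0 x = 0"
  using mul_sc[of x 0 0] mul_commute[of 0 x] by simp_all

lemma mul_add_left: "mul (x + y) z = mul x z + mul y z"
  by (metis mul_add mul_commute)

lemma mul_sc_left: "mul (sc c x) y = sc c (mul x y)"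
  by (metis mul_sc mul_commute)

lemma mul_minus: "mul x (- y) = - mul x y" "mul (- y) x = - mul y x"
  using mul_sc[of x "- 1" y] mul_sc_left[of "- 1" y x] by (simp_all add: sc_minus_one)

lemma mul_diff: "mul x (y - z) = mul x y - mul x z" "mul (y - z) x = mul y x - mul z x"
  using mul_add[of x y "- z"] mul_add_left[of y "- z" x] by (simp_all add: mul_minus)

lemma mul_scaleR: "mul x (r *\<^sub>R y) = r *\<^sub>R mul x y" "mul (r *\<^sub>R y) x = r *\<^sub>R mul y x"
  using mul_sc[of x "of_real r" y] mul_sc_left[of "of_real r" y x] by (simp_all add: sc_of_real)

lemma mul_left_commute: "mul x (mul y z) = mul y (mul x z)"
  by (metis mul_assoc mul_commute)

lemma mul_sum: "mul x (sum f I) = (\<Sum>i\<in>I. mul x (f i))"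
  by (induction I rule: infinite_finite_induct) (auto simp: mul_add)

lemmas mul_ac = mul_assoc mul_commute mul_left_commute

definition alg :: "'a normed_module" where
  "alg = \<lparr>carrier = S, mult = mul, one = undefined, zero = 0, add = (+), smult = sc, vnorm = N\<rparr>"

lemma alg_simps [simp]:
  "carrier alg = S" "x \<otimes>\<^bsub>alg\<^esub> y = mul x y" "\<zero>\<^bsub>alg\<^esub> = 0" "x \<oplus>\<^bsub>alg\<^esub> y = x + y"
  "c \<odot>\<^bsub>alg\<^esub> x = sc c x" "vnorm alg x = N x"
  by (simp_all add: alg_def)

lemma complex_normed_alg: "complex_normed alg"
proof -
  have "abelian_group alg"
    by (rule abelian_groupI) (auto simp: mem ac_simps intro!: bexI[of _ "- x" for x])
  then have "Module.module complex_ring alg"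
    by (rule moduleI[OF complex_ring_cring])
      (auto simp: complex_ring_def mem sc_sc sc_add_left sc_add_right)
  then show ?thesis
    by (auto simp: complex_normed_def N_nonneg N_zero_iff N_triangle N_sc)
qed

lemma alg_minus: "x \<in> S \<Longrightarrow> y \<in> S \<Longrightarrow> x \<ominus>\<^bsub>alg\<^esub> y = x - y"
  using complex_module_minus[of alg x y] complex_normed_alg
  by (simp add: complex_normed_def sc_minus_one)

section \<open>The unitization and its bounded bilinear forms\<close>

definition nu :: "complex \<times> 'a \<Rightarrow> real" where "nu p = cmod (fst p) + N (snd p)"
definition unitization :: "(complex \<times> 'a) set" where "unitization = UNIV \<times> S"
definition scU :: "complex \<Rightarrow> complex \<times> 'a \<Rightarrow> complex \<times> 'a" where
  "scU c p = (c * fst p, sc c (snd p))"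
text \<open>Multiplication by \<open>(0, a)\<close> in the unitization, where \<open>(s, x)\<close>
  stands for s 1 + x. The result has no scalar part.\<close>

definition act :: "'a \<Rightarrow> complex \<times> 'a \<Rightarrow> complex \<times> 'a" where
  "act a p = (0, sc (fst p) a + mul a (snd p))"

lemma unitization_iff [simp]: "(s, x) \<in> unitization \<longleftrightarrow> x \<in> S"
  by (simp add: unitization_def)

lemma unitization_add: "p \<in> unitization \<Longrightarrow> q \<in> unitization \<Longrightarrow> p + q \<in> unitization"
  by (auto simp: unitization_def mem)

lemma unitization_scU: "p \<in> unitization \<Longrightarrow> scU c p \<in> unitization"
  by (auto simp: unitization_def scU_def mem)

lemma unitization_act: "a \<in> S \<Longrightarrow> p \<in> unitization \<Longrightarrow> act a p \<in> unitization"
  by (auto simp: unitization_def act_def mem)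

lemmas unitization_mem = unitization_add unitization_scU unitization_act

lemma nu_nonneg: "p \<in> unitization \<Longrightarrow> 0 \<le> nu p"
  by (auto simp: nu_def unitization_def N_nonneg)

lemma act_simps:
  "act a (p + q) = act a p + act a q" "act (a + b) p = act a p + act b p"
  "act a (scU c p) = scU c (act a p)" "act (sc c a) p = scU c (act a p)"
  "act a (act b p) = act (mul a b) p" "act a (1, 0) = (0, a)" "act a (0, b) = (0, mul a b)"
  "fst (act a p) = 0"
  by (simp_all add: act_def scU_def sc_add_left sc_add_right mul_add mul_add_left mul_sc mul_sc_left
      sc_sc mul_ac algebra_simps)

lemma nu_act:
  assumes "a \<in> S" "p \<in> unitization"
  shows "nu (act a p) \<le> N a * nu p"
proof -
  have "N (sc (fst p) a + mul a (snd p)) \<le> cmod (fst p) * N a + N a * N (snd p)"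
    using assms N_triangle[of "sc (fst p) a" "mul a (snd p)"] N_mul[of a "snd p"] N_sc[of a "fst p"]
    by (auto simp: unitization_def mem)
  then show ?thesis by (simp add: nu_def act_def algebra_simps)
qed

text \<open>The value 0 outside the unitization makes equality of forms the same as equality of
  functions, so that forms constitute the carrier of a module without taking a quotient.\<close>

definition bform :: "'a bimodule_univ \<Rightarrow> bool" where
  "bform \<Phi> \<longleftrightarrow>
     (\<forall>p q. p \<notin> unitization \<or> q \<notin> unitization \<longrightarrow> \<Phi> p q = 0) \<and>
     (\<forall>p\<in>unitization. \<forall>p'\<in>unitization. \<forall>q\<in>unitization.
        \<Phi> (p + p') q = \<Phi> p q + \<Phi> p' q \<and> \<Phi> q (p + p') = \<Phi> q p + \<Phi> q p') \<and>
     (\<forall>c. \<forall>p\<in>unitization. \<forall>q\<in>unitization.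
        \<Phi> (scU c p) q = c * \<Phi> p q \<and> \<Phi> p (scU c q) = c * \<Phi> p q) \<and>
     \<Phi> (1, 0) (1, 0) = 0 \<and>
     (\<exists>K. \<forall>p\<in>unitization. \<forall>q\<in>unitization. cmod (\<Phi> p q) \<le> K * (nu p * nu q))"

definition fnorm :: "'a bimodule_univ \<Rightarrow> real" where
  "fnorm \<Phi> = Inf {K. 0 \<le> K \<and>
     (\<forall>p\<in>unitization. \<forall>q\<in>unitization. cmod (\<Phi> p q) \<le> K * (nu p * nu q))}"

lemma bformD:
  assumes "bform \<Phi>"
  shows "p \<notin> unitization \<or> q \<notin> unitization \<Longrightarrow> \<Phi> p q = 0"
    and "p \<in> unitization \<Longrightarrow> p' \<in> unitization \<Longrightarrow> q \<in> unitization \<Longrightarrow> \<Phi> (p + p') q = \<Phi> p q + \<Phi> p' q"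
    and "p \<in> unitization \<Longrightarrow> p' \<in> unitization \<Longrightarrow> q \<in> unitization \<Longrightarrow> \<Phi> q (p + p') = \<Phi> q p + \<Phi> q p'"
    and "p \<in> unitization \<Longrightarrow> q \<in> unitization \<Longrightarrow> \<Phi> (scU c p) q = c * \<Phi> p q"
    and "p \<in> unitization \<Longrightarrow> q \<in> unitization \<Longrightarrow> \<Phi> p (scU c q) = c * \<Phi> p q"
    and "\<Phi> (1, 0) (1, 0) = 0"
  using assms unfolding bform_def by blast+

lemma fnorm_le:
  assumes "0 \<le> K" "\<And>p q. p \<in> unitization \<Longrightarrow> q \<in> unitization \<Longrightarrow> cmod (\<Phi> p q) \<le> K * (nu p * nu q)"
  shows "fnorm \<Phi> \<le> K"
  unfolding fnorm_def using assms by (intro cInf_lower bdd_belowI[of _ 0]) auto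

lemma fnorm_set_nonempty:
  assumes "bform \<Phi>"
  shows "{K. 0 \<le> K \<and> (\<forall>p\<in>unitization. \<forall>q\<in>unitization. cmod (\<Phi> p q) \<le> K * (nu p * nu q))} \<noteq> {}"
proof -
  obtain K where K: "\<And>p q. p \<in> unitization \<Longrightarrow> q \<in> unitization \<Longrightarrow> cmod (\<Phi> p q) \<le> K * (nu p * nu q)"
    using assms unfolding bform_def by blast
  have "cmod (\<Phi> p q) \<le> \<bar>K\<bar> * (nu p * nu q)" if "p \<in> unitization" "q \<in> unitization" for p q
    using K[OF that] mult_right_mono[of K "\<bar>K\<bar>" "nu p * nu q"] mult_nonneg_nonneg[OF nu_nonneg[OF that(1)] nu_nonneg[OF that(2)]] by linarith
  then show ?thesis by (auto intro!: exI[of _ "\<bar>K\<bar>"])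
qed

lemma fnorm_nonneg: "bform \<Phi> \<Longrightarrow> 0 \<le> fnorm \<Phi>"
  unfolding fnorm_def using fnorm_set_nonempty[of \<Phi>] by (intro cInf_greatest) auto

lemma fnorm_bound:
  assumes "bform \<Phi>" "p \<in> unitization" "q \<in> unitization"
  shows "cmod (\<Phi> p q) \<le> fnorm \<Phi> * (nu p * nu q)"
proof (cases "nu p * nu q = 0")
  case True
  obtain K where "cmod (\<Phi> p q) \<le> K * (nu p * nu q)"
    using assms unfolding bform_def by blast
  with True show ?thesis by (simp only: mult_zero_right)
next
  case False
  then have pos: "nu p * nu q > 0" using nu_nonneg[OF assms(2)] nu_nonneg[OF assms(3)] by auto
  have "cmod (\<Phi> p q) / (nu p * nu q) \<le> fnorm \<Phi>"
    unfolding fnorm_def using fnorm_set_nonempty[OF assms(1)] pos assms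
    by (intro cInf_greatest) (auto simp: pos_divide_le_eq)
  with pos show ?thesis by (simp only: pos_divide_le_eq)
qed

lemma bformI:
  assumes "\<And>p q. p \<notin> unitization \<or> q \<notin> unitization \<Longrightarrow> \<Phi> p q = 0"
    and "\<And>p p' q. p \<in> unitization \<Longrightarrow> p' \<in> unitization \<Longrightarrow> q \<in> unitization \<Longrightarrow> \<Phi> (p + p') q = \<Phi> p q + \<Phi> p' q"
    and "\<And>p p' q. p \<in> unitization \<Longrightarrow> p' \<in> unitization \<Longrightarrow> q \<in> unitization \<Longrightarrow> \<Phi> q (p + p') = \<Phi> q p + \<Phi> q p'"
    and "\<And>c p q. p \<in> unitization \<Longrightarrow> q \<in> unitization \<Longrightarrow> \<Phi> (scU c p) q = c * \<Phi> p q"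
    and "\<And>c p q. p \<in> unitization \<Longrightarrow> q \<in> unitization \<Longrightarrow> \<Phi> p (scU c q) = c * \<Phi> p q"
    and "\<Phi> (1, 0) (1, 0) = 0"
    and "\<And>p q. p \<in> unitization \<Longrightarrow> q \<in> unitization \<Longrightarrow> cmod (\<Phi> p q) \<le> K * (nu p * nu q)"
  shows "bform \<Phi>"
  unfolding bform_def using assms by (intro conjI exI[of _ K] allI ballI impI) auto

text \<open>
  Forms on \<open>A\<^sup># \<times> A\<^sup>#\<close> vanishing at \<open>(1, 1)\<close> stand for the dual of the kernel of \<open>\<epsilon> \<otimes> \<epsilon>\<close> on
  \<open>A\<^sup># \<otimes> A\<^sup>#\<close>, where \<open>\<epsilon>\<close> is the augmentation \<open>fst\<close>; the actions subtract a multiple of \<open>\<epsilon> \<otimes> \<epsilon>\<close> to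
  return to this representative. As \<open>a \<otimes> 1 - 1 \<otimes> a\<close> lies in that kernel, it defines a derivation into
  \<open>forms\<^sup>*\<close>.
\<close>

definition forms :: "('a, 'a bimodule_univ) normed_bimodule" where
  "forms = \<lparr>carrier = {\<Phi>. bform \<Phi>}, mult = undefined, one = undefined, zero = (\<lambda>p q. 0),
     add = (\<lambda>\<Phi> \<Psi> p q. \<Phi> p q + \<Psi> p q), smult = (\<lambda>c \<Phi> p q. c * \<Phi> p q), vnorm = fnorm,
     lact = (\<lambda>a \<Phi> p q. if p \<in> unitization \<and> q \<in> unitization
        then \<Phi> p (act a q) - fst p * fst q * \<Phi> (1, 0) (0, a) else 0),
     ract = (\<lambda>\<Phi> a p q. if p \<in> unitization \<and> q \<in> unitization
        then \<Phi> (act a p) q - fst p * fst q * \<Phi> (0, a) (1, 0) else 0)\<rparr>"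

lemma forms_simps [simp]:
  "\<Phi> \<in> carrier forms \<longleftrightarrow> bform \<Phi>" "\<zero>\<^bsub>forms\<^esub> = (\<lambda>p q. 0)"
  "\<Phi> \<oplus>\<^bsub>forms\<^esub> \<Psi> = (\<lambda>p q. \<Phi> p q + \<Psi> p q)" "c \<odot>\<^bsub>forms\<^esub> \<Phi> = (\<lambda>p q. c * \<Phi> p q)"
  "vnorm forms \<Phi> = fnorm \<Phi>"
  "lact forms a \<Phi> = (\<lambda>p q. if p \<in> unitization \<and> q \<in> unitization
        then \<Phi> p (act a q) - fst p * fst q * \<Phi> (1, 0) (0, a) else 0)"
  "ract forms \<Phi> a = (\<lambda>p q. if p \<in> unitization \<and> q \<in> unitization
        then \<Phi> (act a p) q - fst p * fst q * \<Phi> (0, a) (1, 0) else 0)"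
  by (simp_all add: forms_def)

lemma bform_zero: "bform (\<lambda>p q. 0)"
  by (rule bformI[where K = 0]) auto

lemma bform_add: "bform \<Phi> \<Longrightarrow> bform \<Psi> \<Longrightarrow> bform (\<lambda>p q. \<Phi> p q + \<Psi> p q)"
  and fnorm_add: "bform \<Phi> \<Longrightarrow> bform \<Psi> \<Longrightarrow> fnorm (\<lambda>p q. \<Phi> p q + \<Psi> p q) \<le> fnorm \<Phi> + fnorm \<Psi>"
proof -
  assume \<Phi>: "bform \<Phi>" and \<Psi>: "bform \<Psi>"
  have bound: "cmod (\<Phi> p q + \<Psi> p q) \<le> (fnorm \<Phi> + fnorm \<Psi>) * (nu p * nu q)"
    if "p \<in> unitization" "q \<in> unitization" for p q
    using norm_triangle_ineq[of "\<Phi> p q" "\<Psi> p q"] fnorm_bound[OF \<Phi> that] fnorm_bound[OF \<Psi> that]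
    by (simp add: algebra_simps)
  show "bform (\<lambda>p q. \<Phi> p q + \<Psi> p q)"
    by (rule bformI[OF _ _ _ _ _ _ bound])
      (auto simp: bformD[OF \<Phi>] bformD[OF \<Psi>] algebra_simps)
  show "fnorm (\<lambda>p q. \<Phi> p q + \<Psi> p q) \<le> fnorm \<Phi> + fnorm \<Psi>"
    by (rule fnorm_le[OF _ bound]) (simp_all add: \<Phi> \<Psi> fnorm_nonneg)
qed

lemma bform_scale: "bform \<Phi> \<Longrightarrow> bform (\<lambda>p q. c * \<Phi> p q)"
  and fnorm_scale_le: "bform \<Phi> \<Longrightarrow> fnorm (\<lambda>p q. c * \<Phi> p q) \<le> cmod c * fnorm \<Phi>"
proof -
  assume \<Phi>: "bform \<Phi>"
  have bound: "cmod (c * \<Phi> p q) \<le> (cmod c * fnorm \<Phi>) * (nu p * nu q)"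
    if "p \<in> unitization" "q \<in> unitization" for p q
    using mult_left_mono[OF fnorm_bound[OF \<Phi> that], of "cmod c"] by (simp add: norm_mult mult.assoc)
  show "bform (\<lambda>p q. c * \<Phi> p q)"
    by (rule bformI[OF _ _ _ _ _ _ bound]) (auto simp: bformD[OF \<Phi>] algebra_simps)
  show "fnorm (\<lambda>p q. c * \<Phi> p q) \<le> cmod c * fnorm \<Phi>"
    by (rule fnorm_le[OF _ bound]) (simp_all add: \<Phi> fnorm_nonneg)
qed

lemma fnorm_scale:
  assumes \<Phi>: "bform \<Phi>"
  shows "fnorm (\<lambda>p q. c * \<Phi> p q) = cmod c * fnorm \<Phi>"
proof (rule antisym[OF fnorm_scale_le[OF \<Phi>]], cases "c = 0")
  case True
  then show "cmod c * fnorm \<Phi> \<le> fnorm (\<lambda>p q. c * \<Phi> p q)"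
    using fnorm_nonneg[OF bform_zero] by simp
next
  case False
  have "fnorm \<Phi> \<le> inverse (cmod c) * fnorm (\<lambda>p q. c * \<Phi> p q)"
    using fnorm_scale_le[OF bform_scale[OF \<Phi>, of c], of "inverse c"] False
    by (simp add: norm_inverse mult.assoc[symmetric])
  with False show "cmod c * fnorm \<Phi> \<le> fnorm (\<lambda>p q. c * \<Phi> p q)" by (simp add: field_simps)
qed

lemma complex_normed_forms: "complex_normed forms"
proof -
  have "abelian_group forms"
  proof (rule abelian_groupI)
    show "\<exists>\<Psi>\<in>carrier forms. \<Psi> \<oplus>\<^bsub>forms\<^esub> \<Phi> = \<zero>\<^bsub>forms\<^esub>" if "\<Phi> \<in> carrier forms" for \<Phi>
      using that bform_scale[of \<Phi> "- 1"] by (intro bexI[of _ "\<lambda>p q. - 1 * \<Phi> p q"]) auto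
  qed (auto simp: bform_zero bform_add algebra_simps)
  then have "Module.module complex_ring forms"
    by (rule moduleI[OF complex_ring_cring])
      (auto simp: complex_ring_def bform_scale algebra_simps)
  moreover have "fnorm \<Phi> = 0 \<longleftrightarrow> \<Phi> = (\<lambda>p q. 0)" if \<Phi>: "bform \<Phi>" for \<Phi>
  proof
    assume 0: "fnorm \<Phi> = 0"
    have "\<Phi> p q = 0" for p q
      using fnorm_bound[OF \<Phi>, of p q] bformD(1)[OF \<Phi>, of p q] 0
      by (cases "p \<in> unitization \<and> q \<in> unitization") auto
    then show "\<Phi> = (\<lambda>p q. 0)" by blast
  next
    assume "\<Phi> = (\<lambda>p q. 0)"
    then show "fnorm \<Phi> = 0" using fnorm_scale[OF bform_zero, of 0] by simp
  qed
  ultimately show ?thesis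
    by (auto simp: complex_normed_def fnorm_nonneg fnorm_add fnorm_scale)
qed

lemma forms_minus:
  "bform \<Phi> \<Longrightarrow> bform \<Psi> \<Longrightarrow> \<Phi> \<ominus>\<^bsub>forms\<^esub> \<Psi> = (\<lambda>p q. \<Phi> p q - \<Psi> p q)"
  using complex_module_minus[of forms \<Phi> \<Psi>] complex_normed_forms by (simp add: complex_normed_def)

lemma bform_minus: "bform \<Phi> \<Longrightarrow> bform \<Psi> \<Longrightarrow> bform (\<lambda>p q. \<Phi> p q - \<Psi> p q)"
  using bform_add[OF _ bform_scale[of \<Psi> "- 1"], of \<Phi>] by simp

text \<open>A Cauchy sequence of forms converges pointwise. Letting one index tend to infinity in
  the Cauchy estimate bounds the distance to the pointwise limit uniformly, relative to
  \<open>nu p * nu q\<close>.\<close>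

lemma mcomplete_forms: "Metric_space.mcomplete (carrier forms) (ndist forms)"
proof -
  interpret Metric_space "carrier forms" "ndist forms"
    by (rule complex_normed_metric[OF complex_normed_forms])
  have dist: "ndist forms \<Phi> \<Psi> = fnorm (\<lambda>p q. \<Phi> p q - \<Psi> p q)" if "bform \<Phi>" "bform \<Psi>" for \<Phi> \<Psi>
    using that by (simp add: ndist_def forms_minus)
  have "\<exists>\<Phi>. limitin mtopology \<sigma> \<Phi> sequentially" if "MCauchy \<sigma>" for \<sigma>
  proof -
    from that have \<sigma>: "bform (\<sigma> n)" for n by (auto simp: MCauchy_def image_subset_iff)
    have cauchy: "\<exists>M. \<forall>m\<ge>M. \<forall>n\<ge>M. fnorm (\<lambda>p q. \<sigma> m p q - \<sigma> n p q) < e" if "e > 0" for e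
      using \<open>MCauchy \<sigma>\<close> that by (auto simp: MCauchy_def dist[OF \<sigma> \<sigma>])
    have diff: "cmod (\<sigma> m p q - \<sigma> n p q) \<le> fnorm (\<lambda>p q. \<sigma> m p q - \<sigma> n p q) * (nu p * nu q)"
      if "p \<in> unitization" "q \<in> unitization" for m n p q
      using fnorm_bound[OF bform_minus[OF \<sigma> \<sigma>] that] .
    define \<Phi> where "\<Phi> p q = lim (\<lambda>n. \<sigma> n p q)" for p q
    have lim: "(\<lambda>n. \<sigma> n p q) \<longlonglongrightarrow> \<Phi> p q" for p q
    proof (cases "p \<in> unitization \<and> q \<in> unitization")
      case True
      have "Cauchy (\<lambda>n. \<sigma> n p q)"
      proof (rule CauchyI)
        fix e :: real assume e: "e > 0"
        define c where "c = nu p * nu q + 1"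
        have c: "c > 0" using nu_nonneg True by (simp add: c_def add_nonneg_pos)
        obtain M where M: "\<And>m n. m \<ge> M \<Longrightarrow> n \<ge> M \<Longrightarrow> fnorm (\<lambda>p q. \<sigma> m p q - \<sigma> n p q) < e / c"
          using cauchy[of "e / c"] e c by auto
        have "norm (\<sigma> m p q - \<sigma> n p q) < e" if "m \<ge> M" "n \<ge> M" for m n
        proof -
          have "norm (\<sigma> m p q - \<sigma> n p q) \<le> fnorm (\<lambda>p q. \<sigma> m p q - \<sigma> n p q) * c"
            using diff[of p q m n] True fnorm_nonneg[OF bform_minus[OF \<sigma> \<sigma>], of m n]
            by (simp add: c_def distrib_left)
          also have "\<dots> < e / c * c" using M[OF that] c by (intro mult_strict_right_mono)
          finally show ?thesis using c by simp
        qed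
        then show "\<exists>M. \<forall>m\<ge>M. \<forall>n\<ge>M. norm (\<sigma> m p q - \<sigma> n p q) < e" by blast
      qed
      then show ?thesis
        unfolding \<Phi>_def by (simp add: Cauchy_convergent_iff convergent_LIMSEQ_iff)
    next
      case False
      then have "\<sigma> n p q = 0" for n using bformD(1)[OF \<sigma>] by blast
      then show ?thesis by (simp add: \<Phi>_def)
    qed
    have close: "cmod (\<sigma> n p q - \<Phi> p q) \<le> e * (nu p * nu q)"
      if "p \<in> unitization" "q \<in> unitization" "n \<ge> M"
        and M: "\<And>m n. m \<ge> M \<Longrightarrow> n \<ge> M \<Longrightarrow> fnorm (\<lambda>p q. \<sigma> m p q - \<sigma> n p q) \<le> e" for M e n p q
    proof (rule tendsto_upperbound)
      show "(\<lambda>m. cmod (\<sigma> n p q - \<sigma> m p q)) \<longlonglongrightarrow> cmod (\<sigma> n p q - \<Phi> p q)"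
        by (intro tendsto_intros lim)
      show "\<forall>\<^sub>F m in sequentially. cmod (\<sigma> n p q - \<sigma> m p q) \<le> e * (nu p * nu q)"
        using eventually_ge_at_top[of M]
      proof eventually_elim
        case (elim m)
        have "fnorm (\<lambda>p q. \<sigma> n p q - \<sigma> m p q) * (nu p * nu q) \<le> e * (nu p * nu q)"
          using M[OF \<open>n \<ge> M\<close> elim] nu_nonneg that by (intro mult_right_mono) auto
        with diff[OF that(1,2), of n m] show ?case by simp
      qed
    qed simp
    obtain M1 where M1: "\<And>m n. m \<ge> M1 \<Longrightarrow> n \<ge> M1 \<Longrightarrow> fnorm (\<lambda>p q. \<sigma> m p q - \<sigma> n p q) \<le> 1"
      using cauchy[of 1] by (meson less_imp_le zero_less_one)
    have \<Phi>: "bform \<Phi>"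
    proof (rule bformI)
      show "\<Phi> p q = 0" if "p \<notin> unitization \<or> q \<notin> unitization" for p q
        using bformD(1)[OF \<sigma> that] by (simp add: \<Phi>_def)
      fix p p' q :: "complex \<times> 'a" and c
      assume [simp]: "p \<in> unitization" "q \<in> unitization"
      show "\<Phi> (scU c p) q = c * \<Phi> p q"
        using lim[of "scU c p" q] tendsto_mult_left[OF lim[of p q], of c]
        by (simp add: bformD(4)[OF \<sigma>] LIMSEQ_unique)
      show "\<Phi> p (scU c q) = c * \<Phi> p q"
        using lim[of p "scU c q"] tendsto_mult_left[OF lim[of p q], of c]
        by (simp add: bformD(5)[OF \<sigma>] LIMSEQ_unique)
      have "cmod (\<Phi> p q) \<le> cmod (\<sigma> M1 p q) + cmod (\<sigma> M1 p q - \<Phi> p q)"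
        using norm_triangle_ineq4[of "\<sigma> M1 p q" "\<sigma> M1 p q - \<Phi> p q"] by simp
      also have "\<dots> \<le> fnorm (\<sigma> M1) * (nu p * nu q) + 1 * (nu p * nu q)"
        using fnorm_bound[OF \<sigma>, of p q M1] close[of p q M1 M1 1] M1 by (intro add_mono) auto
      finally show "cmod (\<Phi> p q) \<le> (fnorm (\<sigma> M1) + 1) * (nu p * nu q)" by (simp add: algebra_simps)
      assume [simp]: "p' \<in> unitization"
      show "\<Phi> (p + p') q = \<Phi> p q + \<Phi> p' q"
        using lim[of "p + p'" q] tendsto_add[OF lim[of p q] lim[of p' q]]
        by (simp add: bformD(2)[OF \<sigma>] LIMSEQ_unique)
      show "\<Phi> q (p + p') = \<Phi> q p + \<Phi> q p'"
        using lim[of q "p + p'"] tendsto_add[OF lim[of q p] lim[of q p']]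
        by (simp add: bformD(3)[OF \<sigma>] LIMSEQ_unique)
    qed (simp add: \<Phi>_def bformD(6)[OF \<sigma>])
    have "\<exists>M. \<forall>n\<ge>M. fnorm (\<lambda>p q. \<sigma> n p q - \<Phi> p q) < e" if e: "e > 0" for e
    proof -
      obtain M where M: "\<And>m n. m \<ge> M \<Longrightarrow> n \<ge> M \<Longrightarrow> fnorm (\<lambda>p q. \<sigma> m p q - \<sigma> n p q) \<le> e / 2"
        using cauchy[of "e / 2"] e by (meson less_imp_le half_gt_zero)
      have "fnorm (\<lambda>p q. \<sigma> n p q - \<Phi> p q) \<le> e / 2" if "n \<ge> M" for n
        using close[OF _ _ that M] e by (intro fnorm_le) auto
      with e show ?thesis by (intro exI[of _ M]) force
    qed
    then have "limitin mtopology \<sigma> \<Phi> sequentially"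
      using \<sigma> \<Phi> by (simp add: limit_metric_sequentially dist)
    then show ?thesis by blast
  qed
  then show ?thesis by (simp add: mcomplete_def)
qed

lemma complex_banach_forms: "complex_banach forms"
  by (simp add: complex_banach_iff complex_normed_forms mcomplete_forms)

text \<open>The factor 2 pays for the correction term, which obeys the same bound as the main
  term.\<close>

lemma bform_lact:
    "a \<in> S \<Longrightarrow> bform \<Phi> \<Longrightarrow> bform (lact forms a \<Phi>)"
  and fnorm_lact: "a \<in> S \<Longrightarrow> bform \<Phi> \<Longrightarrow> fnorm (lact forms a \<Phi>) \<le> 2 * N a * fnorm \<Phi>"
proof -
  assume a: "a \<in> S" and \<Phi>: "bform \<Phi>"
  have bound: "cmod (lact forms a \<Phi> p q) \<le> (2 * N a * fnorm \<Phi>) * (nu p * nu q)"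
    if p: "p \<in> unitization" and q: "q \<in> unitization" for p q
  proof -
    have "cmod (\<Phi> p (act a q)) \<le> fnorm \<Phi> * (nu p * nu (act a q))"
      by (rule fnorm_bound[OF \<Phi> p unitization_act[OF a q]])
    also have "\<dots> \<le> fnorm \<Phi> * (nu p * (N a * nu q))"
      by (intro mult_left_mono nu_act[OF a q] nu_nonneg p fnorm_nonneg[OF \<Phi>])
    finally have 1: "cmod (\<Phi> p (act a q)) \<le> N a * fnorm \<Phi> * (nu p * nu q)" by (simp add: mult_ac)
    have "cmod (\<Phi> (1, 0) (0, a)) \<le> fnorm \<Phi> * N a"
      using fnorm_bound[OF \<Phi>, of "(1, 0)" "(0, a)"] a by (simp add: nu_def zero_mem)
    moreover have "cmod (fst p) \<le> nu p" "cmod (fst q) \<le> nu q"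
      using p q by (auto simp: nu_def unitization_def N_nonneg)
    ultimately have "cmod (fst p * fst q * \<Phi> (1, 0) (0, a)) \<le> nu p * nu q * (fnorm \<Phi> * N a)"
      unfolding norm_mult using p q by (intro mult_mono) (auto simp: nu_nonneg)
    with 1 norm_triangle_ineq4[of "\<Phi> p (act a q)" "fst p * fst q * \<Phi> (1, 0) (0, a)"] p q
    show ?thesis by (simp add: algebra_simps)
  qed
  show "bform (lact forms a \<Phi>)"
    by (rule bformI[OF _ _ _ _ _ _ bound])
      (auto simp: unitization_mem a bformD[OF \<Phi>] act_simps zero_mem algebra_simps,
       auto simp: scU_def)
  show "fnorm (lact forms a \<Phi>) \<le> 2 * N a * fnorm \<Phi>"
    by (rule fnorm_le[OF _ bound]) (simp_all add: a \<Phi> fnorm_nonneg N_nonneg)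
qed

lemma bform_flip:
  assumes \<Phi>: "bform \<Phi>"
  shows "bform (\<lambda>p q. \<Phi> q p)"
proof (rule bformI)
  show "cmod (\<Phi> q p) \<le> fnorm \<Phi> * (nu p * nu q)" if "p \<in> unitization" "q \<in> unitization" for p q
    using fnorm_bound[OF \<Phi> that(2,1)] by (simp only: mult.commute[of "nu p" "nu q"])
  show "\<Phi> q p = 0" if "p \<notin> unitization \<or> q \<notin> unitization" for p q
    using that by (intro bformD(1)[OF \<Phi>]) blast
qed (simp_all add: bformD(2-6)[OF \<Phi>])

lemma fnorm_flip_le:
  assumes \<Phi>: "bform \<Phi>"
  shows "fnorm (\<lambda>p q. \<Phi> q p) \<le> fnorm \<Phi>"
proof (rule fnorm_le[OF fnorm_nonneg[OF \<Phi>]])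
  show "cmod (\<Phi> q p) \<le> fnorm \<Phi> * (nu p * nu q)" if "p \<in> unitization" "q \<in> unitization" for p q
    using fnorm_bound[OF \<Phi> that(2,1)] by (simp only: mult.commute[of "nu p" "nu q"])
qed

text \<open>Swapping the two arguments of a form exchanges the two actions, so what is proved for
  \<open>lact\<close> carries over to \<open>ract\<close>.\<close>

lemma ract_flip: "ract forms \<Phi> a = (\<lambda>p q. lact forms a (\<lambda>p q. \<Phi> q p) q p)"
proof (intro ext)
  fix p q
  show "ract forms \<Phi> a p q = lact forms a (\<lambda>p q. \<Phi> q p) q p"
    by (cases "p \<in> unitization"; cases "q \<in> unitization") (simp_all add: mult.commute[of "fst p" "fst q"])
qed

lemma bform_ract:
  assumes "a \<in> S" "bform \<Phi>"
  shows "bform (ract forms \<Phi> a)"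
  unfolding ract_flip by (rule bform_flip[OF bform_lact[OF assms(1) bform_flip[OF assms(2)]]])

lemma fnorm_ract:
  assumes a: "a \<in> S" and \<Phi>: "bform \<Phi>"
  shows "fnorm (ract forms \<Phi> a) \<le> 2 * N a * fnorm \<Phi>"
proof -
  have "fnorm (ract forms \<Phi> a) \<le> fnorm (lact forms a (\<lambda>p q. \<Phi> q p))"
    unfolding ract_flip by (rule fnorm_flip_le[OF bform_lact[OF a bform_flip[OF \<Phi>]]])
  also have "\<dots> \<le> 2 * N a * fnorm (\<lambda>p q. \<Phi> q p)"
    by (rule fnorm_lact[OF a bform_flip[OF \<Phi>]])
  also have "\<dots> \<le> 2 * N a * fnorm \<Phi>"
    using N_nonneg[OF a] by (intro mult_left_mono fnorm_flip_le[OF \<Phi>]) simp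
  finally show ?thesis .
qed

lemma scU_pair: "scU c (0, a) = (0, sc c a)"
  by (simp add: scU_def)

text \<open>The composite left action produces \<open>mul b a\<close>, so commutativity enters in
  the left module law. Iterated corrections collapse because values of \<open>act\<close> have
  scalar part 0.\<close>

lemma banach_bimodule_forms: "banach_bimodule alg forms"
proof -
  note [simp del] = forms_simps(6,7)
  note acts = forms_simps(6,7)
  have add0: "(0 :: complex, a + b) = (0, a) + (0, b)" for a b :: 'a
    by simp
  have "complex_linear forms forms (lact forms a)" "complex_linear forms forms (\<lambda>\<Phi>. ract forms \<Phi> a)"
    if "a \<in> S" for a
    using that by (auto simp: complex_linear_def bform_lact[unfolded acts] bform_ract[unfolded acts] acts fun_eq_iff algebra_simps)
  moreover have "complex_linear alg forms (\<lambda>a. lact forms a \<Phi>)" if \<Phi>: "bform \<Phi>" for \<Phi>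
    using \<Phi> unfolding complex_linear_def
    by (auto simp: bform_lact[unfolded acts] acts fun_eq_iff algebra_simps act_simps add0 scU_pair[symmetric] unitization_mem bformD[OF \<Phi>]
        zero_mem simp del: add_Pair)
  moreover have "complex_linear alg forms (ract forms \<Phi>)" if \<Phi>: "bform \<Phi>" for \<Phi>
    using \<Phi> unfolding complex_linear_def
    by (auto simp: bform_ract[unfolded acts] acts fun_eq_iff algebra_simps act_simps add0 scU_pair[symmetric] unitization_mem bformD[OF \<Phi>]
        zero_mem simp del: add_Pair)
  moreover have "lact forms a (lact forms b \<Phi>) = lact forms (mul a b) \<Phi>"
      "ract forms (ract forms \<Phi> a) b = ract forms \<Phi> (mul a b)"
      "ract forms (lact forms a \<Phi>) b = lact forms a (ract forms \<Phi> b)"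
    if "a \<in> S" "b \<in> S" "bform \<Phi>" for a b \<Phi>
    using that
    by (auto simp: acts fun_eq_iff act_simps unitization_mem zero_mem mem mul_commute[of b a])
  moreover have "\<exists>K. \<forall>a\<in>S. \<forall>\<Phi>\<in>carrier forms.
     fnorm (lact forms a \<Phi>) \<le> K * N a * fnorm \<Phi> \<and> fnorm (ract forms \<Phi> a) \<le> K * N a * fnorm \<Phi>"
    by (intro exI[of _ 2]) (auto simp: fnorm_lact fnorm_ract)
  ultimately show ?thesis
    unfolding banach_bimodule_def by (simp add: complex_banach_forms)
qed

section \<open>The derivation a \<otimes> 1 - 1 \<otimes> a and approximate diagonals\<close>

definition deriv :: "'a \<Rightarrow> 'a bimodule_univ \<Rightarrow> complex" where
  "deriv a = (\<lambda>\<Phi>\<in>carrier forms. \<Phi> (0, a) (1, 0) - \<Phi> (1, 0) (0, a))"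

lemma deriv_bound:
  assumes "a \<in> S" "bform \<Phi>"
  shows "cmod (deriv a \<Phi>) \<le> 2 * N a * fnorm \<Phi>"
  using assms fnorm_bound[OF assms(2), of "(0, a)" "(1, 0)"] fnorm_bound[OF assms(2), of "(1, 0)" "(0, a)"]
    norm_triangle_ineq4[of "\<Phi> (0, a) (1, 0)" "\<Phi> (1, 0) (0, a)"]
  by (simp add: deriv_def nu_def zero_mem algebra_simps)

lemma deriv_mem: "a \<in> S \<Longrightarrow> deriv a \<in> carrier (dual_bimodule forms)"
proof (rule dual_carrierI)
  assume a: "a \<in> S"
  show "cmod (deriv a \<Phi>) \<le> (2 * N a) * vnorm forms \<Phi>" if "\<Phi> \<in> carrier forms" for \<Phi>
    using deriv_bound[OF a] that by simp
qed (auto simp: deriv_def bform_add bform_scale algebra_simps)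

lemma complex_linear_deriv: "complex_linear alg (dual_bimodule forms) deriv"
proof -
  have "(0 :: complex, x + y) = (0, x) + (0, y)" for x y :: 'a by simp
  then have "deriv (x + y) = (\<lambda>\<Phi>\<in>carrier forms. deriv x \<Phi> + deriv y \<Phi>)" if "x \<in> S" "y \<in> S" for x y
    using that by (auto simp: deriv_def fun_eq_iff bformD zero_mem simp del: add_Pair)
  moreover have "deriv (sc c x) = (\<lambda>\<Phi>\<in>carrier forms. c * deriv x \<Phi>)" if "x \<in> S" for c x
    using that by (auto simp: deriv_def fun_eq_iff scU_pair[symmetric] bformD zero_mem algebra_simps)
  ultimately show ?thesis
    by (auto simp: complex_linear_def deriv_mem) (simp_all add: dual_bimodule_def)
qed

lemma continuous_derivation_deriv: "continuous_derivation alg (dual_bimodule forms) deriv"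
proof -
  let ?Y = "dual_bimodule forms"
  interpret A: Metric_space S "ndist alg"
    using complex_normed_metric[OF complex_normed_alg] by simp
  interpret Y: Metric_space "carrier ?Y" "ndist ?Y"
    by (rule complex_normed_metric[OF complex_normed_dual[OF complex_normed_forms]])
  have lin: "deriv x \<ominus>\<^bsub>?Y\<^esub> deriv y = deriv (x - y)" if "x \<in> S" "y \<in> S" for x y
  proof -
    have "deriv (x + sc (- 1) y) = deriv x \<oplus>\<^bsub>?Y\<^esub> (- 1 \<odot>\<^bsub>?Y\<^esub> deriv y)"
      using complex_linear_deriv that by (auto simp: complex_linear_def mem)
    then show ?thesis
      using complex_module_minus[of ?Y "deriv x" "deriv y"] complex_normed_dual[OF complex_normed_forms] that
      by (simp add: complex_normed_def deriv_mem sc_minus_one)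
  qed
  have "continuous_map A.mtopology Y.mtopology deriv"
    unfolding A.metric_continuous_map[OF Y.Metric_space_axioms]
  proof (intro conjI ballI allI impI)
    fix x and e :: real assume x: "x \<in> S" and e: "e > 0"
    have "ndist ?Y (deriv x) (deriv y) < e" if "y \<in> S" "ndist alg x y < e / 2" for y
    proof -
      have "vnorm ?Y (deriv (x - y)) \<le> 2 * N (x - y)"
        using deriv_bound x that by (intro dual_norm_le[OF complex_normed_forms]) (auto simp: mem N_nonneg)
      then show ?thesis
        using x that by (simp add: ndist_def deriv_mem lin alg_minus)
    qed
    with e show "\<exists>d>0. \<forall>y. y \<in> S \<and> ndist alg x y < d \<longrightarrow> ndist ?Y (deriv x) (deriv y) < e"
      by (intro exI[of _ "e / 2"]) auto
  qed (use deriv_mem in auto)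
  \<comment> \<open>The mixed value \<open>\<Phi> (0, a) (0, b)\<close> occurs once with each sign.
    All corrections vanish, as in each term one argument has scalar part 0.\<close>
  moreover have "deriv (mul a b) = lact ?Y a (deriv b) \<oplus>\<^bsub>?Y\<^esub> ract ?Y (deriv a) b"
    if "a \<in> S" "b \<in> S" for a b
    using that bform_lact[OF that(2)] bform_ract[OF that(1)]
    by (auto simp: deriv_def dual_bimodule_def fun_eq_iff act_simps mem mul_commute[of b a])
  ultimately show ?thesis
    by (simp add: continuous_derivation_def complex_linear_deriv)
qed

text \<open>The functional \<open>m\<close> is a single member of the net, far enough along it for
  the finitely many elements of \<open>A0\<close>. Its norm bound \<open>M\<close> may depend on
  \<open>A0\<close> and \<open>e\<close> in an unknown way. The actions on the dual are written out
  as the transposed actions on forms.\<close>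

lemma approximate_diagonal:
  assumes "approximately_amenable TYPE('a bimodule_univ) alg"
    and A0: "finite A0" "A0 \<subseteq> S" and e: "e > 0"
  obtains m M where
    "\<And>\<Phi> \<Psi>. bform \<Phi> \<Longrightarrow> bform \<Psi> \<Longrightarrow> m (\<lambda>p q. \<Phi> p q + \<Psi> p q) = m \<Phi> + m \<Psi>"
    "\<And>c \<Phi>. bform \<Phi> \<Longrightarrow> m (\<lambda>p q. c * \<Phi> p q) = c * m \<Phi>"
    "\<And>\<Phi>. bform \<Phi> \<Longrightarrow> cmod (m \<Phi>) \<le> M * fnorm \<Phi>" "M \<ge> 0"
    "\<And>a \<Phi>. a \<in> A0 \<Longrightarrow> bform \<Phi> \<Longrightarrow>
       cmod (m (ract forms \<Phi> a) - m (lact forms a \<Phi>) - (\<Phi> (0, a) (1, 0) - \<Phi> (1, 0) (0, a))) \<le> e * fnorm \<Phi>"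
proof -
  let ?Y = "dual_bimodule forms"
  note normed = complex_normed_dual[OF complex_normed_forms]
  interpret Y: Metric_space "carrier ?Y" "ndist ?Y"
    by (rule complex_normed_metric[OF normed])
  have "approximately_inner alg ?Y deriv"
    using assms(1) banach_bimodule_forms continuous_derivation_deriv
    unfolding approximately_amenable_def by blast
  then obtain F where F: "F \<noteq> bot" "\<forall>\<^sub>F y in F. y \<in> carrier ?Y"
    and lim: "\<And>a. a \<in> S \<Longrightarrow> limitin Y.mtopology (\<lambda>y. lact ?Y a y \<ominus>\<^bsub>?Y\<^esub> ract ?Y y a) (deriv a) F"
    unfolding approximately_inner_def by auto
  have "\<forall>\<^sub>F y in F. \<forall>a\<in>A0. lact ?Y a y \<ominus>\<^bsub>?Y\<^esub> ract ?Y y a \<in> carrier ?Y \<and>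
      ndist ?Y (lact ?Y a y \<ominus>\<^bsub>?Y\<^esub> ract ?Y y a) (deriv a) < e"
    using lim A0 e by (intro eventually_ball_finite) (auto simp: Y.limitin_metric)
  with F(2) have "\<forall>\<^sub>F y in F. y \<in> carrier ?Y \<and> (\<forall>a\<in>A0. lact ?Y a y \<ominus>\<^bsub>?Y\<^esub> ract ?Y y a \<in> carrier ?Y \<and>
      ndist ?Y (lact ?Y a y \<ominus>\<^bsub>?Y\<^esub> ract ?Y y a) (deriv a) < e)"
    by eventually_elim simp
  then obtain m where m: "m \<in> carrier ?Y"
    and close: "\<And>a. a \<in> A0 \<Longrightarrow> lact ?Y a m \<ominus>\<^bsub>?Y\<^esub> ract ?Y m a \<in> carrier ?Y"
      "\<And>a. a \<in> A0 \<Longrightarrow> ndist ?Y (lact ?Y a m \<ominus>\<^bsub>?Y\<^esub> ract ?Y m a) (deriv a) < e"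
    using eventually_happens'[OF F(1)] by blast
  define M where "M = vnorm ?Y m"
  show ?thesis
  proof (rule that[of m M])
    show "m (\<lambda>p q. \<Phi> p q + \<Psi> p q) = m \<Phi> + m \<Psi>" if "bform \<Phi>" "bform \<Psi>" for \<Phi> \<Psi>
      using dual_carrierD(2)[OF m, of \<Phi> \<Psi>] that by simp
    show "m (\<lambda>p q. c * \<Phi> p q) = c * m \<Phi>" if "bform \<Phi>" for c \<Phi>
      using dual_carrierD(3)[OF m, of \<Phi> c] that by simp
    show "cmod (m \<Phi>) \<le> M * fnorm \<Phi>" if "bform \<Phi>" for \<Phi>
      using dual_norm_bound[OF complex_normed_forms m, of \<Phi>] that by (simp add: M_def)
    show "M \<ge> 0" using complex_normed_nonneg[OF normed m] by (simp add: M_def)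
    fix a \<Phi> assume a: "a \<in> A0" and \<Phi>: "bform \<Phi>"
    with A0 have aS: "a \<in> S" by blast
    have mod: "Module.module complex_ring ?Y" using normed by (simp add: complex_normed_def)
    have mem': "lact ?Y a m \<in> carrier ?Y" "ract ?Y m a \<in> carrier ?Y"
    proof -
      have lin: "complex_linear forms forms (lact forms a)" "complex_linear forms forms (\<lambda>x. ract forms x a)"
        using banach_bimodule_forms aS by (simp_all add: banach_bimodule_def)
      have Mle: "cmod (m \<Psi>) \<le> M * fnorm \<Psi>" if "bform \<Psi>" for \<Psi>
        using dual_norm_bound[OF complex_normed_forms m, of \<Psi>] that by (simp add: M_def)
      have M0: "M \<ge> 0" using complex_normed_nonneg[OF normed m] by (simp add: M_def)
      have eqs: "lact ?Y a m = (\<lambda>x\<in>carrier forms. m (ract forms x a))"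
        "ract ?Y m a = (\<lambda>x\<in>carrier forms. m (lact forms a x))"
        by (simp_all only: dual_bimodule_def normed_bimodule.simps)
      have 1: "cmod (m (ract forms \<Psi> a)) \<le> (M * (2 * N a)) * vnorm forms \<Psi>" if "\<Psi> \<in> carrier forms" for \<Psi>
        using order_trans[OF Mle[OF bform_ract[OF aS, of \<Psi>]] mult_left_mono[OF fnorm_ract[OF aS, of \<Psi>] M0]] that
        by (simp only: forms_simps(1,5) mult.assoc)
      have 2: "cmod (m (lact forms a \<Psi>)) \<le> (M * (2 * N a)) * vnorm forms \<Psi>" if "\<Psi> \<in> carrier forms" for \<Psi>
        using order_trans[OF Mle[OF bform_lact[OF aS, of \<Psi>]] mult_left_mono[OF fnorm_lact[OF aS, of \<Psi>] M0]] that
        by (simp only: forms_simps(1,5) mult.assoc)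
      note cl = complex_normed_add_closed[OF complex_normed_forms] complex_normed_smult_closed[OF complex_normed_forms]
      show "lact ?Y a m \<in> carrier ?Y" unfolding eqs
        by (rule dual_carrierI[where K = "M * (2 * N a)"])
          (use 1 lin(2) dual_carrierD(2,3)[OF m] cl in \<open>auto simp: complex_linear_def Pi_iff simp del: forms_simps\<close>)
      show "ract ?Y m a \<in> carrier ?Y" unfolding eqs
        by (rule dual_carrierI[where K = "M * (2 * N a)"])
          (use 2 lin(1) dual_carrierD(2,3)[OF m] cl in \<open>auto simp: complex_linear_def Pi_iff simp del: forms_simps\<close>)
    qed
    let ?d = "lact ?Y a m \<ominus>\<^bsub>?Y\<^esub> ract ?Y m a"
    have "?d \<ominus>\<^bsub>?Y\<^esub> deriv a \<in> carrier ?Y"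
      using close(1)[OF a] deriv_mem[OF aS] mod
      by (metis abelian_group.minus_closed Module.module.axioms(2))
    then have "cmod ((?d \<ominus>\<^bsub>?Y\<^esub> deriv a) \<Phi>) \<le> vnorm ?Y (?d \<ominus>\<^bsub>?Y\<^esub> deriv a) * vnorm forms \<Phi>"
      using \<Phi> by (intro dual_norm_bound[OF complex_normed_forms]) auto
    also have "\<dots> \<le> e * fnorm \<Phi>"
      using close(2)[OF a] close(1)[OF a] deriv_mem[OF aS] fnorm_nonneg[OF \<Phi>] e
      by (intro mult_mono) (auto simp: ndist_def)
    also have "(?d \<ominus>\<^bsub>?Y\<^esub> deriv a) \<Phi> = m (ract forms \<Phi> a) - m (lact forms a \<Phi>) - deriv a \<Phi>"
      using \<Phi> dual_minus_apply[OF complex_normed_forms close(1)[OF a] deriv_mem[OF aS], of \<Phi>]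
        dual_minus_apply[OF complex_normed_forms mem', of \<Phi>]
      by (simp del: forms_simps(6,7)) (simp add: dual_bimodule_def del: forms_simps(6,7))
    finally show "cmod (m (ract forms \<Phi> a) - m (lact forms a \<Phi>) - (\<Phi> (0, a) (1, 0) - \<Phi> (1, 0) (0, a)))
        \<le> e * fnorm \<Phi>"
      using \<Phi> by (simp add: deriv_def del: forms_simps(6,7))
  qed
qed

section \<open>Bounded functionals and three kinds of test forms\<close>

definition bfun :: "real \<Rightarrow> ('a \<Rightarrow> complex) \<Rightarrow> bool" where
  "bfun K \<phi> \<longleftrightarrow> (\<forall>x\<in>S. \<forall>y\<in>S. \<phi> (x + y) = \<phi> x + \<phi> y) \<and> (\<forall>c. \<forall>x\<in>S. \<phi> (sc c x) = c * \<phi> x) \<and>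
     (\<forall>x\<in>S. cmod (\<phi> x) \<le> K * N x)"

lemma bfunD:
  assumes "bfun K \<phi>"
  shows "x \<in> S \<Longrightarrow> y \<in> S \<Longrightarrow> \<phi> (x + y) = \<phi> x + \<phi> y" "x \<in> S \<Longrightarrow> \<phi> (sc c x) = c * \<phi> x"
    "x \<in> S \<Longrightarrow> cmod (\<phi> x) \<le> K * N x" "\<phi> 0 = 0"
proof -
  show "x \<in> S \<Longrightarrow> y \<in> S \<Longrightarrow> \<phi> (x + y) = \<phi> x + \<phi> y" and sc: "\<And>c. x \<in> S \<Longrightarrow> \<phi> (sc c x) = c * \<phi> x"
    "x \<in> S \<Longrightarrow> cmod (\<phi> x) \<le> K * N x" for x
    using assms by (auto simp: bfun_def)
  show "\<phi> 0 = 0" using sc(1)[of 0 0] zero_mem by simp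
qed

lemma bfun_mul:
  assumes "bfun L \<phi>" "t \<in> S" "\<And>x. x \<in> S \<Longrightarrow> N (mul t x) \<le> K * N x" "L \<ge> 0"
  shows "bfun (L * K) (\<lambda>x. \<phi> (mul t x))"
  unfolding bfun_def
proof (intro conjI ballI allI)
  fix x assume x: "x \<in> S"
  have "cmod (\<phi> (mul t x)) \<le> L * N (mul t x)" using x assms by (intro bfunD) (auto simp: mem)
  also have "\<dots> \<le> L * (K * N x)" using assms x by (intro mult_left_mono) auto
  finally show "cmod (\<phi> (mul t x)) \<le> L * K * N x" by simp
qed (use assms in \<open>auto simp: mul_add mul_sc bfunD mem\<close>)

text \<open>Real Hahn-Banach with \<open>N\<close> as the sublinear function, followed by the usual
  complexification f(y) - i f(iy). The bound survives because each value can be rotated to the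
  positive real axis.\<close>

lemma norming_functional:
  assumes x: "x \<in> S"
  obtains \<phi> where "bfun 1 \<phi>" "\<phi> x = of_real (N x)"
proof -
  have sub: "subspace S" by (simp add: subspace_def mem)
  have sl: "sublinear_on S N" by (simp add: sublinear_on_def N_triangle N_scaleR)
  obtain f where f: "\<And>x y. x \<in> S \<Longrightarrow> y \<in> S \<Longrightarrow> f (x + y) = f x + f y"
    "\<And>r x. x \<in> S \<Longrightarrow> f (r *\<^sub>R x) = r * f x" "\<And>x. x \<in> S \<Longrightarrow> f x \<le> N x" "f x = N x"
    by (rule hahn_banach_real[OF sub sl x]) (rule that, assumption+)
  define \<phi> where "\<phi> y = Complex (f y) (- f (sc \<i> y))" for y
  have sc_decomp: "sc c y = Re c *\<^sub>R y + Im c *\<^sub>R sc \<i> y" for c y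
  proof -
    have "c = of_real (Re c) + of_real (Im c) * \<i>"
      by (simp add: complex_eq_iff)
    then have "sc c y = sc (of_real (Re c) + of_real (Im c) * \<i>) y"
      by (rule arg_cong)
    then show ?thesis by (simp only: sc_add_left sc_sc[symmetric] sc_of_real)
  qed
  have ii: "sc \<i> (sc \<i> y) = - y" for y using sc_sc[of \<i> \<i> y] by (simp add: sc_minus_one)
  have fneg: "f (- y) = - f y" if "y \<in> S" for y using f(2)[OF that, of "- 1"] by simp
  have fsc: "f (sc c y) = Re c * f y + Im c * f (sc \<i> y)" if "y \<in> S" for c y
    using that by (simp add: sc_decomp[of c y] f mem)
  have hom: "\<phi> (sc c y) = c * \<phi> y" if "y \<in> S" for c y
    using fsc[OF that, of c] fsc[OF that, of "\<i> * c"] by (simp add: \<phi>_def complex_eq_iff sc_sc)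
  have bound: "cmod (\<phi> y) \<le> N y" if y: "y \<in> S" for y
  proof (cases "\<phi> y = 0")
    case True
    then show ?thesis using N_nonneg[OF y] by simp
  next
    case False
    define c where "c = cnj (\<phi> y) / of_real (cmod (\<phi> y))"
    have "\<phi> (sc c y) = (\<phi> y * cnj (\<phi> y)) / of_real (cmod (\<phi> y))"
      by (simp add: hom[OF y] c_def)
    also have "\<phi> y * cnj (\<phi> y) = of_real (cmod (\<phi> y)) * of_real (cmod (\<phi> y))"
      using complex_norm_square[of "\<phi> y"] by (simp only: power2_eq_square of_real_mult)
    finally have "\<phi> (sc c y) = of_real (cmod (\<phi> y))" using False by simp
    then have "Re (\<phi> (sc c y)) = cmod (\<phi> y)" by (simp only: Re_complex_of_real)
    then have "cmod (\<phi> y) = f (sc c y)" unfolding \<phi>_def[of "sc c y"] by simp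
    also have "\<dots> \<le> N (sc c y)" using y by (intro f(3) sc_mem)
    also have "\<dots> = N y" using False y by (simp add: N_sc c_def norm_divide)
    finally show ?thesis .
  qed
  show ?thesis
  proof (rule that[of \<phi>])
    show "bfun 1 \<phi>"
    proof -
      have "\<phi> (y + z) = \<phi> y + \<phi> z" if "y \<in> S" "z \<in> S" for y z
        using f(1)[OF that] f(1)[OF sc_mem[OF that(1)] sc_mem[OF that(2)], of \<i> \<i>]
        by (simp only: \<phi>_def sc_add_right complex_eq_iff complex.sel plus_complex.sel) simp
      then show ?thesis using hom bound by (auto simp: bfun_def)
    qed
    have "Re (\<phi> x) = N x" by (simp add: \<phi>_def f(4))
    \<comment> \<open>The real part alone already has the largest modulus that the bound
      allows.\<close>
    moreover have "Im (\<phi> x) = 0"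
    proof -
      have "(N x)\<^sup>2 + (Im (\<phi> x))\<^sup>2 = (cmod (\<phi> x))\<^sup>2" using \<open>Re (\<phi> x) = N x\<close> by (simp add: cmod_power2)
      also have "\<dots> \<le> (N x)\<^sup>2" using bound[OF x] by (intro power_mono) auto
      finally show ?thesis by simp
    qed
    ultimately show "\<phi> x = of_real (N x)" by (simp add: complex_eq_iff)
  qed
qed

text \<open>Splitting each factor of the unitization into scalars and \<open>S\<close> splits a
  tensor into parts in S \<otimes> S, S \<otimes> 1, 1 \<otimes> S and 1 \<otimes> 1. The forms
  \<open>tens\<close>, \<open>lform\<close> and \<open>rform\<close> see exactly one of the first
  three; the last is removed by the normalisation at \<open>(1, 1)\<close>.\<close>

definition tens :: "('a \<Rightarrow> complex) \<Rightarrow> ('a \<Rightarrow> complex) \<Rightarrow> 'a bimodule_univ" where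
  "tens \<phi> \<psi> = (\<lambda>p q. if p \<in> unitization \<and> q \<in> unitization then \<phi> (snd p) * \<psi> (snd q) else 0)"
definition lform :: "('a \<Rightarrow> complex) \<Rightarrow> 'a bimodule_univ" where
  "lform \<phi> = (\<lambda>p q. if p \<in> unitization \<and> q \<in> unitization then fst q * \<phi> (snd p) else 0)"
definition rform :: "('a \<Rightarrow> complex) \<Rightarrow> 'a bimodule_univ" where
  "rform \<psi> = (\<lambda>p q. if p \<in> unitization \<and> q \<in> unitization then fst p * \<psi> (snd q) else 0)"

lemma unitization_snd: "p \<in> unitization \<longleftrightarrow> snd p \<in> S"
  by (cases p) simp

lemma snd_scU [simp]: "snd (scU c p) = sc c (snd p)" "fst (scU c p) = c * fst p"
  by (simp_all add: scU_def)

lemma cmod_fst_le_nu: "p \<in> unitization \<Longrightarrow> cmod (fst p) \<le> nu p"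
  and N_snd_le_nu: "p \<in> unitization \<Longrightarrow> N (snd p) \<le> nu p"
  by (auto simp: nu_def unitization_def N_nonneg)

lemma bfun_nu:
  assumes "bfun K \<phi>" "K \<ge> 0" "p \<in> unitization"
  shows "cmod (\<phi> (snd p)) \<le> K * nu p"
  using bfunD(3)[OF assms(1), of "snd p"] mult_left_mono[OF N_snd_le_nu[OF assms(3)] assms(2)] assms(3)
  by (simp add: unitization_snd)

lemma bform_tens: "bfun K \<phi> \<Longrightarrow> bfun L \<psi> \<Longrightarrow> K \<ge> 0 \<Longrightarrow> L \<ge> 0 \<Longrightarrow> bform (tens \<phi> \<psi>)"
  and fnorm_tens: "bfun K \<phi> \<Longrightarrow> bfun L \<psi> \<Longrightarrow> K \<ge> 0 \<Longrightarrow> L \<ge> 0 \<Longrightarrow> fnorm (tens \<phi> \<psi>) \<le> K * L"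
proof -
  assume \<phi>: "bfun K \<phi>" "K \<ge> 0" and \<psi>: "bfun L \<psi>" "L \<ge> 0"
  have bound: "cmod (tens \<phi> \<psi> p q) \<le> (K * L) * (nu p * nu q)"
    if "p \<in> unitization" "q \<in> unitization" for p q
  proof -
    have "cmod (\<phi> (snd p)) * cmod (\<psi> (snd q)) \<le> (K * nu p) * (L * nu q)"
      using that by (intro mult_mono bfun_nu \<phi> \<psi>) (auto simp: nu_nonneg \<phi>)
    with that show ?thesis by (simp add: tens_def norm_mult mult_ac)
  qed
  show "bform (tens \<phi> \<psi>)"
    by (rule bformI[OF _ _ _ _ _ _ bound])
      (auto simp: tens_def unitization_snd mem bfunD(1,2,4)[OF \<phi>(1)] bfunD(1,2,4)[OF \<psi>(1)] algebra_simps)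
  show "fnorm (tens \<phi> \<psi>) \<le> K * L"
    by (rule fnorm_le[OF _ bound]) (use \<phi> \<psi> in auto)
qed

lemma bform_lform: "bfun K \<phi> \<Longrightarrow> K \<ge> 0 \<Longrightarrow> bform (lform \<phi>)"
  and fnorm_lform: "bfun K \<phi> \<Longrightarrow> K \<ge> 0 \<Longrightarrow> fnorm (lform \<phi>) \<le> K"
proof -
  assume \<phi>: "bfun K \<phi>" "K \<ge> 0"
  have bound: "cmod (lform \<phi> p q) \<le> K * (nu p * nu q)"
    if "p \<in> unitization" "q \<in> unitization" for p q
  proof -
    have "cmod (\<phi> (snd p)) * cmod (fst q) \<le> (K * nu p) * nu q"
      using that by (intro mult_mono bfun_nu \<phi> cmod_fst_le_nu) (auto simp: nu_nonneg \<phi>)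
    with that show ?thesis by (simp add: lform_def norm_mult mult_ac)
  qed
  show "bform (lform \<phi>)"
    by (rule bformI[OF _ _ _ _ _ _ bound])
      (auto simp: lform_def unitization_snd mem bfunD(1,2,4)[OF \<phi>(1)] algebra_simps)
  show "fnorm (lform \<phi>) \<le> K"
    by (rule fnorm_le[OF _ bound]) (use \<phi> in auto)
qed

lemma bform_rform:
  assumes "bfun K \<phi>" "K \<ge> 0"
  shows "bform (rform \<phi>)"
proof -
  have "rform \<phi> = (\<lambda>p q. lform \<phi> q p)" by (auto simp: rform_def lform_def fun_eq_iff)
  with bform_flip[OF bform_lform[OF assms]] show ?thesis by simp
qed

lemma mul_snd_act: "mul t (snd (act a p)) = sc (fst p) (mul t a) + mul (mul t a) (snd p)"
  by (simp add: act_def mul_add mul_sc mul_assoc)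

text \<open>
  The two test forms below are chosen so that their contributions through the \<open>A \<otimes> A\<close>-component
  of the approximate diagonal cancel; only the two one-sided components survive.
\<close>

lemma elimination_estimate:
  fixes \<alpha> c \<tau> e :: real
  assumes m_add: "\<And>\<Phi> \<Psi>. bform \<Phi> \<Longrightarrow> bform \<Psi> \<Longrightarrow> m (\<lambda>p q. \<Phi> p q + \<Psi> p q) = m \<Phi> + m \<Psi>"
    and m_scale: "\<And>c \<Phi>. bform \<Phi> \<Longrightarrow> m (\<lambda>p q. c * \<Phi> p q) = c * m \<Phi>"
    and m_close: "\<And>x \<Phi>. x \<in> {a, b} \<Longrightarrow> bform \<Phi> \<Longrightarrow>
       cmod (m (ract forms \<Phi> x) - m (lact forms x \<Phi>) - (\<Phi> (0, x) (1, 0) - \<Phi> (1, 0) (0, x))) \<le> e * fnorm \<Phi>"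
    and \<phi>: "bfun 1 \<phi>" and \<psi>: "bfun 1 \<psi>"
    and S: "a \<in> S" "b \<in> S" "T \<in> S" "Z \<in> S" "D \<in> S" "D2 \<in> S"
    and T: "mul T a = sc \<alpha> T" "mul T b = sc \<alpha> T"
    and ZD: "mul Z a = sc c D + sc \<tau> Z" "mul D a = sc c D2 + sc \<tau> D" "mul Z b = sc c D2 + sc \<tau> Z"
    and \<alpha>: "\<alpha> = c + \<tau>" "\<alpha> \<ge> 0" "e \<ge> 0"
    and K: "K \<ge> 0" "\<And>x. x \<in> S \<Longrightarrow> N (mul T x) \<le> K * N x" "\<And>x. x \<in> S \<Longrightarrow> N (mul Z x) \<le> K * N x"
      "\<And>x. x \<in> S \<Longrightarrow> N (mul D x) \<le> K * N x"
  shows "\<alpha> * cmod (\<phi> T * m (rform (\<lambda>x. \<psi> (mul D x))) - \<psi> D * m (lform (\<lambda>x. \<phi> (mul T x))))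
    \<le> 3 * K\<^sup>2 * e"
proof -
  define f where "f x = \<phi> (mul T x)" for x
  define g where "g x = \<psi> (mul Z x)" for x
  define h where "h x = \<psi> (mul D x)" for x
  define k where "k x = \<psi> (mul (Z + D) x)" for x
  have f: "bfun K f" and g: "bfun K g" and h: "bfun K h"
    using bfun_mul[OF \<phi> S(3) K(2)] bfun_mul[OF \<psi> S(4) K(3)] bfun_mul[OF \<psi> S(5) K(4)]
    by (simp_all add: f_def[abs_def] g_def[abs_def] h_def[abs_def])
  have "N (mul (Z + D) x) \<le> (2 * K) * N x" if "x \<in> S" for x
    using N_triangle[of "mul Z x" "mul D x"] K(3)[OF that] K(4)[OF that] S that
    by (simp add: mul_add_left mem)
  then have k: "bfun (2 * K) k"
    using bfun_mul[OF \<psi> add_mem[OF S(4,5)], of "2 * K"] by (simp add: k_def[abs_def])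
  have k_eq: "k x = g x + h x" if "x \<in> S" for x
    using that S by (simp add: k_def g_def h_def mul_add_left bfunD(1)[OF \<psi>] mem)
  \<comment> \<open>\<open>\<Phi>\<close> will be tested against a and \<open>\<Psi>\<close> against
    b. The hypotheses give (Z + D) a - Z b = (c + \<tau>) D, so in the difference of the two tests D
    behaves like an eigenvector with the eigenvalue \<alpha> of T.\<close>
  define \<Phi> where "\<Phi> = tens f k"
  define \<Psi> where "\<Psi> = tens f g"
  have \<Phi>: "bform \<Phi>" "fnorm \<Phi> \<le> 2 * K\<^sup>2" and \<Psi>: "bform \<Psi>" "fnorm \<Psi> \<le> K\<^sup>2"
    using bform_tens[OF f k] fnorm_tens[OF f k] bform_tens[OF f g] fnorm_tens[OF f g] K(1)
    by (simp_all add: \<Phi>_def \<Psi>_def power2_eq_square mult_ac)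
  have zero: "f 0 = 0" "g 0 = 0" "h 0 = 0" "k 0 = 0"
    by (rule bfunD(4)[OF f] bfunD(4)[OF g] bfunD(4)[OF h] bfunD(4)[OF k])+
  have f_act: "f (snd (act x p)) = \<alpha> * (fst p * \<phi> T + f (snd p))"
    if "p \<in> unitization" "mul T x = sc \<alpha> T" for x p
    using that S by (simp add: f_def mul_snd_act bfunD(1,2)[OF \<phi>] mem unitization_snd mul_sc_left algebra_simps)
  define d2 where "d2 q = fst q * \<psi> D2 + \<psi> (mul D2 (snd q))" for q
  define z where "z q = fst q * \<psi> Z + g (snd q)" for q
  define d where "d q = fst q * \<psi> D + h (snd q)" for q
  have expand: "\<psi> (mul (sc c' u + sc c'' v) (snd q) + sc (fst q) (sc c' u + sc c'' v)) =
     c' * (fst q * \<psi> u + \<psi> (mul u (snd q))) + c'' * (fst q * \<psi> v + \<psi> (mul v (snd q)))"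
    if "q \<in> unitization" "u \<in> S" "v \<in> S" for c' c'' u v q
    using that by (simp add: mul_add_left mul_sc_left sc_add_right sc_sc bfunD(1,2)[OF \<psi>] mem unitization_snd
        algebra_simps)
  have g_act: "g (snd (act a q)) = c * d q + \<tau> * z q" "g (snd (act b q)) = c * d2 q + \<tau> * z q"
    "h (snd (act a q)) = c * d2 q + \<tau> * d q"
    if "q \<in> unitization" for q
    using expand[OF that S(5,4), of c \<tau>] expand[OF that S(6,4), of c \<tau>] expand[OF that S(6,5), of c \<tau>]
    by (simp_all add: g_def h_def d_def z_def d2_def mul_snd_act ZD add.commute)
  have act_mem: "act x p \<in> unitization" if "x \<in> {a, b}" "p \<in> unitization" for x p
    using that S(1,2) unitization_act[of x p] by (elim insertE) simp_all
  \<comment> \<open>Both forms vanish when one argument is a pure scalar. Hence the corrections in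
    the actions disappear, and so does the value of the derivation: \<open>m\<close> nearly
    annihilates both commutators.\<close>
  have corr: "\<Phi> (0, x) (1, 0) = 0" "\<Phi> (1, 0) (0, x) = 0" "\<Psi> (0, x) (1, 0) = 0" "\<Psi> (1, 0) (0, x) = 0" for x
    by (simp_all add: \<Phi>_def \<Psi>_def tens_def zero)
  let ?r = "rform h" and ?l = "lform f"
  have forms: "bform ?r" "bform ?l" using bform_rform[OF h K(1)] bform_lform[OF f K(1)] by auto
  have "ract forms \<Phi> a p q - lact forms a \<Phi> p q - (ract forms \<Psi> b p q - lact forms b \<Psi> p q)
    = \<alpha> * \<phi> T * ?r p q + (- \<alpha> * \<psi> D) * ?l p q" for p q
  proof (cases "p \<in> unitization \<and> q \<in> unitization")
    case True
    then have q: "snd q \<in> S" "snd (act a q) \<in> S" using act_mem[of a q] by (auto simp: unitization_snd)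
    have "ract forms \<Phi> a p q - lact forms a \<Phi> p q - (ract forms \<Psi> b p q - lact forms b \<Psi> p q)
      = \<alpha> * (fst p * \<phi> T + f (snd p)) * (g (snd q) + h (snd q))
        - f (snd p) * (c * d q + \<tau> * z q + (c * d2 q + \<tau> * d q))
        - (\<alpha> * (fst p * \<phi> T + f (snd p)) * g (snd q) - f (snd p) * (c * d2 q + \<tau> * z q))"
      using True act_mem T by (simp add: corr) (simp add: \<Phi>_def \<Psi>_def tens_def f_act k_eq[OF q(1)] k_eq[OF q(2)] g_act)
    also have "\<dots> = \<alpha> * \<phi> T * (fst p * h (snd q)) + \<alpha> * f (snd p) * h (snd q) - f (snd p) * (\<alpha> * d q)"
      by (simp add: \<alpha>(1) algebra_simps)
    also have "\<dots> = \<alpha> * \<phi> T * ?r p q + (- \<alpha> * \<psi> D) * ?l p q"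
      using True by (simp add: d_def rform_def lform_def algebra_simps)
    finally show ?thesis .
  next
    case False
    then show ?thesis by (auto simp: rform_def lform_def)
  qed
  then have "(\<lambda>p q. \<alpha> * \<phi> T * ?r p q + (- \<alpha> * \<psi> D) * ?l p q) =
    (\<lambda>p q. ract forms \<Phi> a p q + (- 1 * lact forms a \<Phi> p q + (- 1 * ract forms \<Psi> b p q + lact forms b \<Psi> p q)))"
    by (auto simp: fun_eq_iff algebra_simps simp del: forms_simps(6,7))
  then have e1: "m (\<lambda>p q. \<alpha> * \<phi> T * ?r p q + (- \<alpha> * \<psi> D) * ?l p q) =
    m (\<lambda>p q. ract forms \<Phi> a p q + (- 1 * lact forms a \<Phi> p q + (- 1 * ract forms \<Psi> b p q + lact forms b \<Psi> p q)))"
    by simp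
  note mems = bform_lact[OF S(1) \<Phi>(1)] bform_ract[OF S(1) \<Phi>(1)] bform_lact[OF S(2) \<Psi>(1)]
    bform_ract[OF S(2) \<Psi>(1)]
  have e2: "m (\<lambda>p q. \<alpha> * \<phi> T * ?r p q + (- \<alpha> * \<psi> D) * ?l p q) = \<alpha> * \<phi> T * m ?r + (- \<alpha> * \<psi> D) * m ?l"
    by (simp only: m_add m_scale forms bform_scale)
  have e3: "m (\<lambda>p q. ract forms \<Phi> a p q + (- 1 * lact forms a \<Phi> p q + (- 1 * ract forms \<Psi> b p q + lact forms b \<Psi> p q)))
    = m (ract forms \<Phi> a) - m (lact forms a \<Phi>) - (m (ract forms \<Psi> b) - m (lact forms b \<Psi>))"
    by (simp only: m_add m_scale mems bform_scale bform_add) simp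
  have eq: "\<alpha> * (\<phi> T * m ?r - \<psi> D * m ?l) =
    (m (ract forms \<Phi> a) - m (lact forms a \<Phi>)) - (m (ract forms \<Psi> b) - m (lact forms b \<Psi>))"
    unfolding trans[OF trans[OF e2[symmetric] e1] e3, symmetric] by (simp add: algebra_simps)
  \<comment> \<open>The constant 3 is 2 + 1: \<open>k\<close> is built from Z + D and costs twice
    the multiplier bound, \<open>g\<close> from Z alone.\<close>
  have "cmod (m (ract forms \<Phi> a) - m (lact forms a \<Phi>)) \<le> e * (2 * K\<^sup>2)"
    using order_trans[OF m_close[of a \<Phi>] mult_left_mono[OF \<Phi>(2) \<open>e \<ge> 0\<close>]] \<Phi>(1)
    by (simp only: corr insertI1) simp
  moreover have "cmod (m (ract forms \<Psi> b) - m (lact forms b \<Psi>)) \<le> e * K\<^sup>2"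
    using order_trans[OF m_close[of b \<Psi>] mult_left_mono[OF \<Psi>(2) \<open>e \<ge> 0\<close>]] \<Psi>(1)
    by (simp only: corr insertI1 insertI2) simp
  ultimately have "cmod (\<alpha> * (\<phi> T * m ?r - \<psi> D * m ?l)) \<le> e * (2 * K\<^sup>2) + e * K\<^sup>2"
    unfolding eq by (rule order_trans[OF norm_triangle_ineq4 add_mono])
  also have "\<dots> = 3 * K\<^sup>2 * e" by simp
  finally show ?thesis
    using \<alpha>(2) unfolding norm_mult norm_of_real by (simp add: f_def[abs_def] h_def[abs_def])
qed

section \<open>Series along a growing sequence of local units\<close>

text \<open>Multiplication by y is continuous, so it may be applied termwise. A factor y that kills
  the early terms and maps all late ones to the same w turns the rest of the series into its scalar
  tail times w. Restricting the condition on \<open>u j\<close> to nonzero coefficients allows a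
  subseries to skip an inconvenient index.\<close>

lemma mul_series:
  fixes d :: "nat \<Rightarrow> real"
  assumes u: "\<And>j. u j \<in> S" and y: "y \<in> S" and a: "a \<in> S" and vw: "v \<in> S" "w \<in> S"
    and lim: "(\<lambda>n. N ((\<Sum>j<n. d j *\<^sub>R u j) - a)) \<longlonglongrightarrow> 0" and d: "summable d"
    and yu: "\<And>j. d j \<noteq> 0 \<Longrightarrow> mul y (u j) = (if j < k then 0 else if j = k then v else w)"
  shows "mul y a = d k *\<^sub>R v + (suminf d - sum d {..k}) *\<^sub>R w"
proof (rule N_tendsto_unique)
  let ?X = "\<lambda>n. mul y (\<Sum>j<n. d j *\<^sub>R u j)"
  show "?X n \<in> S" for n using u y by (simp add: mem)
  show "(\<lambda>n. N (?X n - mul y a)) \<longlonglongrightarrow> 0"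
  proof (rule tendsto_sandwich[of "\<lambda>_. 0"])
    show "\<forall>\<^sub>F n in sequentially. N (?X n - mul y a) \<le> N y * N ((\<Sum>j<n. d j *\<^sub>R u j) - a)"
      using u y a by (intro always_eventually allI) (simp add: mul_diff[symmetric] N_mul mem)
    show "(\<lambda>n. N y * N ((\<Sum>j<n. d j *\<^sub>R u j) - a)) \<longlonglongrightarrow> 0"
      using tendsto_mult_left[OF lim, of "N y"] by simp
  qed (use u y a in \<open>auto simp: mem N_nonneg\<close>)
  let ?t = "suminf d - sum d {..k}"
  have X: "?X n - (d k *\<^sub>R v + ?t *\<^sub>R w) = (sum d {..<n} - suminf d) *\<^sub>R w" if "n > k" for n
  proof -
    have split: "sum f {..<n} = sum f {..<k} + f k + sum f {Suc k..<n}" for f :: "nat \<Rightarrow> 'b::comm_monoid_add"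
    proof -
      have "sum f ({..<Suc k} \<union> {Suc k..<n}) = sum f {..<Suc k} + sum f {Suc k..<n}"
        by (rule sum.union_disjoint) auto
      moreover have "{..<Suc k} \<union> {Suc k..<n} = {..<n}" using that by auto
      ultimately show ?thesis by (simp only: sum.lessThan_Suc)
    qed
    have "?X n = (\<Sum>j<n. d j *\<^sub>R (if j < k then 0 else if j = k then v else w))"
      unfolding mul_sum mul_scaleR using yu by (intro sum.cong) auto
    also have "\<dots> = d k *\<^sub>R v + (\<Sum>j=Suc k..<n. d j *\<^sub>R w)"
      by (simp add: split)
    also have "(\<Sum>j=Suc k..<n. d j *\<^sub>R w) = (sum d {..<n} - sum d {..k}) *\<^sub>R w"
    proof -
      have "sum d {..k} = sum d {..<k} + d k"
        by (simp only: lessThan_Suc_atMost[symmetric] sum.lessThan_Suc)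
      then have "sum d {..<n} - sum d {..k} = sum d {Suc k..<n}"
        using split[of d] by linarith
      then show ?thesis by (simp only: scaleR_sum_left)
    qed
    finally show ?thesis by (simp only: scaleR_diff_left) simp
  qed
  have "(\<lambda>n. \<bar>sum d {..<n} - suminf d\<bar> * N w) \<longlonglongrightarrow> \<bar>suminf d - suminf d\<bar> * N w"
    by (intro tendsto_intros summable_LIMSEQ d)
  then have "(\<lambda>n. \<bar>sum d {..<n} - suminf d\<bar> * N w) \<longlonglongrightarrow> 0" by simp
  then show "(\<lambda>n. N (?X n - (d k *\<^sub>R v + ?t *\<^sub>R w))) \<longlonglongrightarrow> 0"
  proof (rule Lim_transform_eventually)
    show "\<forall>\<^sub>F n in sequentially. \<bar>sum d {..<n} - suminf d\<bar> * N w = N (?X n - (d k *\<^sub>R v + ?t *\<^sub>R w))"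
      using eventually_gt_at_top[of k] by eventually_elim (simp only: X N_scaleR vw)
  qed
qed (use assms in \<open>simp_all add: mem\<close>)

text \<open>
  With \<open>G\<close> growing geometrically, let \<open>a\<^sub>r\<close> and \<open>b\<^sub>r\<close> be the sums of \<open>c\<^sub>j G\<^bsub>3j\<^esub>\<close> and
  \<open>c\<^sub>j G\<^bsub>3j\<^esub>\<^sup>2\<close> over the \<open>j\<close> of parity \<open>r\<close>. The window \<open>T\<^sub>k = G\<^bsub>3k+2\<^esub> - G\<^bsub>3k+1\<^esub>\<close> lies on a plateau of both
  parities, so it compares the two scalars \<open>\<gamma>\<close> that the approximate diagonal attaches to the
  neighbouring steps \<open>3k+3\<close> and \<open>3k+6\<close>.
\<close>

lemma not_approximately_amenable_growing:
  fixes G :: "nat \<Rightarrow> 'a"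
  assumes G: "\<And>n. G n \<in> S" and G_mul: "\<And>m n. m < n \<Longrightarrow> mul (G m) (G n) = G m"
    and K: "\<And>n x. x \<in> S \<Longrightarrow> N (mul (G n) x) \<le> K * N x" "K \<ge> 1"
    and growth: "\<And>n. N (G (Suc n)) \<ge> 4 * N (G n)" "N (G 0) \<ge> 32"
  shows "\<not> approximately_amenable TYPE('a bimodule_univ) alg"
proof
  assume amen: "approximately_amenable TYPE('a bimodule_univ) alg"
  have G_mul': "mul (G n) (G m) = G m" if "m < n" for m n
    using G_mul[OF that] by (simp add: mul_commute)
  have NG: "N (G n) \<ge> 32 * 4 ^ n" for n
  proof (induction n)
    case (Suc n)
    then show ?case using growth(1)[of n] by simp
  qed (use growth in simp)
  then have NGpos: "N (G n) > 0" for n using less_le_trans[of 0 "32 * 4 ^ n :: real"] by simp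
  \<comment> \<open>The largest coefficients for which the norms of the terms are bounded by
    \<open>(1/2) ^ j\<close>: the series converge, and at step \<open>Suc i\<close> the coefficient
    times \<open>N (D i)\<close> is still at least \<open>(1/2) ^ (i + 2)\<close>.\<close>
  define c where "c j = (1/2) ^ j / N (G (3 * j))" for j
  define d where "d r j = (if j mod 2 = r then c j else 0)" for r j :: nat
  have c_pos: "c j > 0" for j by (simp add: c_def NGpos)
  have d_nonneg: "d r j \<ge> 0" and d_le: "d r j \<le> c j" for r j using c_pos[of j] by (auto simp: d_def)
  have sum_half: "summable (\<lambda>j. (1/2) ^ j :: real)" by (intro summable_geometric) simp
  have cN: "c j * N (G (3 * j)) = (1/2) ^ j" for j using NGpos[of "3 * j"] by (simp add: c_def)
  have dN: "d r j * N (G (3 * j)) \<le> (1/2) ^ j" for r j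
    using mult_right_mono[OF d_le, of "N (G (3 * j))" r j] NGpos[of "3 * j"] by (simp add: cN)
  have c_le: "c j \<le> (1/2) ^ j" for j
  proof -
    have "1 \<le> N (G (3 * j))" using NG[of "3 * j"] one_le_power[of "4 :: real" "3 * j"] by linarith
    then show ?thesis using NGpos[of "3 * j"] by (simp add: c_def divide_le_eq mult_left_le)
  qed
  have d_sum: "summable (d r)" for r
    by (rule summable_comparison_test'[OF sum_half, of 0])
      (use d_nonneg order_trans[OF d_le c_le] in \<open>simp add: abs_of_nonneg\<close>)
  let ?G2 = "\<lambda>n. mul (G n) (G n)"
  have NG2: "N (?G2 n) \<le> K * N (G n)" for n by (intro K G)
  have "\<exists>a. a \<in> S \<and> (\<lambda>n. N ((\<Sum>j<n. d r j *\<^sub>R G (3 * j)) - a)) \<longlonglongrightarrow> 0" for r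
  proof -
    have "summable (\<lambda>j. N (d r j *\<^sub>R G (3 * j)))"
      by (rule summable_comparison_test'[OF sum_half, of 0])
        (use dN d_nonneg NGpos in \<open>auto simp: N_scaleR G abs_mult less_imp_le\<close>)
    from abs_summable_series[OF _ this] show ?thesis using G by (auto simp: mem)
  qed
  then have "\<exists>A. \<forall>r. A r \<in> S \<and> (\<lambda>n. N ((\<Sum>j<n. d r j *\<^sub>R G (3 * j)) - A r)) \<longlonglongrightarrow> 0"
    by (intro choice allI)
  then obtain A where A: "\<And>r. A r \<in> S" "\<And>r. (\<lambda>n. N ((\<Sum>j<n. d r j *\<^sub>R G (3 * j)) - A r)) \<longlonglongrightarrow> 0"
    by auto
  have "\<exists>b. b \<in> S \<and> (\<lambda>n. N ((\<Sum>j<n. d r j *\<^sub>R ?G2 (3 * j)) - b)) \<longlonglongrightarrow> 0" for r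
  proof -
    have "d r j * N (?G2 (3 * j)) \<le> K * (1/2) ^ j" for j
    proof -
      have "d r j * N (?G2 (3 * j)) \<le> d r j * (K * N (G (3 * j)))"
        by (intro mult_left_mono NG2 d_nonneg)
      also have "\<dots> \<le> K * (1/2) ^ j" using mult_left_mono[OF dN[of r j], of K] K(2) by (simp add: mult_ac)
      finally show ?thesis .
    qed
    then have "summable (\<lambda>j. N (d r j *\<^sub>R ?G2 (3 * j)))"
      by (intro summable_comparison_test'[OF summable_mult[OF sum_half, of K], of 0])
        (use d_nonneg in \<open>auto simp: N_scaleR G mem abs_mult N_nonneg\<close>)
    from abs_summable_series[OF _ this] show ?thesis using G by (auto simp: mem)
  qed
  then have "\<exists>B. \<forall>r. B r \<in> S \<and> (\<lambda>n. N ((\<Sum>j<n. d r j *\<^sub>R ?G2 (3 * j)) - B r)) \<longlonglongrightarrow> 0"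
    by (intro choice allI)
  then obtain B where B: "\<And>r. B r \<in> S" "\<And>r. (\<lambda>n. N ((\<Sum>j<n. d r j *\<^sub>R ?G2 (3 * j)) - B r)) \<longlonglongrightarrow> 0"
    by auto
  \<comment> \<open>The series use only every third kernel. The two indices between consecutive
    terms carry the window \<open>T\<close>. The window \<open>Z\<close> straddles the term with
    index 3i + 3; one multiplication by that kernel turns \<open>Z\<close> into \<open>D\<close>, a
    second one turns \<open>D\<close> into \<open>D2\<close>.\<close>
  define T where "T k = G (3 * k + 2) - G (3 * k + 1)" for k
  define Z where "Z i = G (3 * i + 4) - G (3 * i + 2)" for i
  define D where "D i = G (3 * i + 3) - G (3 * i + 2)" for i
  define D2 where "D2 i = ?G2 (3 * i + 3) - G (3 * i + 2)" for i
  have mems: "T i \<in> S" "Z i \<in> S" "D i \<in> S" "D2 i \<in> S" for i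
    by (simp_all add: T_def Z_def D_def D2_def mem G)
  have bound: "N (mul (G m - G n) x) \<le> (2 * K) * N x" if "x \<in> S" for m n x
    using N_triangle_diff[of "mul (G m) x" "mul (G n) x"] K(1)[OF that, of m] K(1)[OF that, of n] that
    by (simp add: mul_diff mem G)
  have lower: "N (G m - G n) \<ge> N (G m) / 2" if "m = Suc n" for m n
    using N_triangle[of "G m - G n" "G n"] growth(1)[of n] NGpos[of n] that by (simp add: mem G)
  have TG: "mul (T l) (G (3 * j)) = (if j \<le> l then 0 else T l)" for l j
    by (auto simp: T_def mul_diff G_mul G_mul')
  have TG2: "mul (T l) (?G2 (3 * j)) = (if j \<le> l then 0 else T l)" for l j
    using TG[of l j] by (auto simp: mul_assoc[symmetric])
  have ZG: "mul (Z i) (G (3 * j)) = (if j < Suc i then 0 else if j = Suc i then D i else Z i)" for i j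
  proof -
    have "j < Suc i \<or> j = Suc i \<or> j > Suc i" by linarith
    then show ?thesis by (auto simp: Z_def D_def mul_diff G_mul G_mul' add.commute[of 3])
  qed
  have DG: "mul (D i) (G (3 * j)) = (if j < Suc i then 0 else if j = Suc i then D2 i else D i)" for i j
  proof -
    have "j < Suc i \<or> j = Suc i \<or> j > Suc i" by linarith
    then show ?thesis by (auto simp: D_def D2_def mul_diff G_mul G_mul' add.commute[of 3])
  qed
  have ZG2: "mul (Z i) (?G2 (3 * j)) = (if j < Suc i then 0 else if j = Suc i then D2 i else Z i)" for i j
    using ZG[of i j] DG[of i j] by (auto simp: mul_assoc[symmetric])
  define \<tau> where "\<tau> i = suminf (d (Suc i mod 2)) - sum (d (Suc i mod 2)) {..Suc i}" for i
  have \<tau>: "\<tau> i \<ge> 0" for i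
    using sum_le_suminf[OF d_sum, of "{..Suc i}" "Suc i mod 2"] d_nonneg by (simp add: \<tau>_def)
  have dS: "d (Suc i mod 2) (Suc i) = c (Suc i)" for i by (simp add: d_def)
  have TA: "mul (T l) (A (Suc i mod 2)) = sc (of_real (c (Suc i) + \<tau> i)) (T l)"
    and TB: "mul (T l) (B (Suc i mod 2)) = sc (of_real (c (Suc i) + \<tau> i)) (T l)"
    if "l = i \<or> Suc l = i" for l i
  proof -
    \<comment> \<open>Index j = i has the wrong parity for this series. The windows l = i and l = i
      - 1 therefore see the same tail, starting at i + 1, and get the same eigenvalue; with a single
      undivided series the values would differ by \<open>c i\<close>.\<close>
    have eq: "(if j \<le> l then 0 else T l) = (if j < Suc i then 0 else if j = Suc i then T l else T l)"
      if "d (Suc i mod 2) j \<noteq> 0" for j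
    proof -
      have "j mod 2 = Suc i mod 2" using that by (auto simp: d_def split: if_splits)
      then have "j \<noteq> i" by presburger
      with \<open>l = i \<or> Suc l = i\<close> show ?thesis by auto
    qed
    have rs: "c (Suc i) *\<^sub>R T l + \<tau> i *\<^sub>R T l = sc (of_real (c (Suc i) + \<tau> i)) (T l)"
      by (simp only: sc_of_real scaleR_add_left)
    show "mul (T l) (A (Suc i mod 2)) = sc (of_real (c (Suc i) + \<tau> i)) (T l)"
      using mul_series[OF _ mems(1) A(1) mems(1) mems(1) A(2) d_sum, of "Suc i mod 2" l "Suc i" l l]
      unfolding rs[symmetric] unfolding \<tau>_def dS by (simp add: G TG eq)
    show "mul (T l) (B (Suc i mod 2)) = sc (of_real (c (Suc i) + \<tau> i)) (T l)"
      using mul_series[OF _ mems(1) B(1) mems(1) mems(1) B(2) d_sum, of "Suc i mod 2" l "Suc i" l l]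
      unfolding rs[symmetric] unfolding \<tau>_def dS by (simp add: G mem TG2 eq)
  qed
  have ZA: "mul (Z i) (A (Suc i mod 2)) = sc (of_real (c (Suc i))) (D i) + sc (of_real (\<tau> i)) (Z i)" for i
    using mul_series[OF _ mems(2) A(1) mems(3) mems(2) A(2) d_sum, of "Suc i mod 2" i "Suc i" i i]
    unfolding \<tau>_def dS sc_of_real by (simp add: G ZG)
  have DA: "mul (D i) (A (Suc i mod 2)) = sc (of_real (c (Suc i))) (D2 i) + sc (of_real (\<tau> i)) (D i)" for i
    using mul_series[OF _ mems(3) A(1) mems(4) mems(3) A(2) d_sum, of "Suc i mod 2" i "Suc i" i i]
    unfolding \<tau>_def dS sc_of_real by (simp add: G DG)
  have ZB: "mul (Z i) (B (Suc i mod 2)) = sc (of_real (c (Suc i))) (D2 i) + sc (of_real (\<tau> i)) (Z i)" for i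
    using mul_series[OF _ mems(2) B(1) mems(4) mems(2) B(2) d_sum, of "Suc i mod 2" i "Suc i" i i]
    unfolding \<tau>_def dS sc_of_real by (simp add: G mem ZG2)
  \<comment> \<open>Differences of two kernels are multipliers of norm at most 2K, so e C is the
    right-hand side of the elimination estimate. The choice of e gives e C \<le> 1/8, hence a drift
    of the scalars of at most 1/4 in total.\<close>
  define C where "C = 3 * (2 * K)\<^sup>2"
  have C: "C \<ge> 0" by (simp add: C_def)
  define e where "e = 1 / (8 * (C + 1))"
  have e: "e > 0" "e * C \<le> 1/8" "e \<le> 1/8" using C by (simp_all add: e_def field_simps)
  \<comment> \<open>The four series account for all steps at once; \<open>T 0\<close> is added to
    pin down the scalar at the start.\<close>
  define A0 where "A0 = {A 0, B 0, A 1, B 1, T 0}"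
  have "finite A0" "A0 \<subseteq> S" by (auto simp: A0_def A B mems)
  then obtain m M where m_add: "\<And>\<Phi> \<Psi>. bform \<Phi> \<Longrightarrow> bform \<Psi> \<Longrightarrow> m (\<lambda>p q. \<Phi> p q + \<Psi> p q) = m \<Phi> + m \<Psi>"
    and m_scale: "\<And>c \<Phi>. bform \<Phi> \<Longrightarrow> m (\<lambda>p q. c * \<Phi> p q) = c * m \<Phi>"
    and m_bound: "\<And>\<Phi>. bform \<Phi> \<Longrightarrow> cmod (m \<Phi>) \<le> M * fnorm \<Phi>" and M: "M \<ge> 0"
    and m_close: "\<And>a \<Phi>. a \<in> A0 \<Longrightarrow> bform \<Phi> \<Longrightarrow>
       cmod (m (ract forms \<Phi> a) - m (lact forms a \<Phi>) - (\<Phi> (0, a) (1, 0) - \<Phi> (1, 0) (0, a))) \<le> e * fnorm \<Phi>"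
    by (rule approximate_diagonal[OF amen _ _ e(1)]) (rule that, assumption+)
  have "\<exists>\<phi>. bfun 1 \<phi> \<and> \<phi> (T i) = of_real (N (T i))" for i
    by (rule norming_functional[OF mems(1)]) blast
  then have "\<exists>\<phi>. \<forall>i. bfun 1 (\<phi> i) \<and> \<phi> i (T i) = of_real (N (T i))"
    by (intro choice allI)
  then obtain \<phi> where \<phi>: "\<And>i. bfun 1 (\<phi> i)" "\<And>i. \<phi> i (T i) = of_real (N (T i))" by auto
  have "\<exists>\<psi>. bfun 1 \<psi> \<and> \<psi> (D i) = of_real (N (D i))" for i
    by (rule norming_functional[OF mems(3)]) blast
  then have "\<exists>\<psi>. \<forall>i. bfun 1 (\<psi> i) \<and> \<psi> i (D i) = of_real (N (D i))"
    by (intro choice allI)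
  then obtain \<psi> where \<psi>: "\<And>i. bfun 1 (\<psi> i)" "\<And>i. \<psi> i (D i) = of_real (N (D i))" by auto
  define q where "q i = m (rform (\<lambda>x. \<psi> i (mul (D i) x)))" for i
  define p where "p i = m (lform (\<lambda>x. \<phi> i (mul (T i) x)))" for i
  \<comment> \<open>Dividing the elimination estimate by \<open>N (D i)\<close> says that the
    one-sided value \<open>p l\<close> is nearly \<open>\<gamma> i\<close> times
    \<open>N (T l)\<close>. Thus \<open>\<gamma> i\<close> is the scalar by which the one-sided
    component acts near step i.\<close>
  define \<gamma> where "\<gamma> i = q i / of_real (N (D i))" for i
  have ND: "N (D i) \<ge> N (G (3 * Suc i)) / 2" for i using lower[of "3 * i + 3" "3 * i + 2"] by (simp add: D_def add.commute[of 3])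
  have NDpos: "N (D i) > 0" for i using ND[of i] NGpos[of "3 * Suc i"] by linarith
  have key: "cmod (of_real (N (T l)) * \<gamma> i - p l) \<le> 2 ^ (i + 2) * (e * C)"
    if li: "l = i \<or> Suc l = i" for l i
  proof -
    let ?r = "Suc i mod 2" and ?\<alpha> = "c (Suc i) + \<tau> i"
    have r: "A ?r \<in> A0" "B ?r \<in> A0"
    proof -
      have "?r = 0 \<or> ?r = 1" by presburger
      then show "A ?r \<in> A0" "B ?r \<in> A0" by (auto simp: A0_def)
    qed
    have "?\<alpha> * cmod (\<phi> l (T l) * m (rform (\<lambda>x. \<psi> i (mul (D i) x))) -
        \<psi> i (D i) * m (lform (\<lambda>x. \<phi> l (mul (T l) x)))) \<le> 3 * (2 * K)\<^sup>2 * e"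
    proof (rule elimination_estimate[OF m_add m_scale _ \<phi>(1) \<psi>(1) A(1) B(1) mems(1,2,3,4) TA[OF li] TB[OF li] ZA DA ZB refl])
      show "cmod (m (ract forms \<Phi> x) - m (lact forms x \<Phi>) - (\<Phi> (0, x) (1, 0) - \<Phi> (1, 0) (0, x))) \<le> e * fnorm \<Phi>"
        if "x \<in> {A ?r, B ?r}" "bform \<Phi>" for x \<Phi>
        using that r by (intro m_close) auto
      show "N (mul (T l) x) \<le> 2 * K * N x" "N (mul (Z i) x) \<le> 2 * K * N x" "N (mul (D i) x) \<le> 2 * K * N x"
        if "x \<in> S" for x
        using bound[OF that] by (simp_all add: T_def Z_def D_def)
    qed (use K(2) e \<tau>[of i] c_pos[of "Suc i"] in auto)
    then have "?\<alpha> * cmod (of_real (N (D i)) * (of_real (N (T l)) * \<gamma> i - p l)) \<le> e * C"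
      using NDpos[of i] by (simp add: \<phi> \<psi> q_def[symmetric] p_def[symmetric] \<gamma>_def C_def algebra_simps)
    then have *: "(?\<alpha> * N (D i)) * cmod (of_real (N (T l)) * \<gamma> i - p l) \<le> e * C"
      using NDpos[of i] by (simp add: norm_mult)
    \<comment> \<open>\<open>N (D i)\<close> is at least half of \<open>N (G (3 * Suc i))\<close>,
      which cancels the denominator of the coefficient. This lower bound is what costs the factor
      \<open>2 ^ (i + 2)\<close>.\<close>
    have "(1/2) ^ (i + 2) \<le> c (Suc i) * N (D i)"
      using mult_left_mono[OF ND[of i], of "c (Suc i)"] c_pos[of "Suc i"]
      unfolding times_divide_eq_right cN by simp
    also have "\<dots> \<le> ?\<alpha> * N (D i)" using \<tau>[of i] NDpos[of i] by (intro mult_right_mono) auto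
    finally have "(1/2) ^ (i + 2) * cmod (of_real (N (T l)) * \<gamma> i - p l) \<le> e * C"
      by (intro order_trans[OF mult_right_mono *]) auto
    then show ?thesis by (simp add: power_one_over field_simps)
  qed
  have NT: "N (T i) \<ge> 16 * 4 ^ i" for i
  proof -
    have "(4::real) ^ i \<le> 4 ^ (3 * i + 2)" by (rule power_increasing) auto
    then show ?thesis using lower[of "3 * i + 2" "3 * i + 1"] NG[of "3 * i + 2"] by (simp add: T_def)
  qed
  have NTpos: "N (T i) > 0" for i using NT[of i] less_le_trans[of 0 "16 * 4 ^ i :: real"] by simp
  \<comment> \<open>The window \<open>T i\<close> is admissible for the steps i and i + 1, and
    \<open>p i\<close> drops out of the comparison. The two errors add up to 12 times
    \<open>2 ^ i * (e * C)\<close>, which the lower bound 16 times \<open>4 ^ i\<close> for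
    \<open>N (T i)\<close> absorbs.\<close>
  have step: "cmod (\<gamma> i - \<gamma> (Suc i)) \<le> (1/2) ^ i * (e * C)" for i
  proof -
    have "N (T i) * cmod (\<gamma> i - \<gamma> (Suc i)) =
       cmod ((of_real (N (T i)) * \<gamma> i - p i) - (of_real (N (T i)) * \<gamma> (Suc i) - p i))"
    proof -
      have "(of_real (N (T i)) * \<gamma> i - p i) - (of_real (N (T i)) * \<gamma> (Suc i) - p i) =
        of_real (N (T i)) * (\<gamma> i - \<gamma> (Suc i))" by (simp add: algebra_simps)
      then show ?thesis using NTpos[of i] by (simp add: norm_mult)
    qed
    also have "\<dots> \<le> 2 ^ (i + 2) * (e * C) + 2 ^ (Suc i + 2) * (e * C)"
      by (intro order_trans[OF norm_triangle_ineq4] add_mono key) auto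
    also have "\<dots> \<le> (16 * 4 ^ i) * ((1/2) ^ i * (e * C))"
    proof -
      have "(4::real) ^ i * (1/2) ^ i = 2 ^ i" by (simp flip: power_mult_distrib)
      then have "(16 * 4 ^ i) * ((1/2) ^ i * (e * C)) = 16 * (2 ^ i * (e * C))" by (simp add: mult_ac)
      moreover have "2 ^ (i + 2) * (e * C) + 2 ^ (Suc i + 2) * (e * C) = 12 * (2 ^ i * (e * C))"
        by (simp add: algebra_simps)
      moreover have "0 \<le> 2 ^ i * (e * C)" using e C by simp
      ultimately show ?thesis by linarith
    qed
    also have "\<dots> \<le> N (T i) * ((1/2) ^ i * (e * C))" using NT e C by (intro mult_right_mono) auto
    finally show ?thesis using NTpos[of i] by simp
  qed
  have p_bound: "cmod (p i) \<le> 2 * K * M" for i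
  proof -
    have "bfun (1 * (2 * K)) (\<lambda>x. \<phi> i (mul (T i) x))"
      using bound by (intro bfun_mul \<phi> mems) (auto simp: T_def)
    then have b: "bform (lform (\<lambda>x. \<phi> i (mul (T i) x)))" "fnorm (lform (\<lambda>x. \<phi> i (mul (T i) x))) \<le> 2 * K"
      using bform_lform[of "2 * K"] fnorm_lform[of "2 * K"] K(2) by auto
    have "cmod (p i) \<le> M * (2 * K)"
      unfolding p_def using m_bound[OF b(1)] mult_left_mono[OF b(2) M] by linarith
    then show ?thesis by (simp add: mult_ac)
  qed
  \<comment> \<open>Here the unknown bound \<open>M\<close> is harmless: it stays fixed while
    \<open>N (T i)\<close> grows with i.\<close>
  have small: "cmod (\<gamma> i) \<le> (1/2) ^ i * (e * C + 2 * K * M)" for i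
  proof -
    have "N (T i) * cmod (\<gamma> i) = cmod ((of_real (N (T i)) * \<gamma> i - p i) + p i)"
      using NTpos[of i] by (simp add: norm_mult)
    also have "\<dots> \<le> 2 ^ (i + 2) * (e * C) + 2 * K * M"
      by (intro order_trans[OF norm_triangle_ineq] add_mono key p_bound) auto
    also have "\<dots> \<le> (16 * 4 ^ i) * ((1/2) ^ i * (e * C + 2 * K * M))"
    proof -
      have "(4::real) ^ i * (1/2) ^ i = 2 ^ i" by (simp flip: power_mult_distrib)
      then have "(16 * 4 ^ i) * ((1/2) ^ i * (e * C + 2 * K * M)) = 16 * 2 ^ i * (e * C) + 16 * 2 ^ i * (2 * K * M)"
        by (simp add: algebra_simps)
      moreover have "1 * (2 * K * M) \<le> 16 * 2 ^ i * (2 * K * M)"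
      proof (rule mult_right_mono)
        show "1 \<le> 16 * (2::real) ^ i" using one_le_power[of "2::real" i] by linarith
        show "0 \<le> 2 * K * M" using K(2) M by simp
      qed
      moreover have "0 \<le> 12 * 2 ^ i * (e * C)" using e C by simp
      ultimately show ?thesis by (simp add: algebra_simps)
    qed
    also have "\<dots> \<le> N (T i) * ((1/2) ^ i * (e * C + 2 * K * M))"
      using NT e C K(2) M by (intro mult_right_mono) auto
    finally show ?thesis using NTpos[of i] by simp
  qed
  have tele: "cmod (\<gamma> 0) \<le> cmod (\<gamma> n) + (2 - 2 * (1/2) ^ n) * (e * C)" for n
  proof (induction n)
    case (Suc n)
    have "cmod (\<gamma> n) \<le> cmod (\<gamma> (Suc n)) + (1/2) ^ n * (e * C)"
      using step[of n] norm_triangle_sub[of "\<gamma> n" "\<gamma> (Suc n)"] by linarith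
    with Suc show ?case by (simp add: algebra_simps)
  qed simp
  have "(\<lambda>n. (1/2) ^ n * (e * C + 2 * K * M) + 2 * (e * C)) \<longlonglongrightarrow> 0 * (e * C + 2 * K * M) + 2 * (e * C)"
    by (intro tendsto_intros LIMSEQ_power_zero) simp
  moreover have "cmod (\<gamma> 0) \<le> (1/2) ^ n * (e * C + 2 * K * M) + 2 * (e * C)" for n
  proof -
    have "(2 - 2 * (1/2) ^ n) * (e * C) \<le> 2 * (e * C)" using e C by (intro mult_right_mono) auto
    with tele[of n] small[of n] show ?thesis by linarith
  qed
  ultimately have \<gamma>0: "cmod (\<gamma> 0) \<le> 2 * (e * C)"
    by (intro tendsto_lowerbound[where F = sequentially]) auto
  \<comment> \<open>On \<open>lform (\<phi> 0)\<close> the left action of \<open>T 0\<close> is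
    zero, the right action gives the form defining \<open>p 0\<close>, and the derivation takes the
    value \<open>N (T 0)\<close>. This says that the one-sided component acts on \<open>T 0\<close>
    almost as a unit.\<close>
  have "cmod (p 0 - of_real (N (T 0))) \<le> e"
  proof -
    have b: "bform (lform (\<phi> 0))" "fnorm (lform (\<phi> 0)) \<le> 1"
      using bform_lform[OF \<phi>(1)] fnorm_lform[OF \<phi>(1)] by auto
    have "ract forms (lform (\<phi> 0)) (T 0) = lform (\<lambda>x. \<phi> 0 (mul (T 0) x))"
      by (auto simp: fun_eq_iff lform_def unitization_act mems zero_mem act_def bfunD[OF \<phi>(1)] unitization_snd mem algebra_simps)
    moreover have "lact forms (T 0) (lform (\<phi> 0)) = (\<lambda>p q. 0 * lform (\<phi> 0) p q)"
      by (auto simp: fun_eq_iff lform_def act_simps bfunD(4)[OF \<phi>(1)])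
    then have "m (lact forms (T 0) (lform (\<phi> 0))) = 0" using m_scale[OF b(1), of 0] by simp
    moreover have "lform (\<phi> 0) (0, T 0) (1, 0) - lform (\<phi> 0) (1, 0) (0, T 0) = of_real (N (T 0))"
      by (simp add: lform_def mems zero_mem \<phi>)
    moreover have "T 0 \<in> A0" by (simp add: A0_def)
    ultimately have "cmod (p 0 - of_real (N (T 0))) \<le> e * fnorm (lform (\<phi> 0))"
      using m_close[of "T 0" "lform (\<phi> 0)"] b(1) by (simp add: p_def)
    also have "\<dots> \<le> e * 1" using b(2) e by (intro mult_left_mono) auto
    finally show ?thesis by simp
  qed
  moreover have "cmod (of_real (N (T 0)) * \<gamma> 0 - p 0) \<le> 4 * (e * C)" using key[of 0 0] by simp
  ultimately have "cmod (of_real (N (T 0)) * \<gamma> 0 - of_real (N (T 0))) \<le> e + 4 * (e * C)"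
    using norm_triangle_ineq[of "of_real (N (T 0)) * \<gamma> 0 - p 0" "p 0 - of_real (N (T 0))"] by simp
  moreover have "N (T 0) \<le> cmod (of_real (N (T 0)) * \<gamma> 0) + cmod (of_real (N (T 0)) * \<gamma> 0 - of_real (N (T 0)))"
    using norm_triangle_sub[of "of_real (N (T 0))" "of_real (N (T 0)) * \<gamma> 0"] NTpos[of 0]
    by (simp add: norm_minus_commute)
  moreover have "cmod (of_real (N (T 0)) * \<gamma> 0) \<le> N (T 0) * (2 * (e * C))"
    using \<gamma>0 NTpos[of 0] by (simp add: norm_mult)
  moreover have "N (T 0) * (2 * (e * C)) \<le> N (T 0) * (1/4)" using e NTpos[of 0] by (intro mult_left_mono) auto
  ultimately have "3/4 * N (T 0) \<le> 5/8" using e by linarith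
  with NT[of 0] show False by simp
qed

text \<open>An unbounded sequence of norms exceeds any bound arbitrarily late, so a subsequence
  grows by factors of 4. The relation between neighbours extends by associativity to all pairs of
  increasing indices and hence to the subsequence.\<close>

theorem not_approximately_amenable:
  fixes E :: "nat \<Rightarrow> 'a"
  assumes E: "\<And>n. E n \<in> S" and E_mul: "\<And>n. mul (E n) (E (Suc n)) = E n"
    and K: "\<And>n x. x \<in> S \<Longrightarrow> N (mul (E n) x) \<le> K * N x"
    and unbounded: "\<And>C. \<exists>n. N (E n) > C"
  shows "\<not> approximately_amenable TYPE('a bimodule_univ) alg"
proof -
  have E_mul': "mul (E m) (E n) = E m" if "m < n" for m n
    using that
  proof (induction n)
    case (Suc n)
    show ?case
    proof (cases "m = n")
      case True
      then show ?thesis by (simp add: E_mul)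
    next
      case False
      with Suc have IH: "mul (E m) (E n) = E m" by simp
      have "mul (E m) (E (Suc n)) = mul (mul (E m) (E n)) (E (Suc n))" by (simp add: IH)
      also have "\<dots> = mul (E m) (mul (E n) (E (Suc n)))" by (rule mul_assoc)
      also have "\<dots> = E m" by (simp only: E_mul IH)
      finally show ?thesis .
    qed
  qed simp
  have later: "\<exists>n>m. N (E n) \<ge> C" for C m
  proof (rule ccontr)
    assume "\<not> ?thesis"
    then have *: "N (E n) < C" if "n > m" for n using that by force
    have "N (E n) \<le> max C (Max ((\<lambda>n. N (E n)) ` {..m}))" for n
      using *[of n] by (cases "n > m") (auto simp: le_max_iff_disj less_imp_le intro!: Max_ge)
    with unbounded show False by (meson not_less)
  qed
  obtain f where f: "N (E (f 0)) \<ge> 32" "\<And>n. f n < f (Suc n)" "\<And>n. N (E (f (Suc n))) \<ge> 4 * N (E (f n))"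
  proof -
    have "\<exists>f. \<forall>n. (n = 0 \<longrightarrow> N (E (f n)) \<ge> 32) \<and> (f n < f (Suc n) \<and> N (E (f (Suc n))) \<ge> 4 * N (E (f n)))"
      by (rule dependent_nat_choice) (use later in blast)+
    then show ?thesis using that by blast
  qed
  have mono: "f m < f n" if "m < n" for m n using lift_Suc_mono_less[of f, OF f(2) that] .
  show ?thesis
  proof (rule not_approximately_amenable_growing[of "\<lambda>n. E (f n)" "max K 1"])
    show "N (mul (E (f n)) x) \<le> max K 1 * N x" if "x \<in> S" for n x
      using K[OF that, of "f n"] mult_right_mono[of K "max K 1" "N x"] N_nonneg[OF that] by linarith
  qed (use E E_mul' mono f in auto)
qed

end

section \<open>Convolution on the group algebra\<close>

lemma lborel_integral_reflect:
  fixes F :: "'e::euclidean_space \<Rightarrow> complex"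
  assumes "F \<in> borel_measurable borel"
  shows "(LINT y|lborel. F (x - y)) = (LINT y|lborel. F y)"
proof -
  have "(LINT y|distr lborel borel (\<lambda>y. x - y). F y) = (LINT y|lborel. F (x - y))"
    using assms by (intro integral_distr) auto
  then show ?thesis by (simp only: lborel_distr_reflect)
qed

lemma lborel_integral_shift:
  fixes F :: "'e::euclidean_space \<Rightarrow> complex"
  assumes "F \<in> borel_measurable borel"
  shows "(LINT y|lborel. F (y - x)) = (LINT y|lborel. F y)"
proof -
  have "(LINT y|distr lborel borel (\<lambda>y. y - x). F y) = (LINT y|lborel. F (y - x))"
    using assms by (intro integral_distr) auto
  then show ?thesis by (simp only: lborel_distr_shift)
qed

text \<open>The general measure and the map r serve two purposes: a product measure with r =
  \<open>snd\<close> gives the triple integral behind associativity, and a simple function r on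
  \<open>lborel\<close> gives discretised convolutions.\<close>

lemma integrable_translation_kernel:
  fixes f :: "'i \<Rightarrow> complex" and g :: "'e::euclidean_space \<Rightarrow> complex"
  assumes M: "sigma_finite_measure M" and f: "integrable M f" and g: "integrable lborel g"
    and r [measurable]: "r \<in> M \<rightarrow>\<^sub>M borel"
  shows "integrable (M \<Otimes>\<^sub>M lborel) (\<lambda>(y, x). f y * g (x - r y))"
proof -
  interpret pair_sigma_finite M "lborel :: 'e measure"
    using M by (intro pair_sigma_finite.intro lborel.sigma_finite_measure_axioms)
  have [measurable]: "f \<in> borel_measurable M" "g \<in> borel_measurable borel"
    using f g by simp_all
  show ?thesis
  proof (rule Fubini_integrable)
    have "(\<lambda>y. LINT x|lborel. cmod (case (y, x) of (y, x) \<Rightarrow> f y * g (x - r y)))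
        = (\<lambda>y. cmod (f y) * (LINT x|lborel. cmod (g x)))"
      by (simp add: norm_mult integral_norm_lborel_shift[OF g])
    then show "integrable M (\<lambda>y. LINT x|lborel. cmod (case (y, x) of (y, x) \<Rightarrow> f y * g (x - r y)))"
      using f by simp
    show "AE y in M. integrable lborel (\<lambda>x. case (y, x) of (y, x) \<Rightarrow> f y * g (x - r y))"
      using integrable_lborel_shift[OF g] by simp
  qed measurable
qed

lemma AE_integrable_translation_kernel:
  fixes f g :: "'e::euclidean_space \<Rightarrow> complex"
  assumes "integrable lborel f" "integrable lborel g" "r \<in> borel_measurable borel"
  shows "AE x in lborel. integrable lborel (\<lambda>y. f y * g (x - r y))"
    and "integrable lborel (\<lambda>x. LINT y|lborel. f y * g (x - r y))"
proof -
  have "integrable (lborel \<Otimes>\<^sub>M lborel) (\<lambda>(y, x). f y * g (x - r y))"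
    using assms by (intro integrable_translation_kernel lborel.sigma_finite_measure_axioms) auto
  then show "AE x in lborel. integrable lborel (\<lambda>y. f y * g (x - r y))"
    "integrable lborel (\<lambda>x. LINT y|lborel. f y * g (x - r y))"
    by (rule lborel_pair.AE_integrable_snd lborel_pair.integrable_snd)+
qed

lemma AE_integrable_conv:
  fixes f g :: "'e::euclidean_space \<Rightarrow> complex"
  assumes "integrable lborel f" "integrable lborel g"
  shows "AE x in lborel. integrable lborel (\<lambda>y. f y * g (x - y))"
  using AE_integrable_translation_kernel(1)[OF assms, of "\<lambda>y. y"] by simp

lemma conv_commute: "conv f g = conv g f"
proof (transfer, goal_cases)
  case (1 f g)
  then have f: "integrable lborel f" and g: "integrable lborel g" by (auto simp: L1_rel_def)
  then have [measurable]: "f \<in> borel_measurable borel" "g \<in> borel_measurable borel" by simp_all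
  have "(LINT y|lborel. f y * g (x - y)) = (LINT y|lborel. g y * f (x - y))" for x
    using lborel_integral_reflect[of "\<lambda>y. g y * f (x - y)" x] by (simp add: mult.commute)
  then show ?case
    using f g by (simp add: L1_rel_def integrable_convolution)
qed

lemma conv_add_right: "conv f (g + h) = conv f g + conv f h"
proof (transfer, goal_cases)
  case (1 f g h)
  then have f: "integrable lborel f" and g: "integrable lborel g" and h: "integrable lborel h"
    by (auto simp: L1_rel_def)
  have "AE x in lborel. (LINT y|lborel. f y * (g (x - y) + h (x - y))) =
     (LINT y|lborel. f y * g (x - y)) + (LINT y|lborel. f y * h (x - y))"
    using AE_integrable_conv[OF f g] AE_integrable_conv[OF f h]
    by eventually_elim (simp add: distrib_left)
  then show ?case
    using f g h integrable_convolution[OF f Bochner_Integration.integrable_add[OF g h]]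
    by (simp add: L1_rel_def integrable_convolution)
qed

lemma conv_scaleC_right: "conv f (scaleC_L1 c g) = scaleC_L1 c (conv f g)"
proof (transfer, goal_cases)
  case (1 f c g)
  then have f: "integrable lborel f" and g: "integrable lborel g" by (auto simp: L1_rel_def)
  have "(\<lambda>x. LINT y|lborel. f y * (c * g (x - y))) = (\<lambda>x. c * (LINT y|lborel. f y * g (x - y)))"
    by (simp add: mult.left_commute)
  then show ?case
    using f g by (simp add: L1_rel_def integrable_convolution)
qed

text \<open>The integrand in three variables is integrable, so for almost every x it is integrable
  in the other two. There the order of integration may be exchanged, and shifting y by z turns the
  inner integral into a convolution.\<close>

lemma conv_assoc: "conv (conv f g) h = conv f (conv g h)"
proof (transfer, goal_cases)
  case (1 f g h)
  then have f: "integrable lborel f" and g: "integrable lborel g" and h: "integrable lborel h"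
    by (auto simp: L1_rel_def)
  then have [measurable]: "f \<in> borel_measurable borel" "g \<in> borel_measurable borel"
    "h \<in> borel_measurable borel" by simp_all
  have "integrable (lborel \<Otimes>\<^sub>M lborel) (\<lambda>(z, y). f z * g (y - z))"
    using integrable_translation_kernel[OF lborel.sigma_finite_measure_axioms f g, of "\<lambda>z. z"] by simp
  from integrable_translation_kernel[OF lborel_pair.P.sigma_finite_measure_axioms this h, of snd]
  have "integrable ((lborel \<Otimes>\<^sub>M lborel) \<Otimes>\<^sub>M lborel)
      (\<lambda>(p, x). (case p of (z, y) \<Rightarrow> f z * g (y - z)) * h (x - snd p))"
    by simp
  moreover have "pair_sigma_finite (lborel \<Otimes>\<^sub>M lborel :: ('a \<times> 'a) measure) (lborel :: 'a measure)"
    by (intro pair_sigma_finite.intro lborel_pair.P.sigma_finite_measure_axioms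
        lborel.sigma_finite_measure_axioms)
  ultimately have "AE x in lborel. integrable (lborel \<Otimes>\<^sub>M lborel)
      (\<lambda>p. (case p of (z, y) \<Rightarrow> f z * g (y - z)) * h (x - snd p))"
    by (intro pair_sigma_finite.AE_integrable_snd) (auto simp: case_prod_beta)
  then have "AE x in lborel. (LINT y|lborel. (LINT z|lborel. f z * g (y - z)) * h (x - y)) =
      (LINT z|lborel. f z * (LINT y|lborel. g y * h (x - z - y)))"
  proof eventually_elim
    case (elim x)
    then have int: "integrable (lborel \<Otimes>\<^sub>M lborel) (\<lambda>(z, y). f z * g (y - z) * h (x - y))"
      by (simp add: case_prod_beta')
    have shift: "(LINT y|lborel. g y * h (x - z - y)) = (LINT y|lborel. g (y - z) * h (x - y))" for z
      using lborel_integral_shift[of "\<lambda>y. g y * h (x - z - y)" z] by (simp add: algebra_simps)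
    have "(LINT y|lborel. (LINT z|lborel. f z * g (y - z)) * h (x - y)) =
        (LINT y|lborel. LINT z|lborel. f z * g (y - z) * h (x - y))" by simp
    also have "\<dots> = (LINT z|lborel. LINT y|lborel. f z * g (y - z) * h (x - y))"
      by (rule lborel_pair.Fubini_integral[OF int])
    also have "\<dots> = (LINT z|lborel. f z * (LINT y|lborel. g y * h (x - z - y)))"
      by (simp add: shift mult.assoc)
    finally show ?case .
  qed
  then show ?case
    using integrable_convolution[OF integrable_convolution[OF f g] h]
      integrable_convolution[OF f integrable_convolution[OF g h]] by (simp add: L1_rel_def)
qed

lemma scaleC_L1_simps:
  "scaleC_L1 c (f + g) = scaleC_L1 c f + scaleC_L1 c g"
  "scaleC_L1 (c + d) f = scaleC_L1 c f + scaleC_L1 d f"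
  "scaleC_L1 c (scaleC_L1 d f) = scaleC_L1 (c * d) f"
  "scaleC_L1 (of_real r) f = r *\<^sub>R f"
  by (transfer, simp add: L1_rel_def algebra_simps scaleR_conv_of_real)+

lemma scaleC_L1_diff: "scaleC_L1 c (f - g) = scaleC_L1 c f - scaleC_L1 c g"
  by transfer (simp add: L1_rel_def algebra_simps)

lemma translate_simps:
  "translate y (f + g) = translate y f + translate y g"
  "translate y (f - g) = translate y f - translate y g"
  "translate y (scaleC_L1 c f) = scaleC_L1 c (translate y f)"
  "translate y (translate z f) = translate (y + z) f"
  "translate 0 f = f"
  by (transfer, auto simp: L1_rel_def algebra_simps integrable_lborel_shift
      intro!: Bochner_Integration.integrable_add Bochner_Integration.integrable_diff)+

section \<open>Approximating a convolution by sums of translates\<close>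

text \<open>Minkowski's inequality for integrals: the norm of the integral over y is at most the
  integral over y of the norms, by Fubini for the modulus of the difference kernel.\<close>

lemma translation_kernel_diff:
  fixes f g :: "'e::euclidean_space \<Rightarrow> complex" and r :: "'e \<Rightarrow> 'e"
  assumes f: "integrable lborel f" and g: "integrable lborel g"
    and r [measurable]: "r \<in> borel_measurable borel"
  shows "integrable lborel (\<lambda>y. cmod (f y) * (LINT x|lborel. cmod (g (x - y) - g (x - r y))))" (is ?int)
    and "(LINT x|lborel. cmod ((LINT y|lborel. f y * g (x - y)) - (LINT y|lborel. f y * g (x - r y))))
      \<le> (LINT y|lborel. cmod (f y) * (LINT x|lborel. cmod (g (x - y) - g (x - r y))))" (is "?l \<le> ?r")
proof -
  let ?k = "\<lambda>y x. f y * g (x - y) - f y * g (x - r y)"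
  have "integrable (lborel \<Otimes>\<^sub>M lborel) (\<lambda>(y, x). f y * g (x - y))"
    "integrable (lborel \<Otimes>\<^sub>M lborel) (\<lambda>(y, x). f y * g (x - r y))"
    using integrable_translation_kernel[OF lborel.sigma_finite_measure_axioms f g, of "\<lambda>z. z"]
      integrable_translation_kernel[OF lborel.sigma_finite_measure_axioms f g, of r] by auto
  from Bochner_Integration.integrable_diff[OF this]
  have k: "integrable (lborel \<Otimes>\<^sub>M lborel) (case_prod ?k)" by (simp add: case_prod_beta')
  then have kn: "integrable (lborel \<Otimes>\<^sub>M lborel) (\<lambda>(y, x). cmod (?k y x))"
    using integrable_norm[OF k] by (simp add: case_prod_beta')
  have eq: "(LINT x|lborel. cmod (?k y x)) = cmod (f y) * (LINT x|lborel. cmod (g (x - y) - g (x - r y)))" for y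
    by (simp add: norm_mult[symmetric] right_diff_distrib flip: integral_mult_right_zero)
  show ?int
    using lborel_pair.integrable_fst[OF kn] by (simp only: eq)
  have "?l = (LINT x|lborel. cmod (LINT y|lborel. ?k y x))"
  proof (rule integral_cong_AE)
    show "AE x in lborel. cmod ((LINT y|lborel. f y * g (x - y)) - (LINT y|lborel. f y * g (x - r y))) =
        cmod (LINT y|lborel. ?k y x)"
      using AE_integrable_conv[OF f g] AE_integrable_translation_kernel(1)[OF f g r]
      by eventually_elim simp
    show "(\<lambda>x. cmod ((LINT y|lborel. f y * g (x - y)) - (LINT y|lborel. f y * g (x - r y)))) \<in> borel_measurable lborel"
      using integrable_convolution[OF f g] AE_integrable_translation_kernel(2)[OF f g r]
      by (auto dest: borel_measurable_integrable)
    show "(\<lambda>x. cmod (LINT y|lborel. ?k y x)) \<in> borel_measurable lborel"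
      using lborel_pair.integrable_snd[OF k] by (auto dest: borel_measurable_integrable)
  qed
  also have "\<dots> \<le> (LINT x|lborel. LINT y|lborel. cmod (?k y x))"
    using lborel_pair.integrable_snd[OF k] lborel_pair.integrable_snd[OF kn]
    by (intro integral_mono integral_norm_bound integrable_norm)
  also have "\<dots> = (LINT y|lborel. LINT x|lborel. cmod (?k y x))"
    by (rule lborel_pair.Fubini_integral[OF kn])
  finally show "?l \<le> ?r" by (simp only: eq)
qed

lemma L1_rel_refl: "integrable lborel f \<Longrightarrow> L1_rel f f"
  by (simp add: L1_rel_def)

lemma integrable_rep_L1: "integrable lborel (rep_L1 f)"
  using Quotient_rep_reflp[OF Quotient_L1, of f] by (simp add: L1_rel_def)

lemma abs_rep_L1: "abs_L1 (rep_L1 f) = f"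
  using Quotient_abs_rep[OF Quotient_L1] .

lemma norm_L1_rep: "norm f = (LINT x|lborel. cmod (rep_L1 f x))"
  using norm_L1.abs_eq[OF L1_rel_refl[OF integrable_rep_L1]] by (simp add: abs_rep_L1)

text \<open>With r a simple approximation of the identity this is the error of a Riemann sum for
  \<open>conv f g\<close>; with r = 0 it compares \<open>conv f g\<close> with the integral of f
  times g, as needed for an approximate identity.\<close>

lemma norm_conv_superposition:
  fixes f g :: "'e::euclidean_space L1"
  assumes r: "r \<in> borel_measurable borel"
  shows "integrable lborel (\<lambda>y. cmod (rep_L1 f y) * norm (translate y g - translate (r y) g))"
    and "norm (conv f g - abs_L1 (\<lambda>x. LINT y|lborel. rep_L1 f y * rep_L1 g (x - r y)))
      \<le> (LINT y|lborel. cmod (rep_L1 f y) * norm (translate y g - translate (r y) g))"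
proof -
  let ?f = "rep_L1 f" and ?g = "rep_L1 g"
  note f = integrable_rep_L1[of f] and g = integrable_rep_L1[of g]
  have tr: "translate y g = abs_L1 (\<lambda>x. ?g (x - y))" for y
    using translate.abs_eq[OF L1_rel_refl[OF g]] by (simp add: abs_rep_L1)
  have nrm: "norm (translate y g - translate z g) = (LINT x|lborel. cmod (?g (x - y) - ?g (x - z)))" for y z
    unfolding tr using integrable_lborel_shift[OF g]
    by (simp add: minus_L1.abs_eq norm_L1.abs_eq L1_rel_refl)
  show "integrable lborel (\<lambda>y. cmod (?f y) * norm (translate y g - translate (r y) g))"
    unfolding nrm by (rule translation_kernel_diff[OF f g r])
  have "conv f g = abs_L1 (\<lambda>x. LINT y|lborel. ?f y * ?g (x - y))"
    using conv.abs_eq[OF L1_rel_refl[OF f] L1_rel_refl[OF g]] by (simp add: abs_rep_L1)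
  then have "norm (conv f g - abs_L1 (\<lambda>x. LINT y|lborel. ?f y * ?g (x - r y))) =
     (LINT x|lborel. cmod ((LINT y|lborel. ?f y * ?g (x - y)) - (LINT y|lborel. ?f y * ?g (x - r y))))"
    using integrable_convolution[OF f g] AE_integrable_translation_kernel(2)[OF f g r]
    by (simp add: minus_L1.abs_eq norm_L1.abs_eq L1_rel_refl)
  then show "norm (conv f g - abs_L1 (\<lambda>x. LINT y|lborel. ?f y * ?g (x - r y)))
      \<le> (LINT y|lborel. cmod (?f y) * norm (translate y g - translate (r y) g))"
    unfolding nrm using translation_kernel_diff(2)[OF f g r] by simp
qed

lemma sum_abs_L1:
  assumes "finite I" "\<And>i. i \<in> I \<Longrightarrow> integrable lborel (F i)"
  shows "(\<Sum>i\<in>I. abs_L1 (F i)) = abs_L1 (\<lambda>x. \<Sum>i\<in>I. F i x)"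
  using assms
proof (induction I rule: finite_induct)
  case empty
  then show ?case by (simp add: zero_L1_def)
next
  case (insert i I)
  then show ?case
    by (simp add: plus_L1.abs_eq L1_rel_refl Bochner_Integration.integrable_sum)
qed

text \<open>Decomposing the domain into the fibres of the simple function r leaves a finite
  combination of translates of g, which stays in any translation-invariant subspace containing
  g.\<close>

lemma superposition_simple:
  fixes f g :: "'e::euclidean_space L1"
  assumes r: "simple_function lborel r"
  shows "abs_L1 (\<lambda>x. LINT y|lborel. rep_L1 f y * rep_L1 g (x - r y)) =
    (\<Sum>z\<in>range r. scaleC_L1 (LINT y|lborel. indicator (r -` {z}) y * rep_L1 f y) (translate z g))"
proof -
  let ?f = "rep_L1 f" and ?g = "rep_L1 g"
  note f = integrable_rep_L1[of f] and g = integrable_rep_L1[of g]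
  have fin: "finite (range r)" using simple_functionD(1)[OF r] by simp
  have meas: "r -` {z} \<in> sets borel" for z using simple_functionD(2)[OF r, of "{z}"] by simp
  let ?c = "\<lambda>z. LINT y|lborel. indicator (r -` {z}) y * ?f y"
  have int: "integrable lborel (\<lambda>y. indicator (r -` {z}) y * ?f y)" for z
    using integrable_real_mult_indicator[of "r -` {z}" lborel "\<lambda>y. Re (?f y)"] f meas[of z]
      integrable_mult_indicator[of "r -` {z}" lborel ?f]
    by (simp add: scaleR_conv_of_real) (simp add: indicator_def of_bool_def if_distrib cong: if_cong)
  have tr: "scaleC_L1 (?c z) (translate z g) = abs_L1 (\<lambda>x. ?c z * ?g (x - z))" for z
  proof -
    have "translate z g = abs_L1 (\<lambda>x. ?g (x - z))"
      using translate.abs_eq[OF L1_rel_refl[OF g]] by (simp add: abs_rep_L1)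
    then show ?thesis
      using scaleC_L1.abs_eq[OF L1_rel_refl[OF integrable_lborel_shift[OF g]]] by simp
  qed
  have "(LINT y|lborel. ?f y * ?g (x - r y)) = (\<Sum>z\<in>range r. ?c z * ?g (x - z))" for x
  proof -
    have "?f y * ?g (x - r y) = (\<Sum>z\<in>range r. indicator (r -` {z}) y * ?f y * ?g (x - z))" for y
    proof -
      have "(\<Sum>z\<in>range r. indicator (r -` {z}) y * ?f y * ?g (x - z)) =
          (\<Sum>z\<in>range r. if r y = z then ?f y * ?g (x - z) else 0)"
        by (intro sum.cong) (auto simp: indicator_def)
      also have "\<dots> = ?f y * ?g (x - r y)" using fin by simp
      finally show ?thesis by simp
    qed
    then show ?thesis using int by (simp add: Bochner_Integration.integral_sum)
  qed
  then show ?thesis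
    using fin integrable_lborel_shift[OF g] by (simp add: tr sum_abs_L1)
qed

section \<open>Segal algebras as ideals\<close>

lemma cmod_indicator: "cmod (indicator A x) = indicator A x"
  by (simp add: indicator_def)

lemma integrable_indicator_mult:
  fixes f :: "'e::euclidean_space \<Rightarrow> complex"
  assumes "integrable lborel f" "A \<in> sets borel"
  shows "integrable lborel (\<lambda>y. indicator A y * f y)"
proof -
  have "integrable lborel (\<lambda>y. indicator A y *\<^sub>R f y)"
    using assms by (intro integrable_mult_indicator) auto
  then show ?thesis by (simp add: scaleR_conv_of_real of_real_indicator)
qed

text \<open>The weights are the integrals of f over the fibres of s. Labels of arbitrary type,
  rather than sample points, let two partitions be joined by labelling with pairs.\<close>

definition riemann_sum :: "('e::euclidean_space \<Rightarrow> complex) \<Rightarrow> ('e \<Rightarrow> 'p) \<Rightarrow> ('p \<Rightarrow> 'e L1) \<Rightarrow> 'e L1" where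
  "riemann_sum f s V = (\<Sum>p\<in>range s. scaleC_L1 (LINT y|lborel. indicator (s -` {p}) y * f y) (V p))"

lemma simple_function_lborelD:
  fixes s :: "'e::euclidean_space \<Rightarrow> 'p"
  assumes "simple_function lborel s"
  shows "finite (range s)" "s -` A \<in> sets borel"
  using simple_functionD(1)[OF assms] simple_functionD(2)[OF assms, of A] by auto

text \<open>A fibre of the coarser labelling is a finite disjoint union of fibres of s, so its
  weight is the sum of theirs.\<close>

lemma riemann_sum_refine:
  fixes s :: "'e::euclidean_space \<Rightarrow> 'p" and \<pi> :: "'p \<Rightarrow> 'q"
  assumes f: "integrable lborel f" and s: "simple_function lborel s"
  shows "riemann_sum f (\<lambda>y. \<pi> (s y)) V = riemann_sum f s (\<lambda>p. V (\<pi> p))"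
proof -
  note fin = simple_function_lborelD(1)[OF s]
  let ?c = "\<lambda>p. LINT y|lborel. indicator (s -` {p}) y * f y"
  note int = integrable_indicator_mult[OF f simple_function_lborelD(2)[OF s]]
  have c: "(LINT y|lborel. indicator ((\<lambda>y. \<pi> (s y)) -` {q}) y * f y) = sum ?c {p \<in> range s. \<pi> p = q}" for q
  proof -
    have "indicator ((\<lambda>y. \<pi> (s y)) -` {q}) y * f y = (\<Sum>p\<in>{p \<in> range s. \<pi> p = q}. indicator (s -` {p}) y * f y)" for y
    proof -
      have "(\<Sum>p\<in>{p \<in> range s. \<pi> p = q}. indicator (s -` {p}) y * f y) =
        (\<Sum>p\<in>{p \<in> range s. \<pi> p = q}. if s y = p then f y else 0)"
        by (intro sum.cong) (auto simp: indicator_def)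
      also have "\<dots> = indicator ((\<lambda>y. \<pi> (s y)) -` {q}) y * f y"
        using fin by (auto simp: indicator_def)
      finally show ?thesis by simp
    qed
    then show ?thesis using int by (simp add: Bochner_Integration.integral_sum)
  qed
  have scaleC_sum: "scaleC_L1 (sum ?c P) v = (\<Sum>p\<in>P. scaleC_L1 (?c p) v)" if "finite P" for P and v :: "'e L1"
    using that
  proof (induction P rule: finite_induct)
    case empty
    then show ?case using scaleC_L1_simps(4)[of 0 v] by simp
  qed (simp add: scaleC_L1_simps)
  have img: "range (\<lambda>y. \<pi> (s y)) = \<pi> ` range s" by auto
  have "riemann_sum f (\<lambda>y. \<pi> (s y)) V =
      (\<Sum>q\<in>\<pi> ` range s. \<Sum>p\<in>{p \<in> range s. \<pi> p = q}. scaleC_L1 (?c p) (V (\<pi> p)))"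
    unfolding riemann_sum_def c img using fin by (intro sum.cong) (auto simp: scaleC_sum)
  also have "\<dots> = riemann_sum f s (\<lambda>p. V (\<pi> p))"
    unfolding riemann_sum_def using fin by (intro sum.group) auto
  finally show ?thesis .
qed

locale segal =
  fixes S :: "'e::euclidean_space L1 set" and N :: "'e L1 \<Rightarrow> real"
  assumes segal: "segal_algebra S N"
begin

abbreviation "A \<equiv> L1_subalgebra S N"

lemma A_simps [simp]:
  "carrier A = S" "\<zero>\<^bsub>A\<^esub> = 0" "x \<oplus>\<^bsub>A\<^esub> y = x + y" "c \<odot>\<^bsub>A\<^esub> x = scaleC_L1 c x" "vnorm A x = N x"
  by (simp_all add: L1_subalgebra_def)

lemma normed: "complex_normed A"
  using segal by (simp add: segal_algebra_def complex_banach_iff)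

lemma scaleC_minus_one: "scaleC_L1 (- 1) (f :: 'e L1) = - f"
  using scaleC_L1_simps(4)[of "- 1" f] by simp

lemma ndist_A: "f \<in> S \<Longrightarrow> g \<in> S \<Longrightarrow> ndist A f g = N (f - g)"
  using complex_module_minus[of A f g] normed
  by (simp add: ndist_def complex_normed_def scaleC_minus_one)

sublocale banach_subspace S N scaleC_L1
proof
  interpret Module.module complex_ring A using normed by (simp add: complex_normed_def)
  show "0 \<in> S" using M.zero_closed by simp
  show add_mem: "f \<in> S \<Longrightarrow> g \<in> S \<Longrightarrow> f + g \<in> S" for f g using M.a_closed by simp
  show scaleC_mem: "f \<in> S \<Longrightarrow> scaleC_L1 c f \<in> S" for f c
    using complex_normed_smult_closed[OF normed] by simp
  have N_nonneg: "f \<in> S \<Longrightarrow> 0 \<le> N f" for f using normed by (auto simp: complex_normed_def)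
  have diff_mem: "f \<in> S \<Longrightarrow> g \<in> S \<Longrightarrow> f - g \<in> S" for f g
    using add_mem[OF _ scaleC_mem, of f g "- 1"] by (simp add: scaleC_minus_one)
  show "\<exists>l\<in>S. (\<lambda>n. N (X n - l)) \<longlonglongrightarrow> 0"
    if X: "\<And>n. X n \<in> S" and cauchy: "\<And>e. e > 0 \<Longrightarrow> \<exists>M. \<forall>m\<ge>M. \<forall>n\<ge>M. N (X m - X n) < e" for X :: "nat \<Rightarrow> 'e L1"
  proof -
    interpret Metric_space S "ndist A" using complex_normed_metric[OF normed] by simp
    have "MCauchy X"
      unfolding MCauchy_def
    proof (intro conjI allI impI)
      show "range X \<subseteq> S" using X by auto
      fix e :: real assume "e > 0"
      from cauchy[OF this] obtain M where "\<forall>m\<ge>M. \<forall>n\<ge>M. N (X m - X n) < e" ..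
      then show "\<exists>M. \<forall>n n'. M \<le> n \<longrightarrow> M \<le> n' \<longrightarrow> ndist A (X n) (X n') < e"
        by (intro exI[of _ M]) (simp add: ndist_A X)
    qed
    moreover have "mcomplete" using segal by (simp add: segal_algebra_def complex_banach_iff)
    ultimately obtain l where l: "limitin mtopology X l sequentially" by (auto simp: mcomplete_def)
    then have lS: "l \<in> S" and lim: "\<forall>e>0. \<exists>M. \<forall>n\<ge>M. X n \<in> S \<and> ndist A (X n) l < e"
      unfolding limit_metric_sequentially by simp_all
    have "(\<lambda>n. N (X n - l)) \<longlonglongrightarrow> 0"
    proof (rule LIMSEQ_I)
      fix e :: real assume "e > 0"
      with lim obtain M where "\<forall>n\<ge>M. X n \<in> S \<and> ndist A (X n) l < e" by blast
      then show "\<exists>M. \<forall>n\<ge>M. norm (N (X n - l) - 0) < e"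
        by (intro exI[of _ M]) (simp add: ndist_A X lS N_nonneg diff_mem)
    qed
    with lS show ?thesis by blast
  qed
qed (use normed in \<open>auto simp: complex_normed_def scaleC_L1_simps\<close>)

lemma N_diff_triangle: "f \<in> S \<Longrightarrow> g \<in> S \<Longrightarrow> h \<in> S \<Longrightarrow> N (f - h) \<le> N (f - g) + N (g - h)"
  using N_triangle[of "f - g" "g - h"] by (simp add: diff_mem)

lemma norm_le_N: "f \<in> S \<Longrightarrow> norm f \<le> N f" and dense: "closure S = UNIV"
  and translate_mem: "f \<in> S \<Longrightarrow> translate y f \<in> S" and N_translate: "f \<in> S \<Longrightarrow> N (translate y f) = N f"
  using segal by (auto simp: segal_algebra_def)

lemma N_translate_diff:
  assumes g: "g \<in> S"
  shows "N (translate y g - translate z g) = N (translate (y - z) g - g)"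
proof -
  have "translate y g - translate z g = translate z (translate (y - z) g - g)"
    by (simp add: translate_simps)
  then show ?thesis by (simp add: N_translate translate_mem diff_mem g)
qed

text \<open>Continuity into the metric topology of \<open>S\<close> is converted into continuity of
  a real function, the form in which measurability and dominated convergence can use it.\<close>

lemma continuous_translate:
  assumes g: "g \<in> S"
  shows "continuous_on UNIV (\<lambda>y. N (translate y g - g))"
proof -
  interpret Metric_space S "ndist A" using complex_normed_metric[OF normed] by simp
  have "continuous_map euclidean mtopology (\<lambda>y. translate y g)"
    using segal g by (simp add: segal_algebra_def)
  then have lim: "\<exists>U. open U \<and> x \<in> U \<and> (\<forall>y\<in>U. translate y g \<in> mball (translate x g) e)" if "e > 0" for x e
    using that by (simp add: continuous_map_to_metric)
  have "\<exists>d>0. \<forall>y. dist y x < d \<longrightarrow> dist (N (translate y g - g)) (N (translate x g - g)) < e"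
    if e: "e > 0" for x e
  proof -
    obtain U where U: "open U" "x \<in> U" and "\<forall>y\<in>U. translate y g \<in> mball (translate x g) e"
      using lim[OF e, of x] by auto
    then have U3: "ndist A (translate x g) (translate y g) < e" if "y \<in> U" for y
      using that by simp
    obtain d where d: "d > 0" "ball x d \<subseteq> U" using U(1,2) open_contains_ball by blast
    have "dist (N (translate y g - g)) (N (translate x g - g)) < e" if "dist y x < d" for y
    proof -
      have "N (translate x g - translate y g) < e"
        using U3[of y] d(2) that g by (simp add: ndist_A translate_mem subset_iff dist_commute)
      moreover have "N (translate y g - g) \<le> N (translate y g - translate x g) + N (translate x g - g)"
        "N (translate x g - g) \<le> N (translate x g - translate y g) + N (translate y g - g)"
        using g N_diff_triangle[OF translate_mem[OF g, of y] translate_mem[OF g, of x] g]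
          N_diff_triangle[OF translate_mem[OF g, of x] translate_mem[OF g, of y] g] by auto
      ultimately show ?thesis
        using N_minus_commute[of "translate x g" "translate y g"] g by (simp add: translate_mem dist_real_def)
    qed
    with d(1) show ?thesis by blast
  qed
  then show ?thesis by (simp add: continuous_on_iff)
qed

lemma N_translate_diff_le: "g \<in> S \<Longrightarrow> N (translate y g - g) \<le> 2 * N g"
  using N_triangle_diff[of "translate y g" g] by (simp add: N_translate translate_mem)

lemma riemann_sum_mem: "(\<And>p. V p \<in> S) \<Longrightarrow> riemann_sum f s V \<in> S"
  unfolding riemann_sum_def by (intro sum_mem sc_mem)

lemma N_riemann_sum:
  fixes s :: "'e \<Rightarrow> 'p"
  assumes f: "integrable lborel f" and s: "simple_function lborel s" and V: "\<And>p. V p \<in> S"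
  shows "N (riemann_sum f s V) \<le> (LINT y|lborel. cmod (f y) * N (V (s y)))"
proof -
  note fin = simple_function_lborelD(1)[OF s]
  let ?c = "\<lambda>p. LINT y|lborel. indicator (s -` {p}) y * f y"
  have int: "integrable lborel (\<lambda>y. indicator (s -` {p}) y * cmod (f y) * N (V p))" for p
    using integrable_norm[OF integrable_indicator_mult[OF f simple_function_lborelD(2)[OF s, of "{p}"]]]
    by (simp add: norm_mult cmod_indicator)
  have "N (riemann_sum f s V) \<le> (\<Sum>p\<in>range s. N (scaleC_L1 (?c p) (V p)))"
    unfolding riemann_sum_def using V by (intro N_sum sc_mem)
  also have "\<dots> = (\<Sum>p\<in>range s. cmod (?c p) * N (V p))"
    using V by (simp add: N_sc)
  also have "\<dots> \<le> (\<Sum>p\<in>range s. (LINT y|lborel. indicator (s -` {p}) y * cmod (f y)) * N (V p))"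
  proof (intro sum_mono mult_right_mono N_nonneg V)
    show "cmod (?c p) \<le> (LINT y|lborel. indicator (s -` {p}) y * cmod (f y))" for p
      using integral_norm_bound[of lborel "\<lambda>y. indicator (s -` {p}) y * f y"]
      by (simp add: norm_mult cmod_indicator)
  qed
  also have "\<dots> = (LINT y|lborel. (\<Sum>p\<in>range s. indicator (s -` {p}) y * cmod (f y) * N (V p)))"
    using int by (simp add: Bochner_Integration.integral_sum)
  also have "\<dots> = (LINT y|lborel. cmod (f y) * N (V (s y)))"
  proof (rule Bochner_Integration.integral_cong)
    fix y
    have "(\<Sum>p\<in>range s. indicator (s -` {p}) y * cmod (f y) * N (V p)) =
      (\<Sum>p\<in>range s. if s y = p then cmod (f y) * N (V p) else 0)"
      by (intro sum.cong) (auto simp: indicator_def)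
    then show "(\<Sum>p\<in>range s. indicator (s -` {p}) y * cmod (f y) * N (V p)) = cmod (f y) * N (V (s y))"
      using fin by simp
  qed simp
  finally show ?thesis .
qed

text \<open>
  \<open>conv f g\<close> is the Bochner integral of \<open>f(y) L\<^sub>y g\<close> in \<open>S\<close>: Riemann sums are Cauchy for \<open>N\<close> and
  converge to \<open>conv f g\<close> in \<open>L\<^sup>1\<close>.
\<close>

lemma
  assumes g: "g \<in> S"
  shows conv_mem: "conv f g \<in> S" and N_conv: "N (conv f g) \<le> norm f * N g"
proof -
  let ?f = "rep_L1 f"
  note f = integrable_rep_L1[of f]
  let ?\<nu> = "\<lambda>z. N (translate z g - g)"
  have [measurable]: "?\<nu> \<in> borel_measurable borel"
    using continuous_translate[OF g] by (rule borel_measurable_continuous_onI)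
  have [measurable]: "?f \<in> borel_measurable borel" using f by simp
  have \<nu>0: "?\<nu> z \<ge> 0" for z using g by (simp add: N_nonneg diff_mem translate_mem)
  \<comment> \<open>Simple functions converging pointwise to the identity supply the sample
    points.\<close>
  obtain r :: "nat \<Rightarrow> 'e \<Rightarrow> 'e" where r: "\<And>k. simple_function lborel (r k)" "\<And>y. (\<lambda>k. r k y) \<longlonglongrightarrow> y"
    using borel_measurable_implies_sequence_metric[of "\<lambda>y::'e. y" lborel 0] by auto
  have [measurable]: "r k \<in> borel_measurable borel" for k
    using borel_measurable_simple_function[OF r(1)] by simp
  have int: "integrable lborel (\<lambda>y. cmod (?f y) * ?\<nu> (h y))" if [measurable]: "h \<in> borel_measurable borel" for h
  proof (rule Bochner_Integration.integrable_bound)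
    show "integrable lborel (\<lambda>y. cmod (?f y) * (2 * N g))" using f by simp
    show "AE y in lborel. norm (cmod (?f y) * ?\<nu> (h y)) \<le> norm (cmod (?f y) * (2 * N g))"
      using \<nu>0 N_translate_diff_le[OF g] N_nonneg[OF g]
      by (intro AE_I2) (auto simp: abs_mult intro!: mult_left_mono)
  qed measurable
  \<comment> \<open>The error of the k-th Riemann sum, measured in \<open>N\<close> by the isometry
    of translations. It tends to 0 by dominated convergence, since \<open>?\<nu>\<close> is
    continuous, vanishes at 0 and is at most \<open>2 * N g\<close>.\<close>
  define a where "a k = (LINT y|lborel. cmod (?f y) * ?\<nu> (r k y - y))" for k
  have "a \<longlonglongrightarrow> (LINT y|lborel. cmod (?f y) * 0)"
    unfolding a_def
  proof (rule integral_dominated_convergence[where w = "\<lambda>y. cmod (?f y) * (2 * N g)"])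
    show "integrable lborel (\<lambda>y. cmod (?f y) * (2 * N g))" using f by simp
    show "AE y in lborel. (\<lambda>k. cmod (?f y) * ?\<nu> (r k y - y)) \<longlonglongrightarrow> cmod (?f y) * 0"
    proof (intro AE_I2 tendsto_mult tendsto_const)
      fix y
      have "(\<lambda>k. ?\<nu> (r k y - y)) \<longlonglongrightarrow> ?\<nu> (y - y)"
        by (rule continuous_on_tendsto_compose[OF continuous_translate[OF g] tendsto_diff[OF r(2) tendsto_const]]) auto
      then show "(\<lambda>k. ?\<nu> (r k y - y)) \<longlonglongrightarrow> 0"
        using N_zero_iff[OF zero_mem] by (simp add: translate_simps)
    qed
    show "AE y in lborel. norm (cmod (?f y) * ?\<nu> (r k y - y)) \<le> cmod (?f y) * (2 * N g)" for k
      using \<nu>0 N_translate_diff_le[OF g] by (intro AE_I2) (auto simp: abs_mult intro!: mult_left_mono)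
  qed measurable
  then have a: "a \<longlonglongrightarrow> 0" by simp
  define R where "R k = riemann_sum ?f (r k) (\<lambda>z. translate z g)" for k
  have R_mem: "R k \<in> S" for k unfolding R_def by (intro riemann_sum_mem translate_mem g)
  have R_diff: "N (R k - R l) \<le> a k + a l" for k l
  proof -
    \<comment> \<open>The pair of labels gives a common refinement of the two partitions.\<close>
    define s where "s y = (r k y, r l y)" for y
    have s: "simple_function lborel s" unfolding s_def by (intro simple_function_Pair r)
    have "R k = riemann_sum ?f s (\<lambda>p. translate (fst p) g)" "R l = riemann_sum ?f s (\<lambda>p. translate (snd p) g)"
      using riemann_sum_refine[OF f s, of fst "\<lambda>z. translate z g"] riemann_sum_refine[OF f s, of snd "\<lambda>z. translate z g"]
      by (simp_all add: R_def s_def)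
    then have "R k - R l = riemann_sum ?f s (\<lambda>p. translate (fst p) g - translate (snd p) g)"
      unfolding riemann_sum_def
      by (simp add: sum_subtractf[symmetric] scaleC_L1_diff)
    also have "N \<dots> \<le> (LINT y|lborel. cmod (?f y) * N (translate (fst (s y)) g - translate (snd (s y)) g))"
      by (intro N_riemann_sum f s diff_mem translate_mem g)
    also have "\<dots> \<le> (LINT y|lborel. cmod (?f y) * ?\<nu> (r k y - y) + cmod (?f y) * ?\<nu> (r l y - y))"
    proof (rule integral_mono)
      show "integrable lborel (\<lambda>y. cmod (?f y) * N (translate (fst (s y)) g - translate (snd (s y)) g))"
        unfolding N_translate_diff[OF g] s_def fst_conv snd_conv by (intro int) measurable
      show "integrable lborel (\<lambda>y. cmod (?f y) * ?\<nu> (r k y - y) + cmod (?f y) * ?\<nu> (r l y - y))"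
        by (intro Bochner_Integration.integrable_add int) measurable
      fix y
      have "N (translate (r k y) g - translate (r l y) g) \<le> ?\<nu> (r k y - y) + ?\<nu> (r l y - y)"
        using N_diff_triangle[of "translate (r k y) g" "translate y g" "translate (r l y) g"]
          N_minus_commute[of "translate y g" "translate (r l y) g"] g
        by (simp add: translate_mem N_translate_diff[OF g, of "r k y" y] N_translate_diff[OF g, of "r l y" y])
      then show "cmod (?f y) * N (translate (fst (s y)) g - translate (snd (s y)) g) \<le>
          cmod (?f y) * ?\<nu> (r k y - y) + cmod (?f y) * ?\<nu> (r l y - y)"
        by (simp add: s_def flip: distrib_left) (intro mult_left_mono, auto)
    qed
    also have "\<dots> = a k + a l"
      unfolding a_def by (intro Bochner_Integration.integral_add int) measurable
    finally show ?thesis .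
  qed
  have "\<exists>l\<in>S. (\<lambda>k. N (R k - l)) \<longlonglongrightarrow> 0"
  proof (rule complete[OF R_mem])
    fix e :: real assume "e > 0"
    then obtain M where M: "\<And>k. k \<ge> M \<Longrightarrow> \<bar>a k\<bar> < e / 2"
      using LIMSEQ_D[OF a, of "e / 2"] by auto
    have "N (R k - R l) < e" if "k \<ge> M" "l \<ge> M" for k l
      using R_diff[of k l] M[OF that(1)] M[OF that(2)] by linarith
    then show "\<exists>M. \<forall>k\<ge>M. \<forall>l\<ge>M. N (R k - R l) < e" by blast
  qed
  then obtain l where l: "l \<in> S" "(\<lambda>k. N (R k - l)) \<longlonglongrightarrow> 0" by blast
  \<comment> \<open>The limit in \<open>N\<close> is identified in the weaker L^1 norm, where the
    integral defining \<open>conv f g\<close> is available.\<close>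
  have 1: "norm (conv f g - R k) \<le> a k" for k
  proof -
    have "R k = abs_L1 (\<lambda>x. LINT y|lborel. ?f y * rep_L1 g (x - r k y))"
      unfolding R_def riemann_sum_def by (rule superposition_simple[OF r(1), symmetric])
    then have "norm (conv f g - R k) \<le> (LINT y|lborel. cmod (?f y) * norm (translate y g - translate (r k y) g))"
      using norm_conv_superposition(2)[of "r k" f g] by simp
    also have "\<dots> \<le> a k"
      unfolding a_def
    proof (rule integral_mono)
      show "integrable lborel (\<lambda>y. cmod (?f y) * norm (translate y g - translate (r k y) g))"
        by (intro norm_conv_superposition) measurable
      show "integrable lborel (\<lambda>y. cmod (?f y) * ?\<nu> (r k y - y))" by (intro int) measurable
      fix y
      have "norm (translate y g - translate (r k y) g) \<le> N (translate (r k y) g - translate y g)"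
        using norm_le_N[of "translate (r k y) g - translate y g"] g
        by (simp add: diff_mem translate_mem norm_minus_commute)
      then show "cmod (?f y) * norm (translate y g - translate (r k y) g) \<le> cmod (?f y) * ?\<nu> (r k y - y)"
        by (simp add: N_translate_diff[OF g] mult_left_mono)
    qed
    finally show ?thesis .
  qed
  have 2: "norm (R k - l) \<le> N (R k - l)" for k by (intro norm_le_N diff_mem R_mem l)
  have le: "norm (conv f g - l) \<le> a k + N (R k - l)" for k
  proof -
    have "norm (conv f g - l) \<le> norm (conv f g - R k) + norm (R k - l)"
      using norm_triangle_ineq[of "conv f g - R k" "R k - l"] by simp
    with 1[of k] 2[of k] show ?thesis by linarith
  qed
  have "(\<lambda>k. a k + N (R k - l)) \<longlonglongrightarrow> 0" using tendsto_add[OF a l(2)] by simp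
  then have "norm (conv f g - l) \<le> 0"
    using le by (intro tendsto_lowerbound[of _ 0 sequentially]) auto
  then have eq: "conv f g = l" by simp
  with l show "conv f g \<in> S" by simp
  \<comment> \<open>Each Riemann sum already satisfies the bound without error, because all
    translates of g have the same norm.\<close>
  have "N l \<le> norm f * N g + N (R k - l)" for k
  proof -
    have "N (R k) \<le> (LINT y|lborel. cmod (?f y) * N (translate (r k y) g))"
      unfolding R_def by (intro N_riemann_sum f r translate_mem g)
    also have "\<dots> = norm f * N g" by (simp add: N_translate[OF g] norm_L1_rep)
    finally show ?thesis
      using N_triangle_diff[OF R_mem diff_mem[OF R_mem l(1)], of k k] by simp
  qed
  moreover have "(\<lambda>k. norm f * N g + N (R k - l)) \<longlonglongrightarrow> norm f * N g + 0"
    by (intro tendsto_intros l)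
  ultimately show "N (conv f g) \<le> norm f * N g"
    unfolding eq by (intro tendsto_lowerbound[of _ "norm f * N g" sequentially]) auto
qed

end

section \<open>De la Vallee-Poussin kernels\<close>

text \<open>Up to a constant, the Fourier transform of the triangle function on \<open>[-a, a]\<close>.\<close>

definition tri :: "real \<Rightarrow> real \<Rightarrow> real" where
  "tri a x = (if x = 0 then a\<^sup>2 / 2 else (1 - cos (a * x)) / x\<^sup>2)"

lemma tri_measurable [measurable]: "tri a \<in> borel_measurable borel"
  unfolding tri_def[abs_def] by measurable

lemma tri_nonneg: "0 \<le> tri a x"
  by (simp add: tri_def)

lemma tri_zero [simp]: "tri 0 = (\<lambda>_. 0)"
  by (auto simp: tri_def fun_eq_iff)

lemma one_minus_cos_le: "1 - cos x \<le> x\<^sup>2 / 2" for x :: real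
proof -
  have "1 - cos x = 2 * (sin (x / 2))\<^sup>2" using cos_double_sin[of "x / 2"] by simp
  also have "(sin (x / 2))\<^sup>2 \<le> (x / 2)\<^sup>2"
    using abs_sin_x_le_abs_x[of "x / 2"] by (simp only: abs_le_square_iff)
  finally show ?thesis by (simp add: power2_eq_square)
qed

lemma tri_one_le: "tri 1 x \<le> 4 * inverse (1 + x\<^sup>2)"
proof (cases "x = 0")
  case False
  have "(1 - cos x) * (1 + x\<^sup>2) = (1 - cos x) + (1 - cos x) * x\<^sup>2" by (simp add: algebra_simps)
  also have "\<dots> \<le> x\<^sup>2 / 2 + 2 * x\<^sup>2"
    using one_minus_cos_le[of x] cos_ge_minus_one[of x] by (intro add_mono mult_right_mono) auto
  also have "\<dots> \<le> 4 * x\<^sup>2" by simp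
  finally have "(1 - cos x) * (1 + x\<^sup>2) \<le> 4 * x\<^sup>2" .
  moreover have "1 + x\<^sup>2 > 0" by (simp add: add_pos_nonneg)
  ultimately show ?thesis using False by (simp add: tri_def field_simps)
qed (simp add: tri_def)

lemma integrable_tri_one: "integrable lborel (tri 1)"
proof (rule Bochner_Integration.integrable_bound)
  have "integrable lborel (\<lambda>x::real. inverse (1 + x\<^sup>2))"
    using integrable_inverse_1_plus_square by (simp add: set_integrable_def)
  then show "integrable lborel (\<lambda>x::real. 4 * inverse (1 + x\<^sup>2))" by simp
  show "AE x in lborel. norm (tri 1 x) \<le> norm (4 * inverse (1 + x\<^sup>2))"
    using tri_one_le tri_nonneg by (intro AE_I2) (simp add: abs_of_nonneg add_nonneg_nonneg)
qed simp

lemma tri_scale_mult: "tri (c * a) x = a\<^sup>2 * tri c (a * x)"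
  by (auto simp: tri_def power_mult_distrib mult.assoc)

lemma tri_scale: "tri a x = a\<^sup>2 * tri 1 (a * x)"
  using tri_scale_mult[of 1 a x] by simp

lemma tri_le: "tri a x \<le> a\<^sup>2 / 2"
proof (cases "x = 0")
  case False
  then have "tri a x \<le> ((a * x)\<^sup>2 / 2) / x\<^sup>2"
    unfolding tri_def using divide_right_mono[OF one_minus_cos_le[of "a * x"], of "x\<^sup>2"] by simp
  with False show ?thesis by (simp add: power_mult_distrib)
qed (simp add: tri_def)

text \<open>The value of this integral is pi; it serves as a normalising factor.\<close>

definition tri_mass :: real where "tri_mass = (LINT x|lborel. tri 1 x)"

lemma integrable_tri: "integrable lborel (tri a)"
proof (cases "a = 0")
  case False
  then have "integrable lborel (\<lambda>x. tri 1 (0 + a * x))"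
    by (rule lborel_integrable_real_affine[OF integrable_tri_one])
  then have "integrable lborel (\<lambda>x. a\<^sup>2 * tri 1 (a * x))" by simp
  then show ?thesis unfolding tri_scale[symmetric] .
qed simp

lemma integral_tri: "(LINT x|lborel. tri a x) = \<bar>a\<bar> * tri_mass"
proof (cases "a = 0")
  case False
  have "(LINT x|lborel. tri a x) = a\<^sup>2 * (LINT x|lborel. tri 1 (a * x))"
    unfolding tri_scale[of a] by simp
  also have "\<dots> = \<bar>a\<bar> * (\<bar>a\<bar> * (LINT x|lborel. tri 1 (a * x)))"
    by (simp add: power2_eq_square)
  also have "\<bar>a\<bar> * (LINT x|lborel. tri 1 (a * x)) = tri_mass"
    using lborel_integral_real_affine[OF False, of "tri 1" 0] by (simp add: tri_mass_def)
  finally show ?thesis .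
qed simp

lemma tri_mass_pos: "tri_mass > 0"
proof -
  have "tri_mass \<ge> 0" unfolding tri_mass_def by (intro Bochner_Integration.integral_nonneg tri_nonneg)
  moreover have "tri_mass \<noteq> 0"
  proof
    assume "tri_mass = 0"
    then have "AE x in lborel. tri 1 x = 0"
      using integral_nonneg_eq_0_iff_AE[OF integrable_tri_one] tri_nonneg by (simp add: tri_mass_def)
    then have "AE x in lborel. x \<notin> {0<..<1::real}"
    proof eventually_elim
      case (elim x)
      have "cos x < cos 0" if "0 < x" "x < 1"
        using that pi_gt3 by (intro cos_monotone_0_pi) auto
      with elim show ?case by (auto simp: tri_def split: if_splits)
    qed
    then have "emeasure lborel {0<..<1::real} = 0"
      by (subst (asm) AE_iff_measurable[of "{0<..<1}"]) auto
    then show False by simp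
  qed
  ultimately show ?thesis by simp
qed

text \<open>The product formula for cosines keeps the functions \<open>tri\<close> closed under
  modulation up to linear combinations. Their Fourier transforms thus follow from the total
  integrals alone.\<close>

lemma tri_mult_cos: "tri a x * cos (t * x) = (tri (a + t) x + tri (a - t) x) / 2 - tri t x"
proof (cases "x = 0")
  case False
  have "cos (a * x) * cos (t * x) = (cos ((a + t) * x) + cos ((a - t) * x)) / 2"
    by (simp add: cos_add cos_diff distrib_right left_diff_distrib)
  with False show ?thesis by (simp add: tri_def divide_simps) (simp add: algebra_simps)
qed (simp add: tri_def power2_eq_square field_simps)

lemma integrable_tri_mult_cos: "integrable lborel (\<lambda>x. tri a x * cos (t * x))"
  unfolding tri_mult_cos by (intro Bochner_Integration.integrable_diff Bochner_Integration.integrable_add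
      integrable_divide_zero integrable_tri)

lemma integral_tri_mult_cos:
  "(LINT x|lborel. tri a x * cos (t * x)) = ((\<bar>a + t\<bar> + \<bar>a - t\<bar>) / 2 - \<bar>t\<bar>) * tri_mass"
  unfolding tri_mult_cos using integrable_tri
  by (simp add: integral_tri algebra_simps add_divide_distrib)

text \<open>The converse Fourier relation: \<open>tri a\<close> is the cosine transform of the
  triangle, checked by an explicit antiderivative.\<close>

lemma tri_integral_rep:
  assumes a: "a \<ge> 0"
  shows "(LINT u|lborel. indicator {0..a} u * ((a - u) * cos (u * x))) = tri a x"
proof -
  have cont: "continuous_on {0..a} (\<lambda>u. (a - u) * cos (u * x))" by (intro continuous_intros)
  show ?thesis
  proof (cases "x = 0")
    case True
    have "((\<lambda>u. a * u - u\<^sup>2 / 2) has_vector_derivative (a - u) * cos (u * x)) (at u within {0..a})" for u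
      unfolding has_real_derivative_iff_has_vector_derivative[symmetric] using True
      by (auto intro!: derivative_eq_intros)
    from integral_FTC_atLeastAtMost[OF a this cont] True show ?thesis
      by (simp add: tri_def power2_eq_square)
  next
    case False
    have "((\<lambda>u. (a - u) * sin (u * x) / x - cos (u * x) / x\<^sup>2) has_vector_derivative (a - u) * cos (u * x))
      (at u within {0..a})" for u
      unfolding has_real_derivative_iff_has_vector_derivative[symmetric] using False
      by (auto intro!: derivative_eq_intros simp: power2_eq_square field_simps)
    from integral_FTC_atLeastAtMost[OF a this cont] False show ?thesis
      by (simp add: tri_def diff_divide_distrib)
  qed
qed

text \<open>By the preceding formula \<open>tri a\<close> is a superposition of the frequencies in
  [0, a]. A function G whose Fourier transform is 1 there reproduces each of them, so it reproduces
  \<open>tri a\<close>; this avoids Fourier inversion.\<close>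

lemma conv_tri:
  fixes G :: "real \<Rightarrow> real"
  assumes G: "integrable lborel G" and a: "a \<ge> 0"
    and cos: "\<And>u. 0 \<le> u \<Longrightarrow> u \<le> a \<Longrightarrow> (LINT y|lborel. G y * cos (u * y)) = 1"
    and sin: "\<And>u. 0 \<le> u \<Longrightarrow> u \<le> a \<Longrightarrow> (LINT y|lborel. G y * sin (u * y)) = 0"
  shows "(LINT y|lborel. G y * tri a (x - y)) = tri a x"
proof -
  have [measurable]: "G \<in> borel_measurable borel" using G by simp
  let ?H = "\<lambda>u. indicator {0..a} u * a :: real"
  have H: "integrable lborel ?H"
    by (intro integrable_mult_left integrable_real_indicator) (auto simp: a)
  have prod: "integrable (lborel \<Otimes>\<^sub>M lborel) (\<lambda>(y, u). G y * ?H u)"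
  proof (rule lborel_pair.Fubini_integrable)
    show "integrable lborel (\<lambda>y. LINT u|lborel. norm (case (y, u) of (y, u) \<Rightarrow> G y * ?H u))"
      using G by (simp add: abs_mult)
  qed (use H in auto)
  let ?k = "\<lambda>y u. G y * (indicator {0..a} u * ((a - u) * cos (u * (x - y))))"
  have k: "integrable (lborel \<Otimes>\<^sub>M lborel) (case_prod ?k)"
  proof (rule Bochner_Integration.integrable_bound[OF prod])
    have "\<bar>indicator {0..a} u * ((a - u) * cos (u * (x - y)))\<bar> \<le> \<bar>?H u\<bar>" for u y
    proof (cases "u \<in> {0..a}")
      case True
      then have "\<bar>a - u\<bar> * \<bar>cos (u * (x - y))\<bar> \<le> a * 1" by (intro mult_mono) auto
      with True a show ?thesis by (simp add: abs_mult)
    qed simp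
    then have "\<bar>?k y u\<bar> \<le> \<bar>G y * ?H u\<bar>" for y u
      unfolding abs_mult[of "G y"] by (intro mult_left_mono) auto
    then show "AE p in lborel \<Otimes>\<^sub>M lborel. norm (case p of (y, u) \<Rightarrow> ?k y u) \<le> norm (case p of (y, u) \<Rightarrow> G y * ?H u)"
      unfolding real_norm_def by (intro AE_I2) (simp only: case_prod_beta)
  qed measurable
  have int: "integrable lborel (\<lambda>y. G y * c y)" if [measurable]: "c \<in> borel_measurable borel" and "\<And>y. \<bar>c y\<bar> \<le> 1" for c
    by (rule Bochner_Integration.integrable_bound[OF G])
      (use that(2) in \<open>auto simp: abs_mult intro!: mult_left_le\<close>)
  have inner: "(LINT y|lborel. ?k y u) = indicator {0..a} u * ((a - u) * cos (u * x))" for u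
  proof (cases "u \<in> {0..a}")
    case True
    have "(LINT y|lborel. G y * cos (u * (x - y))) =
        (LINT y|lborel. cos (u * x) * (G y * cos (u * y)) + sin (u * x) * (G y * sin (u * y)))"
      by (rule Bochner_Integration.integral_cong) (auto simp: right_diff_distrib cos_diff algebra_simps)
    also have "\<dots> = cos (u * x) * (LINT y|lborel. G y * cos (u * y)) + sin (u * x) * (LINT y|lborel. G y * sin (u * y))"
      by (subst Bochner_Integration.integral_add) (auto intro!: int)
    also have "\<dots> = cos (u * x)" using True cos sin by simp
    finally have "(LINT y|lborel. (a - u) * (G y * cos (u * (x - y)))) = (a - u) * cos (u * x)" by simp
    then show ?thesis using True by (simp add: mult.left_commute)
  qed simp
  have "(LINT y|lborel. G y * tri a (x - y)) = (LINT y|lborel. LINT u|lborel. ?k y u)"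
    by (simp add: tri_integral_rep[OF a])
  also have "\<dots> = (LINT u|lborel. LINT y|lborel. ?k y u)"
    using lborel_pair.Fubini_integral[OF k] by simp
  also have "\<dots> = tri a x" unfolding inner by (rule tri_integral_rep[OF a])
  finally show ?thesis .
qed

text \<open>The de la Vallee-Poussin kernel: its Fourier transform is 1 on \<open>[-b, b]\<close> and 0 off \<open>[-2b, 2b]\<close>.\<close>

definition vdp :: "real \<Rightarrow> real \<Rightarrow> real" where
  "vdp b x = (tri (2 * b) x - tri b x) / (b * tri_mass)"

lemma integrable_vdp: "integrable lborel (vdp b)"
  unfolding vdp_def[abs_def] by (intro integrable_divide_zero Bochner_Integration.integrable_diff integrable_tri)

lemma vdp_measurable [measurable]: "vdp b \<in> borel_measurable borel"
  using integrable_vdp by simp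

lemma vdp_scale: "vdp b x = b * vdp 1 (b * x)"
  by (simp add: vdp_def tri_scale_mult[of 2 b] tri_scale[of b] power2_eq_square right_diff_distrib mult.assoc
      flip: right_diff_distrib)

text \<open>In the difference of the two transforms the terms with |t| cancel, and for |t| at most b
  what remains is 2b - b.\<close>

lemma integral_vdp_cos:
  assumes "b > 0" "\<bar>t\<bar> \<le> b"
  shows "(LINT x|lborel. vdp b x * cos (t * x)) = 1"
proof -
  have "(LINT x|lborel. vdp b x * cos (t * x)) =
      (LINT x|lborel. (tri (2 * b) x * cos (t * x) - tri b x * cos (t * x)) / (b * tri_mass))"
    by (simp add: vdp_def left_diff_distrib)
  also have "\<dots> = ((\<bar>2 * b + t\<bar> + \<bar>2 * b - t\<bar>) / 2 - (\<bar>b + t\<bar> + \<bar>b - t\<bar>) / 2) * tri_mass / (b * tri_mass)"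
    using integrable_tri_mult_cos by (simp add: integral_tri_mult_cos left_diff_distrib)
  also have "(\<bar>2 * b + t\<bar> + \<bar>2 * b - t\<bar>) / 2 - (\<bar>b + t\<bar> + \<bar>b - t\<bar>) / 2 = b"
  proof -
    have "\<bar>2 * b + t\<bar> = 2 * b + t" "\<bar>2 * b - t\<bar> = 2 * b - t" "\<bar>b + t\<bar> = b + t" "\<bar>b - t\<bar> = b - t"
      using assms by linarith+
    then show ?thesis by simp
  qed
  finally show ?thesis using assms tri_mass_pos by simp
qed

lemma integral_vdp_sin: "(LINT x|lborel. vdp b x * sin (t * x)) = 0"
proof -
  have "vdp b (- x) = vdp b x" for x by (simp add: vdp_def tri_def)
  then have "(LINT x|lborel. vdp b x * sin (t * x)) = - (LINT x|lborel. vdp b x * sin (t * x))"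
    by (subst lborel_integral_real_affine[of "- 1" _ 0]) auto
  then show ?thesis by simp
qed

lemma integral_vdp: "b > 0 \<Longrightarrow> (LINT x|lborel. vdp b x) = 1"
  using integral_vdp_cos[of b 0] by simp

text \<open>The two triangles have masses proportional to 2b and b; after division by b their sum is
  3, whatever the scale.\<close>

lemma integral_abs_vdp_le:
  assumes "b > 0"
  shows "(LINT x|lborel. \<bar>vdp b x\<bar>) \<le> 3"
proof -
  have "(LINT x|lborel. \<bar>vdp b x\<bar>) \<le> (LINT x|lborel. (tri (2 * b) x + tri b x) / (b * tri_mass))"
  proof (rule integral_mono)
    show "integrable lborel (\<lambda>x. \<bar>vdp b x\<bar>)" using integrable_vdp by (rule integrable_abs)
    show "integrable lborel (\<lambda>x. (tri (2 * b) x + tri b x) / (b * tri_mass))"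
      by (intro integrable_divide_zero Bochner_Integration.integrable_add integrable_tri)
    show "\<bar>vdp b x\<bar> \<le> (tri (2 * b) x + tri b x) / (b * tri_mass)" for x
      using assms tri_mass_pos tri_nonneg[of "2 * b" x] tri_nonneg[of b x]
      by (simp add: vdp_def abs_divide abs_mult divide_right_mono)
  qed
  also have "\<dots> = 3" using assms tri_mass_pos by (simp add: integral_tri integrable_tri field_simps)
  finally show ?thesis .
qed

text \<open>\<open>vdp b\<close> is made of frequencies up to 2b, and the transform of
  \<open>vdp b'\<close> equals 1 on that range. The doubling of the scale comes from here.\<close>

lemma conv_vdp:
  assumes "b > 0" "b' \<ge> 2 * b"
  shows "(LINT y|lborel. vdp b y * vdp b' (x - y)) = vdp b x"
proof -
  have *: "(LINT y|lborel. vdp b' y * tri a (x - y)) = tri a x" if "0 \<le> a" "a \<le> 2 * b" for a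
    using assms that by (intro conv_tri integrable_vdp integral_vdp_cos integral_vdp_sin) auto
  have int: "integrable lborel (\<lambda>y. vdp b' y * tri a (x - y))" for a
  proof (rule Bochner_Integration.integrable_bound)
    show "integrable lborel (\<lambda>y. vdp b' y * (a\<^sup>2 / 2))" using integrable_vdp by simp
    show "AE y in lborel. norm (vdp b' y * tri a (x - y)) \<le> norm (vdp b' y * (a\<^sup>2 / 2))"
      unfolding real_norm_def abs_mult using tri_le[of a] tri_nonneg[of a]
      by (intro AE_I2 mult_left_mono) (auto simp: abs_of_nonneg)
  qed measurable
  have "(LINT y|lborel. vdp b y * vdp b' (x - y)) = (LINT y|lborel. vdp b' y * vdp b (x - y))"
    by (subst lborel_integral_real_affine[of "- 1" _ x]) (simp_all add: mult.commute)
  also have "\<dots> = (LINT y|lborel. (vdp b' y * tri (2 * b) (x - y) - vdp b' y * tri b (x - y)) / (b * tri_mass))"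
    by (rule Bochner_Integration.integral_cong) (simp_all add: vdp_def[of b] right_diff_distrib)
  also have "\<dots> = vdp b x"
    using assms int[of "2 * b"] int[of b] *[of "2 * b"] *[of b] by (simp add: vdp_def[of b])
  finally show ?thesis .
qed

section \<open>Product kernels in several variables\<close>

lemma lborel_prod_Basis:
  fixes f :: "'e::euclidean_space \<Rightarrow> real \<Rightarrow> real"
  assumes f: "\<And>i. i \<in> Basis \<Longrightarrow> integrable lborel (f i)"
  shows "integrable lborel (\<lambda>x. \<Prod>i\<in>Basis. f i (x \<bullet> i))"
    and "(LINT x|lborel. (\<Prod>i\<in>Basis. f i (x \<bullet> i))) = (\<Prod>i\<in>Basis. (LINT s|lborel. f i s))"
proof -
  interpret product_sigma_finite "\<lambda>i::'e. lborel :: real measure"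
    by (simp add: product_sigma_finite_def lborel.sigma_finite_measure_axioms)
  let ?P = "Pi\<^sub>M (Basis :: 'e set) (\<lambda>_. lborel :: real measure)"
  let ?T = "\<lambda>w. \<Sum>b\<in>Basis. w b *\<^sub>R b :: 'e"
  have [measurable]: "f i \<in> borel_measurable borel" if "i \<in> Basis" for i using f[OF that] by simp
  have T: "?T \<in> measurable ?P borel" by measurable
  have coord: "?T w \<bullet> i = w i" if "i \<in> Basis" for w i
    using that by (simp add: inner_sum_left inner_Basis if_distrib cong: if_cong)
  have F: "(\<lambda>x::'e. \<Prod>i\<in>Basis. f i (x \<bullet> i)) \<in> borel_measurable borel" by measurable
  have eq: "(\<Prod>i\<in>Basis. f i (?T w \<bullet> i)) = (\<Prod>i\<in>Basis. f i (w i))" for w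
    by (intro prod.cong) (auto simp: coord)
  show "integrable lborel (\<lambda>x. \<Prod>i\<in>Basis. f i (x \<bullet> i))"
    by (subst lborel_eq, subst integrable_distr_eq[OF T F], unfold eq)
      (rule product_integrable_prod[OF finite_Basis f])
  show "(LINT x|lborel. (\<Prod>i\<in>Basis. f i (x \<bullet> i))) = (\<Prod>i\<in>Basis. (LINT s|lborel. f i s))"
    by (subst lborel_eq, subst integral_distr[OF T F], unfold eq)
      (rule product_integral_prod[OF finite_Basis f])
qed

definition vdp_prod :: "real \<Rightarrow> 'e::euclidean_space \<Rightarrow> real" where
  "vdp_prod b x = (\<Prod>i\<in>Basis. vdp b (x \<bullet> i))"

lemma integrable_vdp_prod: "integrable lborel (vdp_prod b :: 'e::euclidean_space \<Rightarrow> real)"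
  unfolding vdp_prod_def[abs_def] by (rule lborel_prod_Basis(1)[OF integrable_vdp])

lemma vdp_prod_measurable [measurable]: "vdp_prod b \<in> borel_measurable (borel :: 'e::euclidean_space measure)"
  using borel_measurable_integrable[OF integrable_vdp_prod[of b, where 'e = 'e]] by simp

lemma integral_vdp_prod: "b > 0 \<Longrightarrow> (LINT x|lborel. vdp_prod b (x :: 'e::euclidean_space)) = 1"
  unfolding vdp_prod_def by (simp add: lborel_prod_Basis(2)[OF integrable_vdp] integral_vdp)

lemma integral_abs_vdp_prod_le:
  assumes "b > 0"
  shows "(LINT x|lborel. \<bar>vdp_prod b (x :: 'e::euclidean_space)\<bar>) \<le> 3 ^ DIM('e)"
proof -
  have "(LINT x|lborel. \<bar>vdp_prod b (x :: 'e)\<bar>) = (\<Prod>i\<in>(Basis :: 'e set). (LINT s|lborel. \<bar>vdp b s\<bar>))"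
    unfolding vdp_prod_def abs_prod using integrable_vdp
    by (intro lborel_prod_Basis(2)[of "\<lambda>_ s. \<bar>vdp b s\<bar>"]) auto
  also have "\<dots> \<le> (\<Prod>i\<in>(Basis :: 'e set). 3)"
    using integral_abs_vdp_le[OF assms] by (intro prod_mono) auto
  finally show ?thesis by simp
qed

lemma conv_vdp_prod:
  assumes "b > 0" "b' \<ge> 2 * b"
  shows "(LINT y|lborel. vdp_prod b y * vdp_prod b' (x - y)) = vdp_prod b (x :: 'e::euclidean_space)"
proof -
  have int: "integrable lborel (\<lambda>s. vdp b s * vdp b' (t - s))" for t
  proof (rule Bochner_Integration.integrable_bound)
    define K where "K = ((2 * b')\<^sup>2 / 2 + b'\<^sup>2 / 2) / (b' * tri_mass)"
    show "integrable lborel (\<lambda>s. vdp b s * K)" using integrable_vdp by simp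
    have "\<bar>vdp b' u\<bar> \<le> \<bar>K\<bar>" for u
    proof -
      have "\<bar>tri (2 * b') u - tri b' u\<bar> \<le> (2 * b')\<^sup>2 / 2 + b'\<^sup>2 / 2"
        using tri_le[of "2 * b'" u] tri_le[of b' u] tri_nonneg[of "2 * b'" u] tri_nonneg[of b' u] by linarith
      then show ?thesis unfolding vdp_def K_def abs_divide by (intro divide_right_mono) auto
    qed
    then show "AE s in lborel. norm (vdp b s * vdp b' (t - s)) \<le> norm (vdp b s * K)"
      unfolding real_norm_def abs_mult by (intro AE_I2 mult_left_mono) auto
  qed measurable
  show ?thesis
    using lborel_prod_Basis(2)[of "\<lambda>i s. vdp b s * vdp b' (x \<bullet> i - s)", OF int] conv_vdp[OF assms]
    by (simp add: vdp_prod_def prod.distrib inner_diff_left)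
qed

lemma vdp_prod_scale: "vdp_prod b (x :: 'e::euclidean_space) = b ^ DIM('e) * vdp_prod 1 (b *\<^sub>R x)"
proof -
  have "vdp_prod b x = (\<Prod>i\<in>Basis. b * vdp 1 (b * (x \<bullet> i)))"
    unfolding vdp_prod_def by (intro prod.cong refl vdp_scale)
  then show ?thesis by (simp add: vdp_prod_def prod.distrib)
qed

text \<open>Substitution y = z / b: the Jacobian cancels the scaling factor of the kernel, so b
  survives only in the argument of h.\<close>

lemma integral_vdp_prod_scale:
  fixes h :: "'e::euclidean_space \<Rightarrow> real"
  assumes b: "b > 0" and [measurable]: "h \<in> borel_measurable borel"
  shows "(LINT y|lborel. \<bar>vdp_prod b y\<bar> * h y) = (LINT z|lborel. \<bar>vdp_prod 1 z\<bar> * h (z /\<^sub>R b))"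
proof -
  let ?c = "inverse b"
  have "(LINT y|lborel. \<bar>vdp_prod b y\<bar> * h y) =
    (LINT y|density (distr lborel borel (\<lambda>x. 0 + ?c *\<^sub>R x)) (\<lambda>_. \<bar>?c\<bar> ^ DIM('e)). \<bar>vdp_prod b y\<bar> * h y)"
    using b by (subst lborel_affine[of ?c 0]) auto
  also have "\<dots> = (LINT y|distr lborel borel (\<lambda>x. 0 + ?c *\<^sub>R x). \<bar>?c\<bar> ^ DIM('e) * (\<bar>vdp_prod b y\<bar> * h y))"
    using b by (subst integral_density) auto
  also have "\<dots> = (LINT z|lborel. \<bar>?c\<bar> ^ DIM('e) * (\<bar>vdp_prod b (?c *\<^sub>R z)\<bar> * h (?c *\<^sub>R z)))"
    by (subst integral_distr) auto
  also have "\<dots> = (LINT z|lborel. \<bar>vdp_prod 1 z\<bar> * h (z /\<^sub>R b))"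
  proof (rule Bochner_Integration.integral_cong)
    fix z :: 'e
    have "\<bar>?c\<bar> ^ DIM('e) * \<bar>vdp_prod b (?c *\<^sub>R z)\<bar> = \<bar>vdp_prod 1 z\<bar>"
      using b vdp_prod_scale[of b "?c *\<^sub>R z"] by (simp add: abs_mult power_mult_distrib[symmetric] flip: mult.assoc)
    then show "\<bar>?c\<bar> ^ DIM('e) * (\<bar>vdp_prod b (?c *\<^sub>R z)\<bar> * h (?c *\<^sub>R z)) = \<bar>vdp_prod 1 z\<bar> * h (z /\<^sub>R b)"
      by (simp only: mult.assoc[symmetric])
  qed simp
  finally show ?thesis .
qed

definition vdp_L1 :: "real \<Rightarrow> 'e::euclidean_space L1" where
  "vdp_L1 b = abs_L1 (\<lambda>x. complex_of_real (vdp_prod b x))"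

lemma integrable_of_real_vdp_prod:
  "integrable lborel (\<lambda>x. complex_of_real (vdp_prod b (x :: 'e::euclidean_space)))"
  using integrable_vdp_prod[of b, where 'e = 'e] by simp

lemma norm_vdp_L1: "b > 0 \<Longrightarrow> norm (vdp_L1 b :: 'e::euclidean_space L1) \<le> 3 ^ DIM('e)"
  unfolding vdp_L1_def norm_L1.abs_eq[OF L1_rel_refl[OF integrable_of_real_vdp_prod]]
  using integral_abs_vdp_prod_le[of b, where 'e = 'e] by simp

lemma conv_vdp_L1:
  assumes "b > 0" "b' \<ge> 2 * b"
  shows "conv (vdp_L1 b) (vdp_L1 b') = (vdp_L1 b :: 'e::euclidean_space L1)"
  unfolding vdp_L1_def
    conv.abs_eq[OF L1_rel_refl[OF integrable_of_real_vdp_prod] L1_rel_refl[OF integrable_of_real_vdp_prod]]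
  by (simp add: conv_vdp_prod[OF assms] flip: of_real_mult)

lemma AE_rep_vdp_L1:
  "AE y in lborel. rep_L1 (vdp_L1 b) y = complex_of_real (vdp_prod b (y :: 'e::euclidean_space))"
proof -
  have "L1_rel (rep_L1 (vdp_L1 b)) (\<lambda>x. complex_of_real (vdp_prod b (x :: 'e)))"
    unfolding vdp_L1_def
    by (rule Quotient_rep_abs[OF Quotient_L1]) (rule L1_rel_refl[OF integrable_of_real_vdp_prod])
  then show ?thesis by (simp add: L1_rel_def)
qed

text \<open>The discretisation estimate with r = 0. As the kernel has integral 1, the discretised
  convolution is h itself.\<close>

lemma norm_conv_vdp_L1_diff:
  fixes h :: "'e::euclidean_space L1"
  assumes b: "b > 0" and meas: "(\<lambda>y. norm (translate y h - h)) \<in> borel_measurable borel"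
  shows "norm (conv (vdp_L1 b) h - h) \<le> (LINT z|lborel. \<bar>vdp_prod 1 z\<bar> * norm (translate (z /\<^sub>R b) h - h))"
proof -
  let ?e = "rep_L1 (vdp_L1 b :: 'e L1)"
  have [measurable]: "?e \<in> borel_measurable borel" using integrable_rep_L1[of "vdp_L1 b :: 'e L1"] by simp
  have "(LINT y|lborel. ?e y) = (LINT y|lborel. complex_of_real (vdp_prod b (y :: 'e)))"
    by (intro integral_cong_AE AE_rep_vdp_L1) measurable
  then have "(LINT y|lborel. ?e y) = 1" using integral_vdp_prod[OF b, where 'e = 'e] by simp
  then have eq: "(\<lambda>x. LINT y|lborel. ?e y * rep_L1 h (x - 0)) = rep_L1 h" by simp
  have "norm (conv (vdp_L1 b) h - h) \<le> (LINT y|lborel. cmod (?e y) * norm (translate y h - h))"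
    using norm_conv_superposition(2)[of "\<lambda>_. 0" "vdp_L1 b" h] unfolding eq
    by (simp add: abs_rep_L1 translate_simps)
  also have "\<dots> = (LINT y|lborel. \<bar>vdp_prod b y\<bar> * norm (translate y h - h))"
    using AE_rep_vdp_L1[of b, where 'e = 'e] meas by (intro integral_cong_AE) (auto elim!: eventually_mono)
  also have "\<dots> = (LINT z|lborel. \<bar>vdp_prod 1 z\<bar> * norm (translate (z /\<^sub>R b) h - h))"
    by (rule integral_vdp_prod_scale[OF b meas])
  finally show ?thesis .
qed

section \<open>Proper Segal algebras\<close>

lemma norm_conv_le: "norm (conv f g) \<le> norm f * norm (g :: 'e::euclidean_space L1)"
proof (transfer, goal_cases)
  case (1 f g)
  then have f: "integrable lborel f" and g: "integrable lborel g" by (auto simp: L1_rel_def)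
  have k: "integrable (lborel \<Otimes>\<^sub>M lborel) (\<lambda>(y, x). f y * g (x - y))"
    using integrable_translation_kernel[OF lborel.sigma_finite_measure_axioms f g, of "\<lambda>z. z"] by simp
  have kn: "integrable (lborel \<Otimes>\<^sub>M lborel) (\<lambda>(y, x). cmod (f y * g (x - y)))"
    using integrable_norm[OF k] by (simp add: case_prod_beta')
  have "(LINT x|lborel. cmod (LINT y|lborel. f y * g (x - y))) \<le>
      (LINT x|lborel. LINT y|lborel. cmod (f y * g (x - y)))"
    using integrable_convolution[OF f g] lborel_pair.integrable_snd[OF kn]
    by (intro integral_mono integral_norm_bound integrable_norm)
  also have "\<dots> = (LINT y|lborel. LINT x|lborel. cmod (f y * g (x - y)))"
    by (rule lborel_pair.Fubini_integral[OF kn])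
  also have "\<dots> = (LINT y|lborel. cmod (f y)) * (LINT x|lborel. cmod (g x))"
    by (simp add: norm_mult integral_norm_lborel_shift[OF g])
  finally show ?case .
qed

context segal
begin

sublocale comm_banach_algebra S N scaleC_L1 conv
proof
  show "N (conv f g) \<le> N f * N g" if "f \<in> S" "g \<in> S" for f g
    using N_conv[OF that(2), of f] mult_right_mono[OF norm_le_N[OF that(1)] N_nonneg[OF that(2)]] by linarith
  show "conv f g = conv g f" "conv (conv f g) h = conv f (conv g h)" for f g h :: "'e L1"
    by (rule conv_commute conv_assoc)+
qed (simp_all add: conv_mem conv_add_right conv_scaleC_right)

lemma alg_eq: "alg = A"
  by (simp add: alg_def L1_subalgebra_def)

lemma dense_approx:
  assumes "e > 0"
  obtains g where "g \<in> S" "norm (f - g) < e"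
proof -
  have "f \<in> closure S" using dense by simp
  then obtain g where "g \<in> S" "dist g f < e" using assms by (auto simp: closure_approachable)
  then show ?thesis using that by (simp add: dist_norm norm_minus_commute)
qed

text \<open>
  If \<open>V\<close> acts as a unit on \<open>h\<close>, approximate \<open>V\<close> by \<open>f \<in> S\<close> and solve \<open>h = h f + h (V - f)\<close>
  by a Neumann series in the ideal \<open>S\<close>.
\<close>

lemma mem_of_local_unit:
  assumes V: "conv h V = h"
  shows "h \<in> S"
proof -
  obtain f where f: "f \<in> S" "norm (V - f) < 1 / 2" using dense_approx[of "1/2" V] by auto
  define g where "g = V - f"
  define p where "p m = ((\<lambda>x. conv x g) ^^ m) h" for m
  have p_Suc: "p (Suc m) = conv (p m) g" and p0: "p 0 = h" for m by (simp_all add: p_def)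
  \<comment> \<open>By commutativity V stays a local unit for every remainder, so the same
    decomposition can be repeated.\<close>
  have unit: "conv (p m) V = p m" for m
  proof (induction m)
    case (Suc m)
    have "conv (conv (p m) g) V = conv (conv (p m) V) g"
      by (simp add: conv_assoc conv_commute[of g V])
    then show ?case by (simp add: p_Suc Suc)
  qed (simp add: p0 V)
  have step: "p m = conv (p m) f + p (Suc m)" for m
  proof -
    have "p m = conv (p m) (f + g)" by (simp add: g_def unit)
    then show ?thesis by (simp add: p_Suc conv_add_right)
  qed
  have sum: "h = (\<Sum>j<m. conv (p j) f) + p m" for m
  proof (induction m)
    case (Suc m)
    have "h = (\<Sum>j<m. conv (p j) f) + (conv (p m) f + p (Suc m))" using Suc step[of m] by simp
    then show ?case by (simp add: add.assoc)
  qed (simp add: p0)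
  have norm_p: "norm (p m) \<le> (1/2) ^ m * norm h" for m
  proof (induction m)
    case (Suc m)
    have "norm (p (Suc m)) \<le> norm (p m) * norm g" unfolding p_Suc by (rule norm_conv_le)
    also have "\<dots> \<le> ((1/2) ^ m * norm h) * (1/2)" using Suc f(2) by (intro mult_mono) (auto simp: g_def)
    finally show ?case by (simp add: mult_ac)
  qed (simp add: p0)
  have pf: "conv (p j) f \<in> S" for j by (rule conv_mem[OF f(1)])
  have geo: "summable (\<lambda>j. (1/2) ^ j :: real)" by (intro summable_geometric) simp
  have "summable (\<lambda>j. N (conv (p j) f))"
  proof (rule summable_comparison_test'[OF summable_mult2[OF geo, of "norm h * N f"], of 0])
    fix j
    have "N (conv (p j) f) \<le> norm (p j) * N f" by (rule N_conv[OF f(1)])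
    also have "\<dots> \<le> (1/2) ^ j * norm h * N f" by (intro mult_right_mono norm_p N_nonneg f)
    finally show "norm (N (conv (p j) f)) \<le> (1/2) ^ j * (norm h * N f)"
      using N_nonneg[OF pf[of j]] by (simp add: mult.assoc)
  qed
  from abs_summable_series[OF pf this] obtain a where
    a: "a \<in> S" "(\<lambda>n. N ((\<Sum>j<n. conv (p j) f) - a)) \<longlonglongrightarrow> 0" by blast
  \<comment> \<open>The remainders tend to 0 only in L^1, the partial sums converge even in
    \<open>N\<close>; comparing both limits in L^1 gives h = a.\<close>
  have "norm (h - a) \<le> (1/2) ^ n * norm h + N ((\<Sum>j<n. conv (p j) f) - a)" for n
  proof -
    have "h - a = p n + ((\<Sum>j<n. conv (p j) f) - a)" using sum[of n] by (simp add: algebra_simps)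
    then have "norm (h - a) \<le> norm (p n) + norm ((\<Sum>j<n. conv (p j) f) - a)"
      by (simp only: norm_triangle_ineq)
    also have "\<dots> \<le> (1/2) ^ n * norm h + N ((\<Sum>j<n. conv (p j) f) - a)"
      by (intro add_mono norm_p norm_le_N diff_mem sum_mem pf a)
    finally show ?thesis .
  qed
  moreover have "(\<lambda>n. (1/2) ^ n * norm h + N ((\<Sum>j<n. conv (p j) f) - a)) \<longlonglongrightarrow> 0 * norm h + 0"
    by (intro tendsto_intros a LIMSEQ_power_zero) simp
  ultimately have "norm (h - a) \<le> 0"
    by (intro tendsto_lowerbound[of _ 0 sequentially]) auto
  with a(1) show ?thesis by simp
qed

text \<open>Continuity in the L^1 norm is inherited from \<open>N\<close>, which dominates it and in
  which translations of h are continuous.\<close>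

lemma norm_translate_measurable:
  assumes h: "h \<in> S"
  shows "(\<lambda>y. norm (translate y h - h)) \<in> borel_measurable borel"
proof (rule borel_measurable_continuous_onI)
  have diff: "norm (translate y h - translate x h) \<le> N (translate (y - x) h - h)" for x y
    using norm_le_N[of "translate y h - translate x h"] N_translate_diff[OF h, of y x] h
    by (simp add: diff_mem translate_mem)
  show "continuous_on UNIV (\<lambda>y. norm (translate y h - h))"
  proof (rule continuous_at_imp_continuous_on, intro ballI)
    fix x
    have "((\<lambda>y. N (translate (y - x) h - h)) \<longlongrightarrow> N (translate (x - x) h - h)) (at x)"
      by (rule continuous_on_tendsto_compose[OF continuous_translate[OF h]]) (auto intro!: tendsto_eq_intros)
    then have lim: "((\<lambda>y. N (translate (y - x) h - h)) \<longlongrightarrow> 0) (at x)" using N_zero_iff[OF zero_mem] by (simp add: translate_simps)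
    have "norm (norm (translate y h - h) - norm (translate x h - h)) \<le> N (translate (y - x) h - h)" for y
    proof -
      have "\<bar>norm (translate y h - h) - norm (translate x h - h)\<bar> \<le> norm ((translate y h - h) - (translate x h - h))"
        by (rule norm_triangle_ineq3)
      also have "(translate y h - h) - (translate x h - h) = translate y h - translate x h" by simp
      also note diff[of y x]
      finally show ?thesis by (simp only: real_norm_def)
    qed
    then have "\<forall>\<^sub>F y in at x. norm (norm (translate y h - h) - norm (translate x h - h)) \<le> N (translate (y - x) h - h)"
      by (intro always_eventually allI)
    then have "((\<lambda>y. norm (translate y h - h) - norm (translate x h - h)) \<longlongrightarrow> 0) (at x)"
      using lim by (rule Lim_null_comparison)
    then show "isCont (\<lambda>y. norm (translate y h - h)) x"
      unfolding isCont_def by (rule LIM_zero_cancel)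
  qed
qed

text \<open>After rescaling, the kernel is fixed and the translations shrink to 0, so dominated
  convergence applies. For h in \<open>S\<close> the required continuity of translations is part of
  the Segal structure.\<close>

lemma vdp_approximate_identity:
  assumes h: "h \<in> S"
  shows "(\<lambda>n. norm (conv (vdp_L1 (2 ^ n)) h - h)) \<longlonglongrightarrow> 0"
proof (rule tendsto_sandwich[of "\<lambda>_. 0"])
  note [measurable] = norm_translate_measurable[OF h]
  show "(\<lambda>n. LINT z|lborel. \<bar>vdp_prod 1 z\<bar> * norm (translate (z /\<^sub>R 2 ^ n) h - h)) \<longlonglongrightarrow> 0"
  proof -
    have "(\<lambda>n. LINT z|lborel. \<bar>vdp_prod 1 z\<bar> * norm (translate (z /\<^sub>R 2 ^ n) h - h)) \<longlonglongrightarrow>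
        (LINT z|lborel. \<bar>vdp_prod 1 (z :: 'e)\<bar> * 0)"
    proof (rule integral_dominated_convergence[where w = "\<lambda>z. \<bar>vdp_prod 1 z\<bar> * (2 * N h)"])
      show "integrable lborel (\<lambda>z. \<bar>vdp_prod 1 (z :: 'e)\<bar> * (2 * N h))" using integrable_vdp_prod by auto
      show "AE z in lborel. (\<lambda>n. \<bar>vdp_prod 1 z\<bar> * norm (translate (z /\<^sub>R 2 ^ n) h - h)) \<longlonglongrightarrow> \<bar>vdp_prod 1 z\<bar> * 0"
      proof (intro AE_I2 tendsto_mult tendsto_const)
        fix z :: 'e
        have "(\<lambda>n. inverse (2 ^ n :: real)) \<longlonglongrightarrow> 0"
          using LIMSEQ_power_zero[of "1/2 :: real"] by (simp add: power_one_over inverse_eq_divide)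
        then have "(\<lambda>n. z /\<^sub>R 2 ^ n) \<longlonglongrightarrow> 0 *\<^sub>R z" by (intro tendsto_scaleR tendsto_const)
        then have "(\<lambda>n. N (translate (z /\<^sub>R 2 ^ n) h - h)) \<longlonglongrightarrow> N (translate 0 h - h)"
          by (intro continuous_on_tendsto_compose[OF continuous_translate[OF h]]) auto
        then have "(\<lambda>n. N (translate (z /\<^sub>R 2 ^ n) h - h)) \<longlonglongrightarrow> 0"
            using N_zero_iff[OF zero_mem] by (simp add: translate_simps)
        then show "(\<lambda>n. norm (translate (z /\<^sub>R 2 ^ n) h - h)) \<longlonglongrightarrow> 0"
          by (rule Lim_null_comparison[rotated])
            (simp add: always_eventually norm_le_N diff_mem translate_mem h)
      qed
      show "AE z in lborel. norm (\<bar>vdp_prod 1 z\<bar> * norm (translate (z /\<^sub>R 2 ^ n) h - h)) \<le> \<bar>vdp_prod 1 z\<bar> * (2 * N h)" for n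
      proof (intro AE_I2)
        fix z :: 'e
        have "norm (translate (z /\<^sub>R 2 ^ n) h - h) \<le> 2 * N h"
          using norm_le_N[OF diff_mem[OF translate_mem[OF h] h], of "z /\<^sub>R 2 ^ n"]
            N_translate_diff_le[OF h, of "z /\<^sub>R 2 ^ n"] by linarith
        then show "norm (\<bar>vdp_prod 1 z\<bar> * norm (translate (z /\<^sub>R 2 ^ n) h - h)) \<le> \<bar>vdp_prod 1 z\<bar> * (2 * N h)"
          by (simp add: abs_mult mult_left_mono)
      qed
    qed measurable
    then show ?thesis by simp
  qed
  show "\<forall>\<^sub>F n in sequentially. norm (conv (vdp_L1 (2 ^ n)) h - h) \<le>
      (LINT z|lborel. \<bar>vdp_prod 1 z\<bar> * norm (translate (z /\<^sub>R 2 ^ n) h - h))"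
    by (intro always_eventually allI norm_conv_vdp_L1_diff norm_translate_measurable[OF h]) simp
qed simp_all

definition E :: "nat \<Rightarrow> 'e L1" where "E n = vdp_L1 (2 ^ n)"

lemma E_mul: "m < n \<Longrightarrow> conv (E m) (E n) = E m"
  unfolding E_def
proof (rule conv_vdp_L1)
  assume "m < n"
  then have "(2::real) ^ Suc m \<le> 2 ^ n" by (intro power_increasing) auto
  then show "2 * 2 ^ m \<le> (2::real) ^ n" by simp
qed simp

lemma E_mem: "E n \<in> S"
  using mem_of_local_unit[OF E_mul[of n "Suc n"]] by simp

text \<open>If x has the local unit \<open>E n\<close>, then x = x \<open>E n\<close> and the ideal
  estimate gives N x \<le> C norm x. Elements of the form \<open>conv (E k) g\<close> with g in
  \<open>S\<close> have such units and are dense in L^1, so a sequence of them converging in L^1 is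
  Cauchy in \<open>N\<close>.\<close>

lemma bounded_imp_eq_UNIV:
  assumes C: "\<And>n. N (E n) \<le> C"
  shows "S = UNIV"
proof -
  have C0: "C \<ge> 0" using C[of 0] N_nonneg[OF E_mem[of 0]] by simp
  have "f \<in> S" for f
  proof -
    have "\<exists>g k. g \<in> S \<and> norm (f - conv (E k) g) < 2 * (1/2) ^ j" for j :: nat
    proof -
      obtain g where g: "g \<in> S" "norm (f - g) < (1/2) ^ j" using dense_approx[of "(1/2) ^ j" f] by auto
      obtain k where k: "norm (conv (E k) g - g) < (1/2) ^ j"
        using LIMSEQ_D[OF vdp_approximate_identity[OF g(1)], of "(1/2) ^ j"] by (auto simp: E_def)
      have "norm (f - conv (E k) g) \<le> norm (f - g) + norm (conv (E k) g - g)"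
        using norm_triangle_ineq4[of "f - g" "conv (E k) g - g"] by simp
      with g k show ?thesis by (intro exI[of _ g] exI[of _ k]) auto
    qed
    then have "\<forall>j. \<exists>g. \<exists>k. g \<in> S \<and> norm (f - conv (E k) g) < 2 * (1/2) ^ j" by (rule allI)
    from choice[OF this] have "\<exists>G. \<forall>j. \<exists>k. G j \<in> S \<and> norm (f - conv (E k) (G j)) < 2 * (1/2) ^ j" .
    then obtain G where "\<forall>j. \<exists>k. G j \<in> S \<and> norm (f - conv (E k) (G j)) < 2 * (1/2) ^ j" by blast
    from choice[OF this] obtain k where Gk: "\<And>j. G j \<in> S" "\<And>j. norm (f - conv (E (k j)) (G j)) < 2 * (1/2) ^ j"
      by auto
    define X where "X j = conv (E (k j)) (G j)" for j
    have X: "X j \<in> S" for j by (simp add: X_def conv_mem Gk)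
    have close: "norm (f - X j) < 2 * (1/2) ^ j" for j using Gk(2) by (simp add: X_def)
    have N_le: "N (X i - X j) \<le> norm (X i - X j) * C" for i j
    proof -
      \<comment> \<open>Beyond both indices, so that one kernel is a local unit for both elements
        and hence for their difference.\<close>
      define n where "n = Suc (max (k i) (k j))"
      have unit: "conv (X l) (E n) = X l" if "k l < n" for l
        by (simp add: X_def conv_commute[of _ "G l"] conv_assoc E_mul[OF that])
      have "conv (X i - X j) (E n) = X i - X j"
        using unit[of i] unit[of j] by (simp add: mul_diff n_def)
      then have "N (X i - X j) \<le> norm (X i - X j) * N (E n)" using N_conv[OF E_mem, of "X i - X j" n] by simp
      also have "\<dots> \<le> norm (X i - X j) * C" by (intro mult_left_mono C) simp
      finally show ?thesis .
    qed
    have pow0: "(\<lambda>j. 2 * (1/2) ^ j :: real) \<longlonglongrightarrow> 0"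
      using tendsto_mult_left[OF LIMSEQ_power_zero[of "1/2 :: real"], of 2] by simp
    have "\<exists>l\<in>S. (\<lambda>n. N (X n - l)) \<longlonglongrightarrow> 0"
    proof (rule complete[OF X])
      fix e :: real assume e: "e > 0"
      then have "e / (2 * (C + 1)) > 0" using C0 by simp
      from LIMSEQ_D[OF pow0 this] obtain M where M: "\<And>j. j \<ge> M \<Longrightarrow> 2 * (1/2) ^ j < e / (2 * (C + 1))" by auto
      have "N (X i - X j) < e" if "i \<ge> M" "j \<ge> M" for i j
      proof -
        have "norm (X i - X j) \<le> norm (f - X j) + norm (f - X i)"
          using norm_triangle_ineq4[of "f - X j" "f - X i"] by simp
        also have "\<dots> < e / (2 * (C + 1)) + e / (2 * (C + 1))"
          using close[of i] close[of j] M[OF that(1)] M[OF that(2)] by linarith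
        also have "\<dots> = e / (C + 1)"
        proof -
          have "e / (2 * (C + 1)) = e / (C + 1) / 2" by simp
          then show ?thesis by (simp only: field_sum_of_halves)
        qed
        finally have *: "norm (X i - X j) < e / (C + 1)" .
        have "N (X i - X j) \<le> norm (X i - X j) * (C + 1)"
          using N_le[of i j] norm_ge_zero[of "X i - X j"] unfolding distrib_left by linarith
        also have "\<dots> < e / (C + 1) * (C + 1)" using * C0 by (intro mult_strict_right_mono) auto
        finally show ?thesis using C0 by simp
      qed
      then show "\<exists>M. \<forall>m\<ge>M. \<forall>n\<ge>M. N (X m - X n) < e" by blast
    qed
    then obtain l where l: "l \<in> S" "(\<lambda>n. N (X n - l)) \<longlonglongrightarrow> 0" by blast
    have "norm (f - l) \<le> 2 * (1/2) ^ n + N (X n - l)" for n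
    proof -
      have "norm (f - l) \<le> norm (f - X n) + norm (X n - l)"
        using norm_triangle_ineq[of "f - X n" "X n - l"] by simp
      with close[of n] norm_le_N[OF diff_mem[OF X l(1)], of n] show ?thesis by linarith
    qed
    moreover have "(\<lambda>n. 2 * (1/2) ^ n + N (X n - l)) \<longlonglongrightarrow> 0"
      using tendsto_add[OF pow0 l(2)] by simp
    ultimately have "norm (f - l) \<le> 0"
      by (intro tendsto_lowerbound[of _ 0 sequentially]) auto
    with l(1) show ?thesis by simp
  qed
  then show ?thesis by blast
qed

theorem proper_not_approximately_amenable:
  assumes "S \<noteq> UNIV"
  shows "\<not> approximately_amenable TYPE('e L1 bimodule_univ) A"
proof -
  have "\<not> approximately_amenable TYPE('e L1 bimodule_univ) alg"
  proof (rule not_approximately_amenable[of E "3 ^ DIM('e)"])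
    show "N (conv (E n) x) \<le> 3 ^ DIM('e) * N x" if "x \<in> S" for n x
      using N_conv[OF that, of "E n"] mult_right_mono[OF norm_vdp_L1[of "2 ^ n", where 'e = 'e] N_nonneg[OF that]]
      by (simp add: E_def)
    show "\<exists>n. N (E n) > C" for C
    proof (rule ccontr)
      assume "\<not> ?thesis"
      then have "N (E n) \<le> C" for n by (simp add: not_less)
      with bounded_imp_eq_UNIV[of C] assms show False by blast
    qed
  qed (simp_all add: E_mem E_mul)
  then show ?thesis unfolding alg_eq .
qed

end

theorem theorem3p1:
  fixes S :: "(real ^ 'n) L1 set" and N :: "(real ^ 'n) L1 \<Rightarrow> real"
  assumes "segal_algebra S N" and "S \<noteq> UNIV"
  shows "\<not> approximately_amenable TYPE((real ^ 'n) L1 bimodule_univ) (L1_subalgebra S N)"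
proof -
  interpret segal S N by unfold_locales (rule assms(1))
  show ?thesis by (rule proper_not_approximately_amenable[OF assms(2)])
qed

end
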